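(* Let $\mathcal{M}=(M_i,S_i,g_i,\pi_i)_{i\geq1}$ be the multi-sorted structure described in the context, $T=\operatorname{Th}(\mathcal{M})$, and work in a saturated model of $T$. Let $a$ be an element of the sort $M_1$, $p=\operatorname{tp}(a)$ and $\bar{\bar p}=\operatorname{tp}(\operatorname{acl}(a))$ (types over $\emptyset=\operatorname{acl}^{\mathrm{eq}}(\emptyset)$). Then $p$ is a Lascar strong type, but $\bar{\bar p}$ is not a Lascar strong type.
   Context: For each $i\geq1$, $M_i$ is a copy of the unit circle (viewed in the complex plane), the $M_i$ pairwise disjoint sorts; $S_i$ is the ternary relation on $M_i$ with $S_i(a,b,c)$ iff $a,b,c$ are distinct and $b$ comes before $c$ going clockwise around the circle from $a$; $g_i:M_i\to M_i$ is the clockwise rotation by $2\pi/i$ radians; $\pi_i:M_i\to M_1$ is $x\mapsto x^i$. In this theory $\operatorname{acl}^{\mathrm{eq}}(\emptyset)=\emptyset$, so types over $\emptyset$ are strong types. Two tuples have the same Lascar type if one is mapped to the other by an automorphism in the normal subgroup of the automorphism group generated by automorphisms fixing pointwise some small elementary submodel; a type is a Lascar strong type if any two of its realizations have the same Lascar type. *)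

theory Defs
  imports
    "HOL-Analysis.Analysis"
    "HOL-Algebra.Coset"
    "HOL-Algebra.Bij"
    "HOL-Library.Equipollence"
begin

section \<open>Many-sorted first-order logic\<close>

record ('s, 'f, 'r) signature =
  sorts :: "'s set"
  fun_syms :: "'f set"
  rel_syms :: "'r set"
  fun_dom :: "'f \<Rightarrow> 's list"
  fun_cod :: "'f \<Rightarrow> 's"
  rel_dom :: "'r \<Rightarrow> 's list"

definition wf_sig :: "('s, 'f, 'r) signature \<Rightarrow> bool" where
  "wf_sig L \<longleftrightarrow>
     (\<forall>f\<in>fun_syms L. set (fun_dom L f) \<subseteq> sorts L \<and> fun_cod L f \<in> sorts L) \<and>
     (\<forall>r\<in>rel_syms L. set (rel_dom L r) \<subseteq> sorts L)"

text \<open>A variable is a pair of its sort and a number.\<close>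

datatype ('s, 'f) fo_term = Var "'s \<times> nat" | Fun 'f "('s, 'f) fo_term list"

datatype ('s, 'f, 'r) fo_form =
    Eq "('s, 'f) fo_term" "('s, 'f) fo_term"
  | Rel 'r "('s, 'f) fo_term list"
  | Neg "('s, 'f, 'r) fo_form"
  | And "('s, 'f, 'r) fo_form" "('s, 'f, 'r) fo_form"
  | Ex "'s \<times> nat" "('s, 'f, 'r) fo_form"

inductive has_sort :: "('s, 'f, 'r) signature \<Rightarrow> ('s, 'f) fo_term \<Rightarrow> 's \<Rightarrow> bool"
  for L where
  "s \<in> sorts L \<Longrightarrow> has_sort L (Var (s, n)) s"
| "f \<in> fun_syms L \<Longrightarrow> list_all2 (has_sort L) ts (fun_dom L f) \<Longrightarrow>
     has_sort L (Fun f ts) (fun_cod L f)"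

primrec wf_form :: "('s, 'f, 'r) signature \<Rightarrow> ('s, 'f, 'r) fo_form \<Rightarrow> bool" where
  "wf_form L (Eq t u) \<longleftrightarrow> (\<exists>s. has_sort L t s \<and> has_sort L u s)"
| "wf_form L (Rel r ts) \<longleftrightarrow> r \<in> rel_syms L \<and> list_all2 (has_sort L) ts (rel_dom L r)"
| "wf_form L (Neg \<phi>) \<longleftrightarrow> wf_form L \<phi>"
| "wf_form L (And \<phi> \<psi>) \<longleftrightarrow> wf_form L \<phi> \<and> wf_form L \<psi>"
| "wf_form L (Ex x \<phi>) \<longleftrightarrow> fst x \<in> sorts L \<and> wf_form L \<phi>"

primrec fv_term :: "('s, 'f) fo_term \<Rightarrow> ('s \<times> nat) set" where
  "fv_term (Var x) = {x}"
| "fv_term (Fun f ts) = \<Union> (set (map fv_term ts))"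

primrec fv :: "('s, 'f, 'r) fo_form \<Rightarrow> ('s \<times> nat) set" where
  "fv (Eq t u) = fv_term t \<union> fv_term u"
| "fv (Rel r ts) = \<Union> (fv_term ` set ts)"
| "fv (Neg \<phi>) = fv \<phi>"
| "fv (And \<phi> \<psi>) = fv \<phi> \<union> fv \<psi>"
| "fv (Ex x \<phi>) = fv \<phi> - {x}"

record ('s, 'f, 'r, 'a) fo_struct =
  dom_of :: "'s \<Rightarrow> 'a set"
  fun_of :: "'f \<Rightarrow> 'a list \<Rightarrow> 'a"
  rel_of :: "'r \<Rightarrow> 'a list \<Rightarrow> bool"

definition universe :: "('s, 'f, 'r) signature \<Rightarrow> ('s, 'f, 'r, 'a) fo_struct \<Rightarrow> 'a set" where
  "universe L N = (\<Union>s\<in>sorts L. dom_of N s)"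

abbreviation args_in :: "('s, 'f, 'r, 'a) fo_struct \<Rightarrow> 'a list \<Rightarrow> 's list \<Rightarrow> bool" where
  "args_in N xs ss \<equiv> list_all2 (\<lambda>x s. x \<in> dom_of N s) xs ss"

definition is_struct :: "('s, 'f, 'r) signature \<Rightarrow> ('s, 'f, 'r, 'a) fo_struct \<Rightarrow> bool" where
  "is_struct L N \<longleftrightarrow>
     disjoint_family_on (dom_of N) (sorts L) \<and>
     (\<forall>s\<in>sorts L. dom_of N s \<noteq> {}) \<and>
     (\<forall>f\<in>fun_syms L. \<forall>xs. args_in N xs (fun_dom L f) \<longrightarrow> fun_of N f xs \<in> dom_of N (fun_cod L f))"

primrec val :: "('s, 'f, 'r, 'a) fo_struct \<Rightarrow> ('s \<times> nat \<Rightarrow> 'a) \<Rightarrow> ('s, 'f) fo_term \<Rightarrow> 'a" where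
  "val N v (Var x) = v x"
| "val N v (Fun f ts) = fun_of N f (map (val N v) ts)"

primrec sat :: "('s, 'f, 'r, 'a) fo_struct \<Rightarrow> ('s \<times> nat \<Rightarrow> 'a) \<Rightarrow> ('s, 'f, 'r) fo_form \<Rightarrow> bool" where
  "sat N v (Eq t u) \<longleftrightarrow> val N v t = val N v u"
| "sat N v (Rel r ts) \<longleftrightarrow> rel_of N r (map (val N v) ts)"
| "sat N v (Neg \<phi>) \<longleftrightarrow> \<not> sat N v \<phi>"
| "sat N v (And \<phi> \<psi>) \<longleftrightarrow> sat N v \<phi> \<and> sat N v \<psi>"
| "sat N v (Ex x \<phi>) \<longleftrightarrow> (\<exists>a\<in>dom_of N (fst x). sat N (v(x := a)) \<phi>)"

definition Th :: "('s, 'f, 'r) signature \<Rightarrow> ('s, 'f, 'r, 'a) fo_struct \<Rightarrow> ('s, 'f, 'r) fo_form set" where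
  "Th L N = {\<phi>. wf_form L \<phi> \<and> fv \<phi> = {} \<and> (\<forall>v. sat N v \<phi>)}"

definition is_model ::
  "('s, 'f, 'r) signature \<Rightarrow> ('s, 'f, 'r, 'a) fo_struct \<Rightarrow> ('s, 'f, 'r) fo_form set \<Rightarrow> bool" where
  "is_model L N T \<longleftrightarrow> is_struct L N \<and> (\<forall>\<phi>\<in>T. \<forall>v. sat N v \<phi>)"

definition assigns ::
  "('s, 'f, 'r, 'a) fo_struct \<Rightarrow> ('s \<times> nat \<Rightarrow> 'a) \<Rightarrow> 'a set \<Rightarrow> ('s \<times> nat) set \<Rightarrow> bool" where
  "assigns N v A X \<longleftrightarrow> (\<forall>x\<in>X. v x \<in> A \<inter> dom_of N (fst x))"


section \<open>Saturation, algebraic closure, elementary submodels\<close>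

text \<open>
  A formula with parameters in \<open>A\<close> in one free variable of sort \<open>s\<close> is a pair \<open>(\<phi>, v)\<close>: the
  variable is \<open>(s, 0)\<close>, and the other free variables of \<open>\<phi>\<close> stand for the parameters given by \<open>v\<close>.
\<close>

definition forms_over ::
  "('s, 'f, 'r) signature \<Rightarrow> ('s, 'f, 'r, 'a) fo_struct \<Rightarrow> 'a set \<Rightarrow> 's
    \<Rightarrow> (('s, 'f, 'r) fo_form \<times> ('s \<times> nat \<Rightarrow> 'a)) set" where
  "forms_over L N A s = {(\<phi>, v). wf_form L \<phi> \<and> assigns N v A (fv \<phi> - {(s, 0)})}"

definition solutions ::
  "('s, 'f, 'r, 'a) fo_struct \<Rightarrow> 's \<Rightarrow> ('s, 'f, 'r) fo_form \<times> ('s \<times> nat \<Rightarrow> 'a) \<Rightarrow> 'a set" where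
  "solutions N s = (\<lambda>(\<phi>, v). {b \<in> dom_of N s. sat N (v((s, 0) := b)) \<phi>})"

definition saturated :: "('s, 'f, 'r) signature \<Rightarrow> ('s, 'f, 'r, 'a) fo_struct \<Rightarrow> bool" where
  "saturated L N \<longleftrightarrow>
     (\<forall>s\<in>sorts L. \<forall>A\<subseteq>universe L N. A \<prec> universe L N \<longrightarrow>
       (\<forall>\<Gamma>\<subseteq>forms_over L N A s.
          (\<forall>\<Delta>\<subseteq>\<Gamma>. finite \<Delta> \<longrightarrow> (\<exists>b\<in>dom_of N s. \<forall>\<gamma>\<in>\<Delta>. b \<in> solutions N s \<gamma>)) \<longrightarrow>
          (\<exists>b\<in>dom_of N s. \<forall>\<gamma>\<in>\<Gamma>. b \<in> solutions N s \<gamma>)))"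

definition acl :: "('s, 'f, 'r) signature \<Rightarrow> ('s, 'f, 'r, 'a) fo_struct \<Rightarrow> 'a set \<Rightarrow> 'a set" where
  "acl L N A =
     {b. \<exists>s\<in>sorts L. \<exists>\<gamma>\<in>forms_over L N A s. b \<in> solutions N s \<gamma> \<and> finite (solutions N s \<gamma>)}"

definition restrict_struct :: "('s, 'f, 'r, 'a) fo_struct \<Rightarrow> 'a set \<Rightarrow> ('s, 'f, 'r, 'a) fo_struct" where
  "restrict_struct N K = N\<lparr>dom_of := \<lambda>s. dom_of N s \<inter> K\<rparr>"

definition elementary_submodel ::
  "('s, 'f, 'r) signature \<Rightarrow> 'a set \<Rightarrow> ('s, 'f, 'r, 'a) fo_struct \<Rightarrow> bool" where
  "elementary_submodel L K N \<longleftrightarrow>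
     K \<subseteq> universe L N \<and>
     is_struct L (restrict_struct N K) \<and>
     (\<forall>\<phi> v. wf_form L \<phi> \<and> assigns N v K (fv \<phi>) \<longrightarrow> (sat (restrict_struct N K) v \<phi> \<longleftrightarrow> sat N v \<phi>))"


section \<open>Types of tuples and Lascar strong types\<close>

text \<open>
  Tuples are families \<open>c\<close> indexed by a possibly infinite set \<open>I\<close>. An element \<open>(\<phi>, v)\<close> of a type over
  the empty set is the formula obtained from \<open>\<phi>\<close> by letting each free variable \<open>x\<close> denote the
  \<open>v x\<close>-th coordinate of the tuple; the sorts of the coordinates are thereby part of the type.
\<close>

definition tp ::
  "('s, 'f, 'r) signature \<Rightarrow> ('s, 'f, 'r, 'a) fo_struct \<Rightarrow> 'i set \<Rightarrow> ('i \<Rightarrow> 'a)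
    \<Rightarrow> (('s, 'f, 'r) fo_form \<times> ('s \<times> nat \<Rightarrow> 'i)) set" where
  "tp L N I c = {(\<phi>, v). wf_form L \<phi> \<and> v ` fv \<phi> \<subseteq> I \<and>
     assigns N (c \<circ> v) (universe L N) (fv \<phi>) \<and> sat N (c \<circ> v) \<phi>}"

definition realizes ::
  "('s, 'f, 'r) signature \<Rightarrow> ('s, 'f, 'r, 'a) fo_struct \<Rightarrow> 'i set \<Rightarrow> ('i \<Rightarrow> 'a)
    \<Rightarrow> (('s, 'f, 'r) fo_form \<times> ('s \<times> nat \<Rightarrow> 'i)) set \<Rightarrow> bool" where
  "realizes L N I c p \<longleftrightarrow> c ` I \<subseteq> universe L N \<and> p \<subseteq> tp L N I c"

definition automorphisms ::
  "('s, 'f, 'r) signature \<Rightarrow> ('s, 'f, 'r, 'a) fo_struct \<Rightarrow> ('a \<Rightarrow> 'a) set" where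
  "automorphisms L N = {\<sigma> \<in> Bij (universe L N).
     (\<forall>s\<in>sorts L. \<sigma> ` dom_of N s = dom_of N s) \<and>
     (\<forall>f\<in>fun_syms L. \<forall>xs. args_in N xs (fun_dom L f) \<longrightarrow>
        \<sigma> (fun_of N f xs) = fun_of N f (map \<sigma> xs)) \<and>
     (\<forall>r\<in>rel_syms L. \<forall>xs. args_in N xs (rel_dom L r) \<longrightarrow>
        (rel_of N r (map \<sigma> xs) \<longleftrightarrow> rel_of N r xs))}"

lemma args_in_map:
  assumes "\<And>s. s \<in> set ss \<Longrightarrow> \<sigma> ` dom_of N s \<subseteq> dom_of N s" "args_in N xs ss"
  shows "args_in N (map \<sigma> xs) ss"
  using assms(2,1) by (induction rule: list_all2_induct) (auto simp: image_subset_iff)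

lemma args_in_universe:
  "args_in N xs ss \<Longrightarrow> set ss \<subseteq> sorts L \<Longrightarrow> set xs \<subseteq> universe L N"
  by (induction rule: list_all2_induct) (auto simp: universe_def)

lemma subgroup_automorphisms:
  assumes L: "wf_sig L" and N: "is_struct L N"
  shows "subgroup (automorphisms L N) (BijGroup (universe L N))"
proof -
  let ?U = "universe L N"
  let ?A = "automorphisms L N"
  have dom_U: "dom_of N s \<subseteq> ?U" if "s \<in> sorts L" for s
    using that by (auto simp: universe_def)
  have fdom: "set (fun_dom L f) \<subseteq> sorts L" "fun_cod L f \<in> sorts L" if "f \<in> fun_syms L" for f
    using L that by (auto simp: wf_sig_def)
  have rdom: "set (rel_dom L r) \<subseteq> sorts L" if "r \<in> rel_syms L" for r
    using L that by (auto simp: wf_sig_def)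
  have fun_U: "fun_of N f xs \<in> ?U" if "f \<in> fun_syms L" "args_in N xs (fun_dom L f)" for f xs
    using N that fdom[of f] dom_U unfolding is_struct_def by blast
  have args_img: "args_in N (map \<rho> xs) ss"
    if "\<And>s. s \<in> sorts L \<Longrightarrow> \<rho> ` dom_of N s = dom_of N s" "set ss \<subseteq> sorts L" "args_in N xs ss"
    for \<rho> xs ss
    using that by (intro args_in_map) auto
  have one: "(\<lambda>x\<in>?U. x) \<in> ?A"
  proof -
    have m: "map (\<lambda>x\<in>?U. x) xs = xs" if "set xs \<subseteq> ?U" for xs
      using that by (induction xs) auto
    have 1: "(\<lambda>x\<in>?U. x) ` dom_of N s = dom_of N s" if "s \<in> sorts L" for s
      using dom_U[OF that] by (force simp: image_iff)
    have 2: "(\<lambda>x\<in>?U. x) (fun_of N f xs) = fun_of N f (map (\<lambda>x\<in>?U. x) xs)"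
      if "f \<in> fun_syms L" "args_in N xs (fun_dom L f)" for f xs
      unfolding m[OF args_in_universe[OF that(2) fdom(1)[OF that(1)]]] using fun_U[OF that] by simp
    have 3: "rel_of N r (map (\<lambda>x\<in>?U. x) xs) \<longleftrightarrow> rel_of N r xs"
      if "r \<in> rel_syms L" "args_in N xs (rel_dom L r)" for r xs
      unfolding m[OF args_in_universe[OF that(2) rdom[OF that(1)]]] ..
    show ?thesis
      unfolding automorphisms_def using id_Bij 1 2 3 by blast
  qed
  have closed: "compose ?U \<sigma> \<tau> \<in> ?A" if \<sigma>: "\<sigma> \<in> ?A" and \<tau>: "\<tau> \<in> ?A" for \<sigma> \<tau>
  proof -
    have m: "map (compose ?U \<sigma> \<tau>) xs = map \<sigma> (map \<tau> xs)" if "set xs \<subseteq> ?U" for xs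
      using that by (induction xs) (auto simp: compose_def)
    have 1: "compose ?U \<sigma> \<tau> ` dom_of N s = dom_of N s" if "s \<in> sorts L" for s
    proof -
      have "compose ?U \<sigma> \<tau> ` dom_of N s = \<sigma> ` \<tau> ` dom_of N s"
        using dom_U[OF that] by (force simp: compose_def image_iff)
      then show ?thesis using \<sigma> \<tau> that by (simp add: automorphisms_def)
    qed
    have 2: "compose ?U \<sigma> \<tau> (fun_of N f xs) = fun_of N f (map (compose ?U \<sigma> \<tau>) xs)"
      if "f \<in> fun_syms L" "args_in N xs (fun_dom L f)" for f xs
    proof -
      have "args_in N (map \<tau> xs) (fun_dom L f)"
        using \<tau> that fdom by (intro args_img) (auto simp: automorphisms_def)
      then have "\<sigma> (fun_of N f (map \<tau> xs)) = fun_of N f (map \<sigma> (map \<tau> xs))"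
        using \<sigma> that(1) unfolding automorphisms_def by blast
      moreover have "\<tau> (fun_of N f xs) = fun_of N f (map \<tau> xs)"
        using \<tau> that unfolding automorphisms_def by blast
      ultimately show ?thesis
        unfolding m[OF args_in_universe[OF that(2) fdom(1)[OF that(1)]]]
        using fun_U[OF that] by (simp add: compose_eq)
    qed
    have 3: "rel_of N r (map (compose ?U \<sigma> \<tau>) xs) \<longleftrightarrow> rel_of N r xs"
      if "r \<in> rel_syms L" "args_in N xs (rel_dom L r)" for r xs
    proof -
      have "args_in N (map \<tau> xs) (rel_dom L r)"
        using \<tau> that rdom by (intro args_img) (auto simp: automorphisms_def)
      then have "rel_of N r (map \<sigma> (map \<tau> xs)) \<longleftrightarrow> rel_of N r (map \<tau> xs)"
        using \<sigma> that(1) unfolding automorphisms_def by blast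
      moreover have "rel_of N r (map \<tau> xs) \<longleftrightarrow> rel_of N r xs"
        using \<tau> that unfolding automorphisms_def by blast
      ultimately show ?thesis
        unfolding m[OF args_in_universe[OF that(2) rdom[OF that(1)]]] by blast
    qed
    show ?thesis
      using \<sigma> \<tau> 1 2 3 by (auto simp: automorphisms_def compose_Bij)
  qed
  have inv: "(\<lambda>x\<in>?U. inv_into ?U \<sigma> x) \<in> ?A" if \<sigma>: "\<sigma> \<in> ?A" for \<sigma>
  proof -
    let ?\<tau> = "\<lambda>x\<in>?U. inv_into ?U \<sigma> x"
    have \<sigma>B: "\<sigma> \<in> Bij ?U" using \<sigma> by (simp add: automorphisms_def)
    then have inj: "inj_on \<sigma> ?U" and surj: "\<sigma> ` ?U = ?U" by (auto simp: Bij_def bij_betw_def)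
    have l: "?\<tau> (\<sigma> x) = x" if "x \<in> ?U" for x
    proof -
      have "\<sigma> x \<in> ?U" using that surj by blast
      then show ?thesis using that inj by simp
    qed
    have r: "\<sigma> (?\<tau> x) = x" if "x \<in> ?U" for x
      using that surj by (simp add: f_inv_into_f)
    have 1: "?\<tau> ` dom_of N s = dom_of N s" if "s \<in> sorts L" for s
    proof -
      have "?\<tau> ` dom_of N s = ?\<tau> ` \<sigma> ` dom_of N s"
        using \<sigma> that by (simp add: automorphisms_def)
      also have "\<dots> = (\<lambda>x. x) ` dom_of N s"
        unfolding image_image using l dom_U[OF that] by (intro image_cong) blast+
      finally show ?thesis by simp
    qed
    have m: "map \<sigma> (map ?\<tau> xs) = xs" if "set xs \<subseteq> ?U" for xs
    proof -
      have "map (\<lambda>x. \<sigma> (?\<tau> x)) xs = map (\<lambda>x. x) xs"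
        using that r by (intro map_cong) blast+
      then show ?thesis by (simp add: comp_def)
    qed
    have 2: "?\<tau> (fun_of N f xs) = fun_of N f (map ?\<tau> xs)"
      if "f \<in> fun_syms L" "args_in N xs (fun_dom L f)" for f xs
    proof -
      have a: "args_in N (map ?\<tau> xs) (fun_dom L f)"
        using 1 that fdom by (intro args_img) auto
      then have "\<sigma> (fun_of N f (map ?\<tau> xs)) = fun_of N f (map \<sigma> (map ?\<tau> xs))"
        using \<sigma> that(1) unfolding automorphisms_def by blast
      also have "\<dots> = fun_of N f xs"
        unfolding m[OF args_in_universe[OF that(2) fdom(1)[OF that(1)]]] ..
      finally show ?thesis using l[OF fun_U[OF that(1) a]] by simp
    qed
    have 3: "rel_of N r (map ?\<tau> xs) \<longleftrightarrow> rel_of N r xs"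
      if "r \<in> rel_syms L" "args_in N xs (rel_dom L r)" for r xs
    proof -
      have "args_in N (map ?\<tau> xs) (rel_dom L r)"
        using 1 that rdom by (intro args_img) auto
      then have "rel_of N r (map \<sigma> (map ?\<tau> xs)) \<longleftrightarrow> rel_of N r (map ?\<tau> xs)"
        using \<sigma> that(1) unfolding automorphisms_def by blast
      then show ?thesis
        unfolding m[OF args_in_universe[OF that(2) rdom[OF that(1)]]] by (rule sym)
    qed
    show ?thesis
      using 1 2 3 restrict_inv_into_Bij[OF \<sigma>B] unfolding automorphisms_def by blast
  qed
  have sub: "?A \<subseteq> Bij ?U" by (auto simp: automorphisms_def)
  interpret G: group "BijGroup ?U" by (rule group_BijGroup)
  show ?thesis
  proof (rule G.subgroupI)
    show "?A \<subseteq> carrier (BijGroup ?U)" using sub by (simp add: BijGroup_def)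
    show "?A \<noteq> {}" using one by blast
    show "inv\<^bsub>BijGroup ?U\<^esub> \<sigma> \<in> ?A" if "\<sigma> \<in> ?A" for \<sigma>
      using inv[OF that] sub that by (auto simp: inv_BijGroup)
    show "\<sigma> \<otimes>\<^bsub>BijGroup ?U\<^esub> \<tau> \<in> ?A" if "\<sigma> \<in> ?A" "\<tau> \<in> ?A" for \<sigma> \<tau>
      using closed[OF that] sub that by (auto simp: BijGroup_def)
  qed
qed

definition Aut :: "('s, 'f, 'r) signature \<Rightarrow> ('s, 'f, 'r, 'a) fo_struct \<Rightarrow> ('a \<Rightarrow> 'a) monoid" where
  "Aut L N = (BijGroup (universe L N))\<lparr>carrier := automorphisms L N\<rparr>"

lemma group_Aut: "wf_sig L \<Longrightarrow> is_struct L N \<Longrightarrow> group (Aut L N)"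
  unfolding Aut_def
  using subgroup.subgroup_is_group[OF subgroup_automorphisms group_BijGroup] by blast

text \<open>
  Small means of smaller cardinality than the ambient saturated model, which in applications must
  have cardinality above that of the language for small elementary submodels to exist.
\<close>

definition fixing_small_submodel ::
  "('s, 'f, 'r) signature \<Rightarrow> ('s, 'f, 'r, 'a) fo_struct \<Rightarrow> ('a \<Rightarrow> 'a) set" where
  "fixing_small_submodel L N = {\<sigma> \<in> automorphisms L N.
     \<exists>K. elementary_submodel L K N \<and> K \<prec> universe L N \<and> (\<forall>x\<in>K. \<sigma> x = x)}"

definition normal_generated :: "('g, 'b) monoid_scheme \<Rightarrow> 'g set \<Rightarrow> 'g set" where
  "normal_generated G X = \<Inter> {H. H \<lhd> G \<and> X \<subseteq> H}"

definition same_Lascar_type ::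
  "('s, 'f, 'r) signature \<Rightarrow> ('s, 'f, 'r, 'a) fo_struct \<Rightarrow> 'i set \<Rightarrow> ('i \<Rightarrow> 'a) \<Rightarrow> ('i \<Rightarrow> 'a) \<Rightarrow> bool" where
  "same_Lascar_type L N I c d \<longleftrightarrow>
     (\<exists>\<sigma>\<in>normal_generated (Aut L N) (fixing_small_submodel L N). \<forall>i\<in>I. \<sigma> (c i) = d i)"

definition Lascar_strong_type ::
  "('s, 'f, 'r) signature \<Rightarrow> ('s, 'f, 'r, 'a) fo_struct \<Rightarrow> 'i set
    \<Rightarrow> (('s, 'f, 'r) fo_form \<times> ('s \<times> nat \<Rightarrow> 'i)) set \<Rightarrow> bool" where
  "Lascar_strong_type L N I p \<longleftrightarrow>
     (\<forall>c d. realizes L N I c p \<and> realizes L N I d p \<longrightarrow> same_Lascar_type L N I c d)"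


section \<open>The structure of circles\<close>

datatype circ_fun = Rot nat | Proj nat
datatype circ_rel = Circ nat

definition circ_sig :: "(nat, circ_fun, circ_rel) signature" where
  "circ_sig = \<lparr>
     sorts = {1..},
     fun_syms = Rot ` {1..} \<union> Proj ` {1..},
     rel_syms = Circ ` {1..},
     fun_dom = (\<lambda>f. case f of Rot i \<Rightarrow> [i] | Proj i \<Rightarrow> [i]),
     fun_cod = (\<lambda>f. case f of Rot i \<Rightarrow> i | Proj i \<Rightarrow> 1),
     rel_dom = (\<lambda>r. case r of Circ i \<Rightarrow> [i, i, i])\<rparr>"

definition clockwise :: "complex \<Rightarrow> complex \<Rightarrow> complex \<Rightarrow> bool" where
  "clockwise a b c \<longleftrightarrow>
     distinct [a, b, c] \<and>
     (\<exists>s t. 0 \<le> s \<and> s < t \<and> t < 2 * pi \<and> b = a * cis (- s) \<and> c = a * cis (- t))"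

text \<open>The copy of the unit circle of sort \<open>i\<close> is \<open>{i} \<times> sphere 0 1\<close>.\<close>

definition circ_struct :: "(nat, circ_fun, circ_rel, nat \<times> complex) fo_struct" where
  "circ_struct = \<lparr>
     dom_of = (\<lambda>i. {i} \<times> sphere 0 1),
     fun_of = (\<lambda>f xs. case f of
         Rot i \<Rightarrow> (i, snd (xs ! 0) * cis (- (2 * pi / real i)))
       | Proj i \<Rightarrow> (1, snd (xs ! 0) ^ i)),
     rel_of = (\<lambda>r xs. clockwise (snd (xs ! 0)) (snd (xs ! 1)) (snd (xs ! 2)))\<rparr>"

lemma is_struct_circ_struct: "is_struct circ_sig circ_struct"
  by (auto simp: is_struct_def circ_sig_def circ_struct_def disjoint_family_on_def
      list_all2_Cons2 norm_mult norm_power split: circ_fun.splits)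

lemma wf_sig_circ_sig: "wf_sig circ_sig"
  by (auto simp: wf_sig_def circ_sig_def)

end

theory Submission
  imports Defs
begin

text \<open>
  Clockwise order makes the sort 1 a saturated dense circular order, and each sort \<open>i\<close> is its \<open>i\<close>-fold
  cover. An increasing homeomorphism of the real line commuting with translation by \<open>2 \<pi>\<close> acts on all
  sorts at once. Such maps show in the standard model, hence by transfer in \<open>N\<close>, that
  two elements of the sort 1 have the same type over a set when no element of the set projects into the
  arc between them. Two elements of the sort 1 lying in one cut over a countable elementary submodel are
  therefore conjugate over it by homogeneity; since all pairs of distinct elements are
  conjugate over the empty set, any two elements of the sort 1 have the same Lascar type.

  On the other hand, an automorphism fixing an elementary submodel moves every element of the sort \<open>i\<close>
  by less than a step of \<open>2 \<pi> / i\<close>, because the submodel contains an orbit of the rotation. So the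
  automorphisms whose displacement, measured in such steps, is bounded uniformly in \<open>i\<close> form a normal
  subgroup containing the generators. Rotating each sort \<open>i\<close> by \<open>i div 2\<close> steps is an automorphism that
  fixes the sort 1, and no map in this subgroup agrees with it on the fibres over \<open>a\<close>, all of which
  lie in the algebraic closure of \<open>a\<close>.
\<close>


section \<open>Satisfaction\<close>

text \<open>\<open>N\<close> is nonstandard and carries no angles, so whatever is used about it has
  to be a first-order sentence for one fixed sort \<open>i\<close>: arcs of one rotation step become
  \<open>cell\<close>, and displacement becomes the length of a chain of successively
  \<open>near\<close> points. In a single sort any two points are joined by a chain whose length
  depends only on \<open>i\<close>, so a bound on displacement excludes nothing unless it is the
  same for all sorts. This is why the infinite tuple \<open>acl circ_sig N {a}\<close> is considered
  and why the fibres of all sorts over \<open>a\<close> are used together. A step of a chain may run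
  in either direction, whereas cells are numbered by naturals; \<open>cell_near\<close> therefore
  adds one rotation per step, which is the origin of the counts \<open>2 * n\<close> and
  \<open>2 * n + 1\<close> at the end. For the type of \<open>a\<close> a single generator suffices:
  one pair moved by it is carried to any other pair of distinct points by conjugation.
  Uncountability of \<open>N\<close> makes a countable submodel, which the countable language
  provides, small.\<close>

lemma finite_fv_term: "finite (fv_term t)"
  by (induction t) auto

lemma finite_fv: "finite (fv \<phi>)"
  by (induction \<phi>) (auto simp: finite_fv_term)

lemma val_cong: "(\<And>x. x \<in> fv_term t \<Longrightarrow> v x = w x) \<Longrightarrow> val N v t = val N w t"
proof (induction t)
  case (Fun f ts)
  then have "map (val N v) ts = map (val N w) ts" by (intro map_cong) auto
  then show ?case by (simp only: val.simps)
qed simp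

lemma sat_cong: "(\<And>x. x \<in> fv \<phi> \<Longrightarrow> v x = w x) \<Longrightarrow> sat N v \<phi> \<longleftrightarrow> sat N w \<phi>"
proof (induction \<phi> arbitrary: v w)
  case (Eq t u)
  then have "val N v t = val N w t" "val N v u = val N w u" by (auto intro!: val_cong)
  then show ?case by simp
next
  case (Rel r ts)
  then have "map (val N v) ts = map (val N w) ts" by (intro map_cong val_cong) auto
  then show ?case by (simp only: sat.simps)
next
  case (Neg \<phi>)
  then show ?case by (metis fv.simps(3) sat.simps(3))
next
  case (And \<phi> \<psi>)
  then show ?case by (metis UnCI fv.simps(4) sat.simps(4))
next
  case (Ex x \<phi>)
  have "sat N (v(x := a)) \<phi> \<longleftrightarrow> sat N (w(x := a)) \<phi>" for a
    using Ex.prems by (intro Ex.IH) auto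
  then show ?case by simp
qed

lemma val_in_dom:
  assumes "is_struct L N" "has_sort L t s" "assigns N v UNIV (fv_term t)"
  shows "val N v t \<in> dom_of N s"
  using assms(2,3)
proof (induction)
  case (1 s n)
  then show ?case by (auto simp: assigns_def)
next
  case (2 f ts)
  have "args_in N (map (val N v) ts) (fun_dom L f)"
    unfolding list_all2_conv_all_nth
  proof (intro conjI allI impI)
    show l: "length (map (val N v) ts) = length (fun_dom L f)"
      using 2(2) by (simp add: list_all2_lengthD)
    fix k assume k: "k < length (map (val N v) ts)"
    then have "assigns N v UNIV (fv_term (ts ! k))"
      using 2(3) by (auto simp: assigns_def)
    then show "map (val N v) ts ! k \<in> dom_of N (fun_dom L f ! k)"
      using 2(2) k by (simp add: list_all2_conv_all_nth)
  qed
  then show ?case using assms(1) 2(1) by (auto simp: is_struct_def)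
qed

lemma has_sort_fv: "has_sort L t s \<Longrightarrow> x \<in> fv_term t \<Longrightarrow> fst x \<in> sorts L"
proof (induction rule: has_sort.induct)
  case (2 f ts)
  then obtain k where k: "k < length ts" "x \<in> fv_term (ts ! k)" by (auto simp: in_set_conv_nth)
  moreover have "x \<in> fv_term (ts ! k) \<longrightarrow> fst x \<in> sorts L"
    using list_all2_nthD[OF 2(2) k(1)] by blast
  ultimately show ?case by blast
qed simp

lemma has_sort_sorts: "wf_sig L \<Longrightarrow> has_sort L t s \<Longrightarrow> s \<in> sorts L"
  by (cases rule: has_sort.cases) (auto simp: wf_sig_def)

lemma wf_form_fv: "wf_form L \<phi> \<Longrightarrow> x \<in> fv \<phi> \<Longrightarrow> fst x \<in> sorts L"
proof (induction \<phi>)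
  case (Eq t u)
  then show ?case by (auto dest: has_sort_fv)
next
  case (Rel r ts)
  then obtain k where "k < length ts" "x \<in> fv_term (ts ! k)" by (auto simp: in_set_conv_nth)
  moreover from this Rel have "has_sort L (ts ! k) (rel_dom L r ! k)"
    by (simp add: list_all2_conv_all_nth)
  ultimately show ?case by (auto intro: has_sort_fv)
qed auto

section \<open>Renaming of variables, and identification of several variables with one\<close>

primrec rename_term :: "('s \<times> nat \<Rightarrow> 's \<times> nat) \<Rightarrow> ('s, 'f) fo_term \<Rightarrow> ('s, 'f) fo_term" where
  "rename_term \<rho> (Var x) = Var (\<rho> x)"
| "rename_term \<rho> (Fun f ts) = Fun f (map (rename_term \<rho>) ts)"

primrec rename :: "('s \<times> nat \<Rightarrow> 's \<times> nat) \<Rightarrow> ('s, 'f, 'r) fo_form \<Rightarrow> ('s, 'f, 'r) fo_form" where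
  "rename \<rho> (Eq t u) = Eq (rename_term \<rho> t) (rename_term \<rho> u)"
| "rename \<rho> (Rel r ts) = Rel r (map (rename_term \<rho>) ts)"
| "rename \<rho> (Neg \<phi>) = Neg (rename \<rho> \<phi>)"
| "rename \<rho> (And \<phi> \<psi>) = And (rename \<rho> \<phi>) (rename \<rho> \<psi>)"
| "rename \<rho> (Ex x \<phi>) = Ex (\<rho> x) (rename \<rho> \<phi>)"

lemma val_rename: "val N v (rename_term \<rho> t) = val N (v \<circ> \<rho>) t"
proof (induction t)
  case (Fun f ts)
  have "map (\<lambda>t. val N v (rename_term \<rho> t)) ts = map (val N (v \<circ> \<rho>)) ts"
    by (intro map_cong refl Fun.IH)
  then show ?case by (simp only: rename_term.simps val.simps map_map comp_def)
qed simp

lemma fv_term_rename: "fv_term (rename_term \<rho> t) = \<rho> ` fv_term t"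
  by (induction t) auto

lemma fv_rename: "inj \<rho> \<Longrightarrow> fv (rename \<rho> \<phi>) = \<rho> ` fv \<phi>"
  by (induction \<phi>) (auto simp: fv_term_rename image_Un inj_image_eq_iff image_set_diff)

lemma has_sort_rename:
  assumes "\<And>x. fst (\<rho> x) = fst x" "has_sort L t s"
  shows "has_sort L (rename_term \<rho> t) s"
  using assms(2)
proof (induction)
  case (1 s n)
  then show ?case using assms(1)[of "(s, n)"] by (cases "\<rho> (s, n)") (auto intro: has_sort.intros)
next
  case (2 f ts)
  then show ?case
    by (auto simp: list_all2_map1 intro!: has_sort.intros elim: list_all2_mono)
qed

lemma wf_form_rename:
  assumes "\<And>x. fst (\<rho> x) = fst x" "wf_form L \<phi>"
  shows "wf_form L (rename \<rho> \<phi>)"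
  using assms(2)
  by (induction \<phi>)
     (auto simp: list_all2_map1 assms(1) intro: has_sort_rename[OF assms(1)] elim: list_all2_mono)

text \<open>\<open>rename\<close> also renames bound variables; injectivity rules out capture, and
  since sorts are kept the quantifiers range over the same sets.\<close>

lemma sat_rename:
  assumes "inj \<rho>" "\<And>x. fst (\<rho> x) = fst x"
  shows "sat N v (rename \<rho> \<phi>) \<longleftrightarrow> sat N (v \<circ> \<rho>) \<phi>"
proof (induction \<phi> arbitrary: v)
  case (Rel r ts)
  have "map (val N v) (map (rename_term \<rho>) ts) = map (val N (v \<circ> \<rho>)) ts"
    by (simp add: val_rename)
  then show ?case by (simp only: rename.simps sat.simps)
next
  case (Ex x \<phi>)
  have "v(\<rho> x := a) \<circ> \<rho> = (v \<circ> \<rho>)(x := a)" for a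
    using assms(1) by (auto simp: fun_eq_iff inj_eq)
  then show ?case by (simp only: rename.simps sat.simps Ex.IH assms(2))
qed (simp_all add: val_rename)

text \<open>Substitutes \<open>z\<close> for the variables \<open>xs\<close>. Quantifiers and
  equations do the work, so that no capture-avoiding substitution has to be developed.\<close>

primrec collapse ::
  "'s \<times> nat \<Rightarrow> ('s \<times> nat) list \<Rightarrow> ('s, 'f, 'r) fo_form \<Rightarrow> ('s, 'f, 'r) fo_form" where
  "collapse z [] \<phi> = \<phi>"
| "collapse z (x # xs) \<phi> = Ex x (And (Eq (Var x) (Var z)) (collapse z xs \<phi>))"

lemma sat_collapse:
  assumes "v z \<in> dom_of N s" "\<And>x. x \<in> set xs \<Longrightarrow> fst x = s" "z \<notin> set xs"
  shows "sat N v (collapse z xs \<phi>) \<longleftrightarrow> sat N (\<lambda>y. if y \<in> set xs then v z else v y) \<phi>"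
  using assms
proof (induction xs arbitrary: v)
  case (Cons x xs)
  let ?v = "v(x := v z)"
  have z: "?v z = v z" using Cons.prems(3) by simp
  have x: "fst x = s" using Cons.prems(2) by simp
  have "sat N v (collapse z (x # xs) \<phi>) \<longleftrightarrow>
      (\<exists>a\<in>dom_of N s. a = v z \<and> sat N (v(x := a)) (collapse z xs \<phi>))"
    using Cons.prems(3) by (simp add: x)
  also have "\<dots> \<longleftrightarrow> sat N ?v (collapse z xs \<phi>)"
    using Cons.prems(1) by blast
  also have "\<dots> \<longleftrightarrow> sat N (\<lambda>y. if y \<in> set xs then ?v z else ?v y) \<phi>"
    by (rule Cons.IH) (use Cons.prems z in \<open>auto simp del: fun_upd_apply\<close>)
  also have "(\<lambda>y. if y \<in> set xs then ?v z else ?v y) =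
      (\<lambda>y. if y \<in> set (x # xs) then v z else v y)" using Cons.prems(3) by (simp add: fun_eq_iff)
  finally show ?case .
qed simp

lemma wf_collapse:
  assumes "wf_form L \<phi>" "fst z = s" "s \<in> sorts L" "\<And>x. x \<in> set xs \<Longrightarrow> fst x = s"
  shows "wf_form L (collapse z xs \<phi>)"
  using assms
proof (induction xs)
  case (Cons x xs)
  have "has_sort L (Var x) s" "has_sort L (Var z) s"
    using Cons.prems by (cases x; cases z; auto intro!: has_sort.intros)+
  then show ?case using Cons by auto
qed simp

lemma fv_collapse: "fv (collapse z xs \<phi>) \<subseteq> insert z (fv \<phi> - set xs)"
  by (induction xs) auto

section \<open>Derived connectives, and transfer of first-order truths to models of the
  theory\<close>

definition Imp :: "('s, 'f, 'r) fo_form \<Rightarrow> ('s, 'f, 'r) fo_form \<Rightarrow> ('s, 'f, 'r) fo_form" where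
  "Imp \<phi> \<psi> = Neg (And \<phi> (Neg \<psi>))"

definition All :: "'s \<times> nat \<Rightarrow> ('s, 'f, 'r) fo_form \<Rightarrow> ('s, 'f, 'r) fo_form" where
  "All x \<phi> = Neg (Ex x (Neg \<phi>))"

definition Or :: "('s, 'f, 'r) fo_form \<Rightarrow> ('s, 'f, 'r) fo_form \<Rightarrow> ('s, 'f, 'r) fo_form" where
  "Or \<phi> \<psi> = Neg (And (Neg \<phi>) (Neg \<psi>))"

lemma Imp_simps [simp]:
  "sat N v (Imp \<phi> \<psi>) \<longleftrightarrow> (sat N v \<phi> \<longrightarrow> sat N v \<psi>)"
  "wf_form L (Imp \<phi> \<psi>) \<longleftrightarrow> wf_form L \<phi> \<and> wf_form L \<psi>"
  "fv (Imp \<phi> \<psi>) = fv \<phi> \<union> fv \<psi>"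
  by (auto simp: Imp_def)

lemma Or_simps [simp]:
  "sat N v (Or \<phi> \<psi>) \<longleftrightarrow> sat N v \<phi> \<or> sat N v \<psi>"
  "wf_form L (Or \<phi> \<psi>) \<longleftrightarrow> wf_form L \<phi> \<and> wf_form L \<psi>"
  "fv (Or \<phi> \<psi>) = fv \<phi> \<union> fv \<psi>"
  by (auto simp: Or_def)

lemma All_simps [simp]:
  "sat N v (All x \<phi>) \<longleftrightarrow> (\<forall>a\<in>dom_of N (fst x). sat N (v(x := a)) \<phi>)"
  "wf_form L (All x \<phi>) \<longleftrightarrow> fst x \<in> sorts L \<and> wf_form L \<phi>"
  "fv (All x \<phi>) = fv \<phi> - {x}"
  by (auto simp: All_def)

text \<open>Formulas have no constant for falsity, so the disjunction of a list starts from one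
  distinguished disjunct.\<close>

definition Disj :: "('s, 'f, 'r) fo_form \<Rightarrow> ('s, 'f, 'r) fo_form list \<Rightarrow> ('s, 'f, 'r) fo_form" where
  "Disj \<phi> \<phi>s = foldr Or \<phi>s \<phi>"

lemma Disj_simps [simp]:
  "sat N v (Disj \<phi> \<phi>s) \<longleftrightarrow> sat N v \<phi> \<or> (\<exists>\<psi>\<in>set \<phi>s. sat N v \<psi>)"
  "wf_form L (Disj \<phi> \<phi>s) \<longleftrightarrow> wf_form L \<phi> \<and> (\<forall>\<psi>\<in>set \<phi>s. wf_form L \<psi>)"
  "fv (Disj \<phi> \<phi>s) = fv \<phi> \<union> (\<Union>\<psi>\<in>set \<phi>s. fv \<psi>)"
  unfolding Disj_def by (induction \<phi>s) auto

lemma sat_foldr_All: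
  "sat N v (foldr All xs \<phi>) \<longleftrightarrow>
     (\<forall>w. assigns N w UNIV (set xs) \<and> (\<forall>x. x \<notin> set xs \<longrightarrow> w x = v x) \<longrightarrow> sat N w \<phi>)"
proof (induction xs arbitrary: v)
  case Nil
  have "(\<forall>x. w x = v x) \<longleftrightarrow> w = v" for w by auto
  then show ?case by (auto simp: assigns_def)
next
  case (Cons x xs)
  show ?case (is "?l \<longleftrightarrow> ?r")
  proof
    assume l: ?l
    show ?r
    proof (intro allI impI)
      fix w assume w: "assigns N w UNIV (set (x # xs)) \<and> (\<forall>y. y \<notin> set (x # xs) \<longrightarrow> w y = v y)"
      have "w x \<in> dom_of N (fst x)" using w by (auto simp: assigns_def)
      then have "sat N (v(x := w x)) (foldr All xs \<phi>)" using l by simp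
      moreover have "\<forall>y. y \<notin> set xs \<longrightarrow> w y = (v(x := w x)) y" using w by auto
      moreover have "assigns N w UNIV (set xs)" using w by (auto simp: assigns_def)
      ultimately show "sat N w \<phi>" unfolding Cons.IH by blast
    qed
  next
    assume r: ?r
    have "sat N (v(x := a)) (foldr All xs \<phi>)" if a: "a \<in> dom_of N (fst x)" for a
      unfolding Cons.IH
    proof (intro allI impI)
      fix w assume w: "assigns N w UNIV (set xs) \<and> (\<forall>y. y \<notin> set xs \<longrightarrow> w y = (v(x := a)) y)"
      have "w x \<in> dom_of N (fst x)"
      proof (cases "x \<in> set xs")
        case False
        then have "w x = (v(x := a)) x" using w by blast
        then show ?thesis using a by simp
      qed (use w in \<open>simp add: assigns_def\<close>)
      then have "assigns N w UNIV (set (x # xs))" using w by (auto simp: assigns_def)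
      moreover have "\<forall>y. y \<notin> set (x # xs) \<longrightarrow> w y = v y" using w by auto
      ultimately show "sat N w \<phi>" using r by blast
    qed
    then show ?l by simp
  qed
qed

text \<open>The universal closure over the finite set \<open>X\<close> is a sentence true in
  \<open>M\<close>, hence an element of \<open>Th L M\<close>, and its instance at \<open>v\<close>
  is the claim.\<close>

lemma transfer:
  assumes "is_model L N (Th L M)" "wf_form L \<phi>"
    and X: "finite X" "fv \<phi> \<subseteq> X" "fst ` X \<subseteq> sorts L"
    and M: "\<And>v. assigns M v UNIV X \<Longrightarrow> sat M v \<phi>"
    and v: "assigns N v UNIV X"
  shows "sat N v \<phi>"
proof -
  obtain xs where xs: "set xs = X" using X(1) finite_list by blast
  let ?\<psi> = "foldr All xs \<phi>"
  have "fv (foldr All ys \<phi>) = fv \<phi> - set ys" for ys by (induction ys) auto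
  then have "fv ?\<psi> = {}" using xs X(2) by simp
  moreover have "wf_form L (foldr All ys \<phi>)" if "set ys \<subseteq> X" for ys
    using that assms(2) X(3) by (induction ys) auto
  moreover have "sat M u ?\<psi>" for u
    unfolding sat_foldr_All using M xs by auto
  ultimately have "?\<psi> \<in> Th L M" using xs by (auto simp: Th_def)
  then have "sat N v ?\<psi>" using assms(1) by (simp add: is_model_def)
  then show ?thesis unfolding sat_foldr_All using v xs by auto
qed

text \<open>The variables are numbered by their positions in a list of sorts.\<close>

definition asg :: "'a list \<Rightarrow> 's \<times> nat \<Rightarrow> 'a" where
  "asg xs x = xs ! snd x"

text \<open>Variables are identified with positions in \<open>ss\<close>, so an admissible
  assignment in \<open>M\<close> can be replaced by one read off a list, and the check in
  \<open>M\<close> becomes a computation with explicit lists.\<close>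

lemma transfer_asg:
  assumes model: "is_model L N (Th L M)" and \<phi>: "wf_form L \<phi>" "fv \<phi> \<subseteq> set (zip ss [0..<length ss])"
    and ss: "set ss \<subseteq> sorts L"
    and M: "\<And>ys. args_in M ys ss \<Longrightarrow> sat M (asg ys) \<phi>"
    and xs: "args_in N xs ss"
  shows "sat N (asg xs) \<phi>"
proof (rule transfer[OF model \<phi>(1) _ \<phi>(2)])
  let ?X = "set (zip ss [0..<length ss])"
  have X: "x \<in> ?X \<longleftrightarrow> snd x < length ss \<and> fst x = ss ! snd x" for x
    by (cases x) (auto simp: set_zip)
  show "fst ` ?X \<subseteq> sorts L" using ss by (auto dest: set_zip_leftD)
  show "sat M v \<phi>" if v: "assigns M v UNIV ?X" for v
  proof -
    let ?ys = "map (\<lambda>n. v (ss ! n, n)) [0..<length ss]"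
    have "args_in M ?ys ss"
      unfolding list_all2_conv_all_nth
    proof (intro conjI allI impI)
      fix n assume "n < length ?ys"
      moreover from this have "(ss ! n, n) \<in> ?X" by (simp add: X)
      ultimately show "?ys ! n \<in> dom_of M (ss ! n)"
        using v by (auto simp: assigns_def simp del: set_zip)
    qed simp
    moreover have "asg ?ys x = v x" if "x \<in> fv \<phi>" for x
    proof -
      have "x \<in> ?X" using that \<phi>(2) by blast
      then have "snd x < length ss" "fst x = ss ! snd x" using X by blast+
      then show ?thesis by (cases x) (simp add: asg_def)
    qed
    ultimately show ?thesis using M sat_cong[of \<phi> "asg ?ys" v M] by blast
  qed
  show "assigns N (asg xs) UNIV ?X"
    using xs by (auto simp: assigns_def asg_def list_all2_conv_all_nth set_zip)
qed simp


section \<open>Automorphisms\<close>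

lemma is_struct_dom_unique:
  assumes "is_struct L N" "s \<in> sorts L" "t \<in> sorts L" "x \<in> dom_of N s" "x \<in> dom_of N t"
  shows "s = t"
proof (rule ccontr)
  assume "s \<noteq> t"
  then have "dom_of N s \<inter> dom_of N t = {}"
    using assms(1-3) by (simp add: is_struct_def disjoint_family_on_def)
  then show False using assms(4,5) by blast
qed

lemma automorphisms_Bij: "\<sigma> \<in> automorphisms L N \<Longrightarrow> \<sigma> \<in> Bij (universe L N)"
  by (simp add: automorphisms_def)

lemma automorphisms_dom:
  "\<sigma> \<in> automorphisms L N \<Longrightarrow> s \<in> sorts L \<Longrightarrow> \<sigma> ` dom_of N s = dom_of N s"
  by (simp add: automorphisms_def)

lemma automorphisms_in_dom:
  "\<sigma> \<in> automorphisms L N \<Longrightarrow> s \<in> sorts L \<Longrightarrow> x \<in> dom_of N s \<Longrightarrow> \<sigma> x \<in> dom_of N s"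
  by (drule (1) automorphisms_dom) blast

lemma automorphisms_fun:
  "\<sigma> \<in> automorphisms L N \<Longrightarrow> f \<in> fun_syms L \<Longrightarrow> args_in N xs (fun_dom L f) \<Longrightarrow>
    \<sigma> (fun_of N f xs) = fun_of N f (map \<sigma> xs)"
  by (simp add: automorphisms_def)

lemma automorphisms_rel:
  "\<sigma> \<in> automorphisms L N \<Longrightarrow> r \<in> rel_syms L \<Longrightarrow> args_in N xs (rel_dom L r) \<Longrightarrow>
    rel_of N r (map \<sigma> xs) \<longleftrightarrow> rel_of N r xs"
  by (simp add: automorphisms_def)

lemma args_in_val:
  assumes "is_struct L N" "list_all2 (has_sort L) ts ss" "assigns N v UNIV (\<Union> (fv_term ` set ts))"
  shows "args_in N (map (val N v) ts) ss"
proof -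
  have "list_all2 (\<lambda>t s. val N v t \<in> dom_of N s) ts ss"
    unfolding list_all2_conv_all_nth
  proof (intro conjI allI impI)
    show l: "length ts = length ss" using assms(2) by (rule list_all2_lengthD)
    fix k assume k: "k < length ts"
    then have "has_sort L (ts ! k) (ss ! k)" using assms(2) by (simp add: list_all2_conv_all_nth)
    moreover have "assigns N v UNIV (fv_term (ts ! k))"
      using assms(3) k by (auto simp: assigns_def)
    ultimately show "val N v (ts ! k) \<in> dom_of N (ss ! k)" by (rule val_in_dom[OF assms(1)])
  qed
  then show ?thesis by (simp add: list_all2_map1)
qed

lemma val_automorphism:
  assumes "is_struct L N" "\<sigma> \<in> automorphisms L N" "has_sort L t s" "assigns N v UNIV (fv_term t)"
  shows "val N (\<sigma> \<circ> v) t = \<sigma> (val N v t)"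
  using assms(3,4)
proof (induction)
  case (2 f ts)
  have m: "val N (\<sigma> \<circ> v) t = \<sigma> (val N v t)" if "t \<in> set ts" for t
  proof -
    have "assigns N v UNIV (fv_term t)" using 2(3) that by (auto simp: assigns_def)
    moreover obtain k where k: "k < length ts" "t = ts ! k"
      using \<open>t \<in> set ts\<close> by (auto simp: in_set_conv_nth)
    ultimately show ?thesis using list_all2_nthD[OF 2(2) k(1)] by blast
  qed
  have "list_all2 (has_sort L) ts (fun_dom L f)"
    using 2(2) by (rule list_all2_mono) blast
  then have "args_in N (map (val N v) ts) (fun_dom L f)"
    using 2(3) by (intro args_in_val[OF assms(1)]) auto
  then have "\<sigma> (val N v (Fun f ts)) = fun_of N f (map \<sigma> (map (val N v) ts))"
    using automorphisms_fun[OF assms(2) 2(1)] by simp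
  also have "map \<sigma> (map (val N v) ts) = map (val N (\<sigma> \<circ> v)) ts" using m by simp
  finally show ?case by (simp only: val.simps)
qed simp

text \<open>Terms commute with \<open>\<sigma>\<close> by \<open>val_automorphism\<close>; equations
  use injectivity on the universe, and quantifiers use that \<open>\<sigma>\<close> maps each sort
  onto itself, not merely into it.\<close>

lemma sat_automorphism:
  assumes L: "wf_sig L" and N: "is_struct L N" and \<sigma>: "\<sigma> \<in> automorphisms L N"
    and "wf_form L \<phi>" "assigns N v UNIV (fv \<phi>)"
  shows "sat N (\<sigma> \<circ> v) \<phi> \<longleftrightarrow> sat N v \<phi>"
  using assms(4,5)
proof (induction \<phi> arbitrary: v)
  case (Eq t u)
  then obtain s where s: "has_sort L t s" "has_sort L u s" by auto
  have a: "assigns N v UNIV (fv_term t)" "assigns N v UNIV (fv_term u)"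
    using Eq by (auto simp: assigns_def)
  have in_dom: "val N v t \<in> universe L N" "val N v u \<in> universe L N"
    using val_in_dom[OF N] s a has_sort_sorts[OF L] by (force simp: universe_def)+
  have "inj_on \<sigma> (universe L N)"
    using automorphisms_Bij[OF \<sigma>] by (simp add: Bij_def bij_betw_def)
  then have "\<sigma> (val N v t) = \<sigma> (val N v u) \<longleftrightarrow> val N v t = val N v u"
    using in_dom by (auto dest: inj_onD)
  then show ?case using val_automorphism[OF N \<sigma>] s a by (simp only: sat.simps)
next
  case (Rel r ts)
  then have ts: "list_all2 (has_sort L) ts (rel_dom L r)" and r: "r \<in> rel_syms L" by auto
  have "args_in N (map (val N v) ts) (rel_dom L r)"
    using ts Rel.prems(2) by (intro args_in_val[OF N]) auto
  then have "rel_of N r (map \<sigma> (map (val N v) ts)) \<longleftrightarrow> rel_of N r (map (val N v) ts)"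
    by (rule automorphisms_rel[OF \<sigma> r])
  moreover have "map \<sigma> (map (val N v) ts) = map (val N (\<sigma> \<circ> v)) ts"
  proof -
    have "val N (\<sigma> \<circ> v) t = \<sigma> (val N v t)" if "t \<in> set ts" for t
    proof -
      obtain k where "k < length ts" "t = ts ! k" using \<open>t \<in> set ts\<close> by (auto simp: in_set_conv_nth)
      then have "has_sort L t (rel_dom L r ! k)" using ts by (simp add: list_all2_conv_all_nth)
      moreover have "assigns N v UNIV (fv_term t)"
        using Rel.prems(2) that by (auto simp: assigns_def)
      ultimately show ?thesis by (rule val_automorphism[OF N \<sigma>])
    qed
    then show ?thesis by simp
  qed
  ultimately show ?case by (simp only: sat.simps)
next
  case (Ex x \<phi>)
  have x: "fst x \<in> sorts L" using Ex.prems(1) by simp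
  have *: "sat N ((\<sigma> \<circ> v)(x := \<sigma> a)) \<phi> \<longleftrightarrow> sat N (v(x := a)) \<phi>" if "a \<in> dom_of N (fst x)" for a
  proof -
    have "sat N (\<sigma> \<circ> v(x := a)) \<phi> \<longleftrightarrow> sat N (v(x := a)) \<phi>"
      using Ex.prems that by (intro Ex.IH) (auto simp: assigns_def)
    then show ?thesis by (simp add: fun_upd_comp)
  qed
  have "sat N (\<sigma> \<circ> v) (Ex x \<phi>) \<longleftrightarrow> (\<exists>b\<in>\<sigma> ` dom_of N (fst x). sat N ((\<sigma> \<circ> v)(x := b)) \<phi>)"
    using automorphisms_dom[OF \<sigma> x] by simp
  also have "\<dots> \<longleftrightarrow> sat N v (Ex x \<phi>)" using * by simp
  finally show ?case .
next
  case (Neg \<phi>)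
  then show ?case by (simp only: sat.simps wf_form.simps fv.simps)
next
  case (And \<phi> \<psi>)
  moreover from And.prems(2) have "assigns N v UNIV (fv \<phi>)" "assigns N v UNIV (fv \<psi>)"
    by (auto simp: assigns_def)
  ultimately show ?case by (simp only: sat.simps wf_form.simps)
qed


section \<open>Partial elementary maps\<close>

text \<open>A set of pairs instead of a function: single-valuedness and injectivity follow from
  preserving equations, the converse is again a set of pairs, and stages of a back-and-forth are
  plain unions. One direction of satisfaction suffices because formulas are closed under
  \<open>Neg\<close>.\<close>

definition partial_elementary ::
  "('s, 'f, 'r) signature \<Rightarrow> ('s, 'f, 'r, 'a) fo_struct \<Rightarrow> ('a \<times> 'a) set \<Rightarrow> bool" where
  "partial_elementary L N R \<longleftrightarrow>
     (\<forall>(a, b)\<in>R. \<exists>s\<in>sorts L. a \<in> dom_of N s \<and> b \<in> dom_of N s) \<and>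
     (\<forall>\<phi> v w. wf_form L \<phi> \<longrightarrow> assigns N v UNIV (fv \<phi>) \<longrightarrow> (\<forall>x\<in>fv \<phi>. (v x, w x) \<in> R) \<longrightarrow>
        sat N v \<phi> \<longrightarrow> sat N w \<phi>)"

lemma partial_elementary_sat:
  assumes "partial_elementary L N R" "wf_form L \<phi>" "assigns N v UNIV (fv \<phi>)"
    "\<And>x. x \<in> fv \<phi> \<Longrightarrow> (v x, w x) \<in> R"
  shows "sat N w \<phi> \<longleftrightarrow> sat N v \<phi>"
proof -
  have "sat N w \<psi>" if "wf_form L \<psi>" "fv \<psi> = fv \<phi>" "sat N v \<psi>" for \<psi>
    by (rule assms(1)[unfolded partial_elementary_def, THEN conjunct2, rule_format, of \<psi> v w])
      (simp_all add: assms(3,4) that)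
  from this[of \<phi>] this[of "Neg \<phi>"] assms(2) show ?thesis by auto
qed

lemma partial_elementary_dom:
  assumes "partial_elementary L N R" "is_struct L N" "(a, b) \<in> R" "s \<in> sorts L"
  shows "a \<in> dom_of N s \<longleftrightarrow> b \<in> dom_of N s"
proof -
  obtain t where "t \<in> sorts L" "a \<in> dom_of N t" "b \<in> dom_of N t"
    using assms(1,3) by (auto simp: partial_elementary_def)
  then show ?thesis using is_struct_dom_unique[OF assms(2)] assms(4) by metis
qed

lemma partial_elementary_assigns:
  assumes "partial_elementary L N R" "is_struct L N" "wf_form L \<phi>" "X \<subseteq> fv \<phi>"
    "assigns N v UNIV X" "\<And>x. x \<in> X \<Longrightarrow> (v x, w x) \<in> R"
  shows "assigns N w (Range R) X"
  unfolding assigns_def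
proof
  fix x assume x: "x \<in> X"
  then have "fst x \<in> sorts L" using assms(3,4) wf_form_fv by blast
  then have "w x \<in> dom_of N (fst x)"
    using partial_elementary_dom[OF assms(1,2) assms(6)[OF x], of "fst x"] assms(5) x
    by (auto simp: assigns_def)
  then show "w x \<in> Range R \<inter> dom_of N (fst x)" using assms(6)[OF x] by blast
qed

lemma partial_elementary_subset:
  assumes "partial_elementary L N R" "Q \<subseteq> R"
  shows "partial_elementary L N Q"
  unfolding partial_elementary_def
proof (intro conjI allI impI)
  show "\<forall>(a, b)\<in>Q. \<exists>s\<in>sorts L. a \<in> dom_of N s \<and> b \<in> dom_of N s"
    using assms by (auto simp: partial_elementary_def)
  fix \<phi> v w
  assume "wf_form L \<phi>" "assigns N v UNIV (fv \<phi>)" "\<forall>x\<in>fv \<phi>. (v x, w x) \<in> Q" "sat N v \<phi>"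
  then show "sat N w \<phi>" using partial_elementary_sat[OF assms(1)] assms(2) by blast
qed

text \<open>A formula has finitely many free variables, so it sees only finitely many pairs of
  \<open>R\<close>. This carries the back-and-forth through limit stages.\<close>

lemma partial_elementary_finite:
  assumes "\<And>Q. finite Q \<Longrightarrow> Q \<subseteq> R \<Longrightarrow> partial_elementary L N Q"
  shows "partial_elementary L N R"
  unfolding partial_elementary_def
proof (intro conjI allI impI ballI)
  fix p assume "p \<in> R"
  then have "partial_elementary L N {p}" using assms[of "{p}"] by simp
  then show "case p of (a, b) \<Rightarrow> \<exists>s\<in>sorts L. a \<in> dom_of N s \<and> b \<in> dom_of N s"
    by (simp add: partial_elementary_def)
next
  fix \<phi> v w
  assume *: "wf_form L \<phi>" "assigns N v UNIV (fv \<phi>)" "\<forall>x\<in>fv \<phi>. (v x, w x) \<in> R" "sat N v \<phi>"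
  have "partial_elementary L N ((\<lambda>x. (v x, w x)) ` fv \<phi>)"
    using *(3) by (intro assms) (auto simp: finite_fv)
  then show "sat N w \<phi>" using * partial_elementary_sat[of L N _ \<phi> v w] by blast
qed

lemma partial_elementary_converse:
  assumes "partial_elementary L N R" "is_struct L N"
  shows "partial_elementary L N (R\<inverse>)"
  unfolding partial_elementary_def
proof (intro conjI allI impI)
  show "\<forall>(a, b)\<in>R\<inverse>. \<exists>s\<in>sorts L. a \<in> dom_of N s \<and> b \<in> dom_of N s"
    using assms(1) unfolding partial_elementary_def by fastforce
next
  fix \<phi> v w
  assume *: "wf_form L \<phi>" "assigns N v UNIV (fv \<phi>)" "\<forall>x\<in>fv \<phi>. (v x, w x) \<in> R\<inverse>" "sat N v \<phi>"
  have "w x \<in> dom_of N (fst x)" if "x \<in> fv \<phi>" for x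
    using partial_elementary_dom[OF assms, of "w x" "v x" "fst x"] wf_form_fv[OF *(1) that] *(2,3) that
    by (simp add: assigns_def)
  then have "assigns N w UNIV (fv \<phi>)" by (simp add: assigns_def)
  then show "sat N w \<phi>"
    using * partial_elementary_sat[OF assms(1) *(1), of w v] by auto
qed

lemma partial_elementary_Id_on:
  "A \<subseteq> universe L N \<Longrightarrow> partial_elementary L N (Id_on A)"
  unfolding partial_elementary_def
proof (intro conjI allI impI)
  show "\<forall>(a, b)\<in>Id_on A. \<exists>s\<in>sorts L. a \<in> dom_of N s \<and> b \<in> dom_of N s" if "A \<subseteq> universe L N"
    using that by (auto simp: universe_def)
  fix \<phi> v w
  assume *: "\<forall>x\<in>fv \<phi>. (v x, w x) \<in> Id_on A" and sat: "sat N v \<phi>"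
  have "v x = w x" if "x \<in> fv \<phi>" for x
    using bspec[OF * that] by (simp add: Id_on_iff)
  then show "sat N w \<phi>" using sat sat_cong by metis
qed

text \<open>Only the variable \<open>(s, 0)\<close> may take the new value, so that extending a partial elementary map
  by one pair is a statement about 1-types.\<close>

lemma partial_elementary_insert:
  assumes L: "is_struct L N" and R: "partial_elementary L N R"
    and s: "s \<in> sorts L" "b \<in> dom_of N s" "b' \<in> dom_of N s"
    and step: "\<And>\<phi> v w. wf_form L \<phi> \<Longrightarrow> assigns N v UNIV (fv \<phi>) \<Longrightarrow> v (s, 0) = b \<Longrightarrow> w (s, 0) = b' \<Longrightarrow>
       (\<And>x. x \<in> fv \<phi> \<Longrightarrow> x \<noteq> (s, 0) \<Longrightarrow> (v x, w x) \<in> R) \<Longrightarrow> sat N v \<phi> \<Longrightarrow> sat N w \<phi>"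
  shows "partial_elementary L N (insert (b, b') R)"
  unfolding partial_elementary_def
proof (intro conjI allI impI)
  show "\<forall>(a, c)\<in>insert (b, b') R. \<exists>s\<in>sorts L. a \<in> dom_of N s \<and> c \<in> dom_of N s"
    using R s by (auto simp: partial_elementary_def)
next
  fix \<phi> v w
  assume wf: "wf_form L \<phi>" and v: "assigns N v UNIV (fv \<phi>)"
    and vw: "\<forall>x\<in>fv \<phi>. (v x, w x) \<in> insert (b, b') R" and sat: "sat N v \<phi>"
  \<comment> \<open>All variables of \<open>\<phi>\<close> move up by one number, which frees
    \<open>(s, 0)\<close> for the new pair; \<open>shift u c\<close> is the matching assignment,
    with \<open>c\<close> at \<open>(s, 0)\<close>.\<close>
  define \<rho> :: "'a \<times> nat \<Rightarrow> 'a \<times> nat" where "\<rho> = (\<lambda>x. (fst x, Suc (snd x)))"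
  define shift where "shift u c x = (if x = (s, 0) then c else u (fst x, snd x - 1))"
    for u :: "'a \<times> nat \<Rightarrow> 'd" and c and x :: "'a \<times> nat"
  have \<rho>: "inj \<rho>" "fst (\<rho> x) = fst x" "\<rho> x \<noteq> (s, 0)" for x
    by (auto simp: \<rho>_def inj_def)
  have shift\<rho>: "shift u c \<circ> \<rho> = u" "shift u c (\<rho> x) = u x" "shift u c (s, 0) = c" for u c x
    by (auto simp: shift_def \<rho>_def fun_eq_iff)
  \<comment> \<open>These variables carry the pair \<open>(b, b')\<close> itself. After renaming,
    \<open>collapse\<close> merges them all into \<open>(s, 0)\<close>, so every other variable
    carries a pair of \<open>R\<close>.\<close>
  let ?new = "{x \<in> fv \<phi>. (v x, w x) \<notin> R}"
  obtain xs where xs: "set xs = \<rho> ` ?new"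
    using finite_list[of "\<rho> ` ?new"] finite_fv[of \<phi>] by auto
  have new: "v x = b" "w x = b'" "fst x = s" if "x \<in> ?new" for x
  proof -
    show eq: "v x = b" "w x = b'" using that vw by auto
    show "fst x = s"
      using is_struct_dom_unique[OF L _ s(1), of "fst x" b] wf_form_fv[OF wf] that v eq s(2)
      by (auto simp: assigns_def)
  qed
  have xs_fst: "fst y = s" and xs_0: "y \<noteq> (s, 0)" if "y \<in> set xs" for y
  proof -
    obtain x where x: "x \<in> ?new" "y = \<rho> x" using \<open>y \<in> set xs\<close> unfolding xs by blast
    show "fst y = s" unfolding x(2) \<rho>(2) by (rule new(3)[OF x(1)])
    show "y \<noteq> (s, 0)" unfolding x(2) by (rule \<rho>(3))
  qed
  let ?\<psi> = "collapse (s, 0) xs (rename \<rho> \<phi>)"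
  have sat_iff: "sat N (shift u c) ?\<psi> \<longleftrightarrow> sat N u \<phi>"
    if "c \<in> dom_of N s" "\<And>x. x \<in> ?new \<Longrightarrow> u x = c" for u c
  proof -
    have "sat N (shift u c) ?\<psi> \<longleftrightarrow>
        sat N (\<lambda>y. if y \<in> set xs then shift u c (s, 0) else shift u c y) (rename \<rho> \<phi>)"
    proof (rule sat_collapse)
      show "shift u c (s, 0) \<in> dom_of N s" using that(1) by (simp only: shift\<rho>)
      show "(s, 0) \<notin> set xs" using xs_0 by blast
    qed (rule xs_fst)
    also have "\<dots> \<longleftrightarrow> sat N (shift u c) (rename \<rho> \<phi>)"
    proof (rule sat_cong)
      fix y
      have "shift u c y = c" if "y \<in> set xs"
      proof -
        obtain x where "x \<in> ?new" "y = \<rho> x" using \<open>y \<in> set xs\<close> unfolding xs by blast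
        then show ?thesis using \<open>\<And>x. x \<in> ?new \<Longrightarrow> u x = c\<close> by (simp only: shift\<rho>)
      qed
      then show "(if y \<in> set xs then shift u c (s, 0) else shift u c y) = shift u c y"
        by (simp add: shift\<rho>)
    qed
    also have "\<dots> \<longleftrightarrow> sat N u \<phi>"
      by (simp only: sat_rename[OF \<rho>(1,2)] shift\<rho>)
    finally show ?thesis .
  qed
  have fv: "\<exists>y\<in>fv \<phi>. x = \<rho> y \<and> (v y, w y) \<in> R" if "x \<in> fv ?\<psi>" "x \<noteq> (s, 0)" for x
  proof -
    have "x \<in> \<rho> ` fv \<phi> - set xs"
      using fv_collapse[of "(s, 0)" xs "rename \<rho> \<phi>"] that fv_rename[OF \<rho>(1)] by blast
    then show ?thesis using xs by auto
  qed
  have "sat N (shift w b') ?\<psi>"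
  proof (rule step)
    show "wf_form L ?\<psi>"
      by (rule wf_collapse[where s = s]) (simp_all add: wf_form_rename[OF \<rho>(2) wf] s(1) xs_fst)
    have "shift v b x \<in> dom_of N (fst x)" if "x \<in> fv ?\<psi>" for x
    proof (cases "x = (s, 0)")
      case False
      from fv[OF that this] obtain y where "y \<in> fv \<phi>" "x = \<rho> y" by blast
      then show ?thesis using v \<rho>(2)[of y] by (simp add: shift\<rho> assigns_def)
    qed (simp add: shift\<rho> s)
    then show "assigns N (shift v b) UNIV (fv ?\<psi>)"
      by (simp add: assigns_def)
    show "(shift v b x, shift w b' x) \<in> R" if "x \<in> fv ?\<psi>" "x \<noteq> (s, 0)" for x
      using fv[OF that] by (auto simp: shift\<rho>)
    show "sat N (shift v b) ?\<psi>" using sat sat_iff[of b v] s(2) new(1) by blast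
  qed (simp_all add: shift\<rho>)
  then show "sat N w \<phi>" using sat_iff[of b' w] s(3) new(2) by blast
qed

text \<open>With identity pairs the two assignments agree on the parameters, so \<open>step\<close>
  says that the type of \<open>b\<close> over \<open>A\<close> is contained in that of
  \<open>b'\<close>.\<close>

lemma partial_elementary_Id_on_insert:
  assumes N: "is_struct L N" and A: "A \<subseteq> universe L N"
    and s: "s \<in> sorts L" "b \<in> dom_of N s" "b' \<in> dom_of N s"
    and step: "\<And>\<phi> v. wf_form L \<phi> \<Longrightarrow> assigns N v A (fv \<phi> - {(s, 0)}) \<Longrightarrow>
       sat N (v((s, 0) := b)) \<phi> \<Longrightarrow> sat N (v((s, 0) := b')) \<phi>"
  shows "partial_elementary L N (insert (b, b') (Id_on A))"
proof (rule partial_elementary_insert[OF N partial_elementary_Id_on[OF A] s])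
  fix \<phi> v w
  assume *: "wf_form L \<phi>" "assigns N v UNIV (fv \<phi>)" "v (s, 0) = b" "w (s, 0) = b'"
    "\<And>x. x \<in> fv \<phi> \<Longrightarrow> x \<noteq> (s, 0) \<Longrightarrow> (v x, w x) \<in> Id_on A" "sat N v \<phi>"
  have "v((s, 0) := b) = v" using *(3) by auto
  moreover have "assigns N v A (fv \<phi> - {(s, 0)})" using *(2,5) by (auto simp: assigns_def)
  ultimately have "sat N (v((s, 0) := b')) \<phi>" using step[OF *(1)] *(6) by simp
  moreover have "(v((s, 0) := b')) x = w x" if "x \<in> fv \<phi>" for x
    using *(4) *(5)[OF that] by (cases "x = (s, 0)") auto
  ultimately show "sat N w \<phi>" using sat_cong[of \<phi> "v((s, 0) := b')" w N] by blast
qed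

text \<open>Elementarity for equations between variables makes \<open>Q\<close> the graph of a
  bijection, and elementarity for the atomic formulas \<open>y = f(xs)\<close> and
  \<open>r(xs)\<close> gives compatibility with the symbols.\<close>

lemma partial_elementary_automorphism:
  assumes L: "wf_sig L" and N: "is_struct L N" and Q: "partial_elementary L N Q"
    and dom: "Domain Q = universe L N" and ran: "Range Q = universe L N"
  shows "\<exists>\<sigma>\<in>automorphisms L N. \<forall>(a, b)\<in>Q. \<sigma> a = b"
proof -
  let ?U = "universe L N"
  have same: "s \<in> sorts L \<Longrightarrow> (a, b) \<in> Q \<Longrightarrow> a \<in> dom_of N s \<longleftrightarrow> b \<in> dom_of N s" for a b s
    using partial_elementary_dom[OF Q N] by blast
  have fun_inj: "b = b' \<longleftrightarrow> a = a'" if ab: "(a, b) \<in> Q" "(a', b') \<in> Q" and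
    s: "s \<in> sorts L" "a \<in> dom_of N s" "a' \<in> dom_of N s" for a b a' b' s
  proof -
    have "wf_form L (Eq (Var (s, 0)) (Var (s, 1)))"
      using s(1) has_sort.intros(1) by (metis wf_form.simps(1))
    from partial_elementary_sat[OF Q this, of "\<lambda>x. if snd x = 0 then a else a'"
        "\<lambda>x. if snd x = 0 then b else b'"] show ?thesis
      using ab s by (auto simp: assigns_def)
  qed
  have fn: "b = b'" if "(a, b) \<in> Q" "(a, b') \<in> Q" for a b b'
  proof -
    have "a \<in> ?U" using that dom by blast
    then show ?thesis using fun_inj[OF that] by (auto simp: universe_def)
  qed
  have inj: "a = a'" if "(a, b) \<in> Q" "(a', b) \<in> Q" for a a' b
  proof -
    have "a \<in> ?U" using that dom by blast
    then obtain s where s: "s \<in> sorts L" "a \<in> dom_of N s" by (auto simp: universe_def)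
    then have "a' \<in> dom_of N s" using same that by blast
    then show ?thesis using fun_inj[OF that] s by blast
  qed
  define \<sigma> where "\<sigma> = (\<lambda>a\<in>?U. THE b. (a, b) \<in> Q)"
  have \<sigma>I: "\<sigma> a = b" if "(a, b) \<in> Q" for a b
    using that dom fn by (auto simp: \<sigma>_def intro!: the_equality)
  have \<sigma>Q: "(a, \<sigma> a) \<in> Q" if "a \<in> ?U" for a
    using that dom \<sigma>I by blast
  have dU: "dom_of N s \<subseteq> ?U" if "s \<in> sorts L" for s using that by (auto simp: universe_def)
  have img: "\<sigma> ` dom_of N s = dom_of N s" if s: "s \<in> sorts L" for s
  proof
    show "\<sigma> ` dom_of N s \<subseteq> dom_of N s" using \<sigma>Q same[OF s] dU[OF s] by blast
    show "dom_of N s \<subseteq> \<sigma> ` dom_of N s"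
    proof
      fix b assume b: "b \<in> dom_of N s"
      then obtain a where "(a, b) \<in> Q" using ran dU[OF s] by blast
      then show "b \<in> \<sigma> ` dom_of N s" using \<sigma>I same[OF s] b by blast
    qed
  qed
  have sat: "sat N (\<sigma> \<circ> v) \<phi> \<longleftrightarrow> sat N v \<phi>" if "wf_form L \<phi>" "assigns N v UNIV (fv \<phi>)" for \<phi> v
  proof (rule partial_elementary_sat[OF Q that])
    fix x assume x: "x \<in> fv \<phi>"
    then have "v x \<in> ?U"
      using dU wf_form_fv[OF that(1) x] that(2) by (auto simp: assigns_def)
    then show "(v x, (\<sigma> \<circ> v) x) \<in> Q" using \<sigma>Q by simp
  qed
  \<comment> \<open>Argument variables are numbered from one, so that number zero can hold the value
    of the function even when its sort occurs among the arguments.\<close>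
  let ?ts = "\<lambda>ss. map (\<lambda>k. Var (ss ! k, Suc k)) [0..<length ss]"
  let ?v = "\<lambda>y xs (t, n). case n of 0 \<Rightarrow> y | Suc k \<Rightarrow> xs ! k"
  have ts_sort: "list_all2 (has_sort L) (?ts ss) ss" if "set ss \<subseteq> sorts L" for ss
    using that by (auto simp: list_all2_conv_all_nth intro!: has_sort.intros)
  have ts_val: "map (val N (?v y xs)) (?ts ss) = xs" if "length xs = length ss" for y xs ss
    using that by (intro nth_equalityI) auto
  have \<sigma>v: "sat N (\<sigma> \<circ> ?v y xs) \<phi> \<longleftrightarrow> sat N (?v (\<sigma> y) (map \<sigma> xs)) \<phi>"
    if "\<And>x. x \<in> fv \<phi> \<Longrightarrow> snd x \<le> length xs" for \<phi> :: "('a, 'b, 'c) fo_form" and y xs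
  proof (rule sat_cong)
    fix x assume "x \<in> fv \<phi>"
    then have "snd x \<le> length xs" by (rule that)
    then show "(\<sigma> \<circ> ?v y xs) x = ?v (\<sigma> y) (map \<sigma> xs) x"
      by (cases x) (simp split: nat.split)
  qed
  have "\<sigma> \<in> Bij ?U"
  proof -
    have "inj_on \<sigma> ?U" using \<sigma>Q inj by (metis inj_onI)
    moreover have "\<sigma> ` ?U = ?U" using img by (auto simp: universe_def image_UN)
    ultimately show ?thesis by (auto simp: Bij_def bij_betw_def \<sigma>_def)
  qed
  moreover have "\<sigma> (fun_of N f xs) = fun_of N f (map \<sigma> xs)"
    if f: "f \<in> fun_syms L" and xs: "args_in N xs (fun_dom L f)" for f xs
  proof -
    let ?ss = "fun_dom L f"
    let ?y = "fun_of N f xs"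
    let ?\<phi> = "Eq (Var (fun_cod L f, 0)) (Fun f (?ts ?ss))"
    have ss: "set ?ss \<subseteq> sorts L" "fun_cod L f \<in> sorts L" using L f by (auto simp: wf_sig_def)
    have len: "length xs = length ?ss" using xs by (rule list_all2_lengthD)
    have "wf_form L ?\<phi>"
      using has_sort.intros(2)[OF f ts_sort[OF ss(1)]] ss(2) by (auto intro: has_sort.intros)
    moreover have "?y \<in> dom_of N (fun_cod L f)" using N f xs by (auto simp: is_struct_def)
    then have "assigns N (?v ?y xs) UNIV (fv ?\<phi>)"
      using xs by (auto simp: assigns_def list_all2_conv_all_nth)
    moreover have "sat N (?v ?y xs) ?\<phi>"
      unfolding sat.simps val.simps ts_val[OF len] by simp
    ultimately have "sat N (\<sigma> \<circ> ?v ?y xs) ?\<phi>" using sat by blast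
    moreover have "sat N (\<sigma> \<circ> ?v ?y xs) ?\<phi> \<longleftrightarrow> sat N (?v (\<sigma> ?y) (map \<sigma> xs)) ?\<phi>"
      by (rule \<sigma>v) (use len in auto)
    ultimately have "sat N (?v (\<sigma> ?y) (map \<sigma> xs)) ?\<phi>" by (rule iffD1[rotated])
    moreover have "map (val N (?v (\<sigma> ?y) (map \<sigma> xs))) (?ts ?ss) = map \<sigma> xs"
      by (rule ts_val) (use len in simp)
    ultimately show ?thesis by (simp only: sat.simps val.simps prod.case nat.case)
  qed
  moreover have "rel_of N r (map \<sigma> xs) \<longleftrightarrow> rel_of N r xs"
    if r: "r \<in> rel_syms L" and xs: "args_in N xs (rel_dom L r)" for r xs
  proof -
    let ?ss = "rel_dom L r"
    let ?\<phi> = "Rel r (?ts ?ss)"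
    have ss: "set ?ss \<subseteq> sorts L" using L r by (auto simp: wf_sig_def)
    have len: "length xs = length ?ss" using xs by (rule list_all2_lengthD)
    have "wf_form L ?\<phi>" using r ts_sort[OF ss] by simp
    moreover have "assigns N (?v undefined xs) UNIV (fv ?\<phi>)"
      using xs by (auto simp: assigns_def list_all2_conv_all_nth)
    ultimately have "sat N (\<sigma> \<circ> ?v undefined xs) ?\<phi> \<longleftrightarrow> sat N (?v undefined xs) ?\<phi>" using sat by blast
    moreover have "sat N (\<sigma> \<circ> ?v undefined xs) ?\<phi> \<longleftrightarrow> sat N (?v (\<sigma> undefined) (map \<sigma> xs)) ?\<phi>"
      by (rule \<sigma>v) (use len in auto)
    moreover have "map (val N (?v (\<sigma> undefined) (map \<sigma> xs))) (?ts ?ss) = map \<sigma> xs"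
      by (rule ts_val) (use len in simp)
    moreover have "map (val N (?v undefined xs)) (?ts ?ss) = xs"
      by (rule ts_val) (use len in simp)
    ultimately show ?thesis by (simp only: sat.simps)
  qed
  ultimately have "\<sigma> \<in> automorphisms L N"
    using img by (simp add: automorphisms_def)
  moreover have "\<forall>(a, b)\<in>Q. \<sigma> a = b" by (simp add: \<sigma>I split_beta)
  ultimately show ?thesis by (intro bexI[where x = \<sigma>])
qed


section \<open>Homogeneity of saturated structures\<close>

text \<open>Smallness in \<open>saturated\<close> is stated with \<open>lesspoll\<close>, whereas
  unions below an infinite cardinal and initial segments of a cardinal order are controlled by
  \<open>ordLess2\<close>.\<close>

lemma lesspoll_iff_ordLess: "A \<prec> B \<longleftrightarrow> ordLess2 (card_of A) (card_of B)"
proof -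
  have "A \<prec> B \<longleftrightarrow> \<not> B \<lesssim> A"
  proof
    show "\<not> B \<lesssim> A" if "A \<prec> B"
      using that lepoll_antisym unfolding lesspoll_def by blast
  next
    assume "\<not> B \<lesssim> A"
    then have *: "ordLess2 (card_of A) (card_of B)"
      by (simp add: lepoll_def flip: card_of_ordLess)
    then have "A \<lesssim> B"
      using ordLess_imp_ordLeq card_of_ordLeq unfolding lepoll_def by blast
    moreover have "\<not> A \<approx> B" using * not_ordLess_ordIso eqpoll_iff_card_of_ordIso by blast
    ultimately show "A \<prec> B" by (simp add: lesspoll_def)
  qed
  also have "\<dots> \<longleftrightarrow> ordLess2 (card_of A) (card_of B)"
    by (simp add: lepoll_def flip: card_of_ordLess)
  finally show ?thesis .
qed

lemma lesspoll_Un_infinite: "infinite C \<Longrightarrow> A \<prec> C \<Longrightarrow> B \<prec> C \<Longrightarrow> A \<union> B \<prec> C"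
  unfolding lesspoll_iff_ordLess by (rule card_of_Un_ordLess_infinite)

lemma lesspoll_insert_infinite: "infinite C \<Longrightarrow> A \<prec> C \<Longrightarrow> insert x A \<prec> C"
  using lesspoll_Un_infinite[of C "{x}" A] finite_lesspoll_infinite[of C "{x}"] by simp

lemma countable_lesspoll_uncountable: "countable A \<Longrightarrow> uncountable B \<Longrightarrow> A \<prec> B"
  unfolding lesspoll_iff_ordLess
  by (simp flip: card_of_ordLess) (meson countable_image_inj_on countable_subset)

lemma countable_Id_on: "countable A \<Longrightarrow> countable (Id_on A)"
  by (simp add: Id_on_def)

lemma image_lesspoll: "A \<prec> C \<Longrightarrow> f ` A \<prec> C"
  using image_lepoll lesspoll_trans1 by blast

lemma saturatedD:
  assumes "saturated L N" "s \<in> sorts L" "A \<subseteq> universe L N" "A \<prec> universe L N"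
    "\<Gamma> \<subseteq> forms_over L N A s"
    "\<And>\<Delta>. \<Delta> \<subseteq> \<Gamma> \<Longrightarrow> finite \<Delta> \<Longrightarrow> \<exists>b\<in>dom_of N s. \<forall>\<gamma>\<in>\<Delta>. b \<in> solutions N s \<gamma>"
  shows "\<exists>b\<in>dom_of N s. \<forall>\<gamma>\<in>\<Gamma>. b \<in> solutions N s \<gamma>"
  using assms unfolding saturated_def by simp

text \<open>The parameters of the two formulas are moved to disjoint sets of variables, keeping \<open>z\<close>.\<close>

lemma merge_forms:
  fixes \<phi>\<^sub>1 \<phi>\<^sub>2 :: "('s, 'f, 'r) fo_form" and s :: 's
  defines "z \<equiv> (s, 0)"
  assumes "wf_form L \<phi>\<^sub>1" "wf_form L \<phi>\<^sub>2"
  obtains \<psi> :: "('s, 'f, 'r) fo_form"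
    and m :: "('s \<times> nat \<Rightarrow> 'a) \<Rightarrow> ('s \<times> nat \<Rightarrow> 'a) \<Rightarrow> 's \<times> nat \<Rightarrow> 'a"
  where "wf_form L \<psi>"
    and "\<And>(N :: ('s, 'f, 'r, 'a) fo_struct) v w c. sat N ((m v w)(z := c)) \<psi> \<longleftrightarrow>
           sat N (v(z := c)) \<phi>\<^sub>1 \<and> sat N (w(z := c)) \<phi>\<^sub>2"
    and "\<And>x. x \<in> fv \<psi> \<Longrightarrow> x \<noteq> z \<Longrightarrow>
           (\<exists>y\<in>fv \<phi>\<^sub>1. y \<noteq> z \<and> fst y = fst x \<and> (\<forall>v w. m v w x = v y)) \<or>
           (\<exists>y\<in>fv \<phi>\<^sub>2. y \<noteq> z \<and> fst y = fst x \<and> (\<forall>v w. m v w x = w y))"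
proof -
  define \<rho>\<^sub>1 :: "'s \<times> nat \<Rightarrow> 's \<times> nat" where "\<rho>\<^sub>1 x = (fst x, 2 * snd x)" for x
  define \<rho>\<^sub>2 :: "'s \<times> nat \<Rightarrow> 's \<times> nat"
    where "\<rho>\<^sub>2 x = (if x = z then x else (fst x, 2 * snd x + 1))" for x
  \<comment> \<open>Even numbers belong to the first formula and odd ones to the second. Doubling
    fixes \<open>z\<close>, whose number is zero; the second renaming has to exempt it
    explicitly.\<close>
  define m :: "('s \<times> nat \<Rightarrow> 'a) \<Rightarrow> ('s \<times> nat \<Rightarrow> 'a) \<Rightarrow> ('s \<times> nat \<Rightarrow> 'a)" where
    "m v w x = (if even (snd x) then v else w) (fst x, snd x div 2)" for v w x
  have inj1: "inj \<rho>\<^sub>1" by (auto simp: inj_def \<rho>\<^sub>1_def prod_eq_iff)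
  have \<rho>z: "\<rho>\<^sub>1 x = z \<longleftrightarrow> x = z" "\<rho>\<^sub>2 x = z \<longleftrightarrow> x = z" for x
    by (cases x; simp add: \<rho>\<^sub>1_def \<rho>\<^sub>2_def z_def)+
  have inj2: "inj \<rho>\<^sub>2"
  proof (rule injI)
    fix x y assume eq: "\<rho>\<^sub>2 x = \<rho>\<^sub>2 y"
    show "x = y"
    proof (cases "x = z \<or> y = z")
      case True
      then show ?thesis using eq \<rho>z by metis
    next
      case False
      then have "fst x = fst y" "snd x = snd y" using eq by (simp_all add: \<rho>\<^sub>2_def)
      then show ?thesis by (rule prod_eqI)
    qed
  qed
  have fst: "fst (\<rho>\<^sub>1 x) = fst x" "fst (\<rho>\<^sub>2 x) = fst x" for x
    by (simp_all add: \<rho>\<^sub>1_def \<rho>\<^sub>2_def)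
  have m1: "m v w (\<rho>\<^sub>1 x) = v x" for v w x by (simp add: m_def \<rho>\<^sub>1_def)
  have m2: "m v w (\<rho>\<^sub>2 x) = w x" if "x \<noteq> z" for v w x
    using that by (simp add: m_def \<rho>\<^sub>2_def)
  have m: "(m v w)(z := c) \<circ> \<rho>\<^sub>1 = v(z := c)" "(m v w)(z := c) \<circ> \<rho>\<^sub>2 = w(z := c)" for v w c
    by (simp_all add: fun_eq_iff \<rho>z m1 m2 del: split_paired_All)
  let ?\<psi> = "And (rename \<rho>\<^sub>1 \<phi>\<^sub>1) (rename \<rho>\<^sub>2 \<phi>\<^sub>2)"
  show thesis
  proof (rule that[of ?\<psi> m])
    show "wf_form L ?\<psi>"
      by (simp add: wf_form_rename[OF fst(1) assms(2)] wf_form_rename[OF fst(2) assms(3)])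
  next
    show "sat N ((m v w)(z := c)) ?\<psi> \<longleftrightarrow> sat N (v(z := c)) \<phi>\<^sub>1 \<and> sat N (w(z := c)) \<phi>\<^sub>2"
      for N :: "('s, 'f, 'r, 'a) fo_struct" and v w c
      by (simp only: sat.simps sat_rename[OF inj1 fst(1)] sat_rename[OF inj2 fst(2)] m)
  next
    fix x assume x: "x \<in> fv ?\<psi>" "x \<noteq> z"
    then consider y where "y \<in> fv \<phi>\<^sub>1" "x = \<rho>\<^sub>1 y" | y where "y \<in> fv \<phi>\<^sub>2" "x = \<rho>\<^sub>2 y"
      by (auto simp: fv_rename[OF inj1] fv_rename[OF inj2])
    then show "(\<exists>y\<in>fv \<phi>\<^sub>1. y \<noteq> z \<and> fst y = fst x \<and> (\<forall>v w. m v w x = v y)) \<or>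
           (\<exists>y\<in>fv \<phi>\<^sub>2. y \<noteq> z \<and> fst y = fst x \<and> (\<forall>v w. m v w x = w y))"
    proof cases
      case 1
      then have "y \<noteq> z" using x(2) \<rho>z by blast
      then show ?thesis using 1 m1 fst by (intro disjI1 bexI[of _ y]) auto
    next
      case 2
      then have "y \<noteq> z" using x(2) \<rho>z by blast
      then show ?thesis using 2 m2 fst by (intro disjI2 bexI[of _ y]) auto
    qed
  qed
qed

text \<open>The type of \<open>b\<close> over the domain of \<open>R\<close>, with each parameter
  replaced by its image, is a type over the range of \<open>R\<close>, and any realization of it is
  a possible image. A finite part is satisfied because one formula implying all of it holds at
  \<open>b\<close>, and \<open>R\<close> preserves its existential quantification over
  \<open>(s, 0)\<close>.\<close>

lemma partial_elementary_extend:
  assumes N: "is_struct L N" and sat: "saturated L N" and R: "partial_elementary L N R"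
    and small: "R \<prec> universe L N" and s: "s \<in> sorts L" and b: "b \<in> dom_of N s"
  obtains b' where "b' \<in> dom_of N s" "partial_elementary L N (insert (b, b') R)"
proof -
  let ?z = "(s, 0)"
  \<comment> \<open>\<open>\<phi>\<close> holds at \<open>b\<close> with parameters
    \<open>v\<close>, and \<open>w\<close> is their image under \<open>R\<close>.\<close>
  define ok where "ok \<phi> v w \<longleftrightarrow> wf_form L \<phi> \<and> assigns N v UNIV (fv \<phi> - {?z}) \<and>
      (\<forall>x\<in>fv \<phi> - {?z}. (v x, w x) \<in> R) \<and> sat N (v(?z := b)) \<phi>" for \<phi> v w
  have okD: "v x \<in> dom_of N (fst x) \<and> (v x, w x) \<in> R" if "ok \<phi> v w" "x \<in> fv \<phi>" "x \<noteq> ?z" for \<phi> v w x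
    using that by (simp add: ok_def assigns_def)
  define \<Gamma> where "\<Gamma> = {(\<phi>, w). \<exists>v. ok \<phi> v w}"
  have "Range R \<subseteq> universe L N"
    using R by (auto simp: partial_elementary_def universe_def)
  moreover have "Range R \<prec> universe L N"
    using image_lesspoll[OF small, of snd] by (simp add: Range_snd)
  moreover have "\<Gamma> \<subseteq> forms_over L N (Range R) s"
  proof (clarsimp simp: \<Gamma>_def forms_over_def)
    fix \<phi> v w assume "ok \<phi> v w"
    then show "wf_form L \<phi> \<and> assigns N w (Range R) (fv \<phi> - {?z})"
      using partial_elementary_assigns[OF R N, of \<phi> "fv \<phi> - {?z}" v w] by (simp add: ok_def)
  qed
  moreover have "\<exists>c\<in>dom_of N s. \<forall>\<gamma>\<in>\<Delta>. c \<in> solutions N s \<gamma>" if "\<Delta> \<subseteq> \<Gamma>" "finite \<Delta>" for \<Delta>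
  proof -
    \<comment> \<open>Up to renaming of parameters \<open>\<Gamma>\<close> is closed under
      conjunction, by \<open>merge_forms\<close>, so a finite part is implied by a single
      member.\<close>
    have "\<exists>\<delta>\<in>\<Gamma>. \<forall>\<gamma>\<in>\<Delta>. solutions N s \<delta> \<subseteq> solutions N s \<gamma>"
      using that(2,1)
    proof (induction)
      case empty
      have "ok (Eq (Var ?z) (Var ?z)) (\<lambda>_. b) (\<lambda>_. b)"
        using s by (auto simp: ok_def assigns_def intro: has_sort.intros)
      then show ?case unfolding \<Gamma>_def by blast
    next
      case (insert \<gamma> \<Delta>)
      then obtain \<delta> where \<delta>: "\<delta> \<in> \<Gamma>" "\<And>\<gamma>. \<gamma> \<in> \<Delta> \<Longrightarrow> solutions N s \<delta> \<subseteq> solutions N s \<gamma>" by blast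
      obtain \<phi>\<^sub>1 v\<^sub>1 w\<^sub>1 where 1: "\<gamma> = (\<phi>\<^sub>1, w\<^sub>1)" "ok \<phi>\<^sub>1 v\<^sub>1 w\<^sub>1" using insert.prems \<Gamma>_def by blast
      obtain \<phi>\<^sub>2 v\<^sub>2 w\<^sub>2 where 2: "\<delta> = (\<phi>\<^sub>2, w\<^sub>2)" "ok \<phi>\<^sub>2 v\<^sub>2 w\<^sub>2" using \<delta>(1) \<Gamma>_def by blast
      have wf: "wf_form L \<phi>\<^sub>1" "wf_form L \<phi>\<^sub>2" using 1 2 by (simp_all add: ok_def)
      obtain \<psi> m where \<psi>: "wf_form L \<psi>"
        and m: "\<And>(N :: ('a, 'b, 'c, 'd) fo_struct) v w c. sat N ((m v w)(?z := c)) \<psi> \<longleftrightarrow>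
           sat N (v(?z := c)) \<phi>\<^sub>1 \<and> sat N (w(?z := c)) \<phi>\<^sub>2"
        and fv: "\<And>x. x \<in> fv \<psi> \<Longrightarrow> x \<noteq> ?z \<Longrightarrow>
           (\<exists>y\<in>fv \<phi>\<^sub>1. y \<noteq> ?z \<and> fst y = fst x \<and> (\<forall>v w. m v w x = v y)) \<or>
           (\<exists>y\<in>fv \<phi>\<^sub>2. y \<noteq> ?z \<and> fst y = fst x \<and> (\<forall>v w. m v w x = w y))"
        by (rule merge_forms[OF wf, of s, where 'a = 'd]) blast
      have "m v\<^sub>1 v\<^sub>2 x \<in> dom_of N (fst x) \<and> (m v\<^sub>1 v\<^sub>2 x, m w\<^sub>1 w\<^sub>2 x) \<in> R"
        if "x \<in> fv \<psi> - {?z}" for x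
      proof -
        from that have "x \<in> fv \<psi>" "x \<noteq> ?z" by blast+
        from fv[OF this] show ?thesis
        proof (elim disjE bexE conjE)
          fix y assume "y \<in> fv \<phi>\<^sub>1" "y \<noteq> ?z" "fst y = fst x" "\<forall>v w. m v w x = v y"
          then show ?thesis using okD[OF 1(2), of y] by simp
        next
          fix y assume "y \<in> fv \<phi>\<^sub>2" "y \<noteq> ?z" "fst y = fst x" "\<forall>v w. m v w x = w y"
          then show ?thesis using okD[OF 2(2), of y] by simp
        qed
      qed
      then have "ok \<psi> (m v\<^sub>1 v\<^sub>2) (m w\<^sub>1 w\<^sub>2)"
        using \<psi> m 1(2) 2(2) by (simp add: ok_def assigns_def)
      then have "(\<psi>, m w\<^sub>1 w\<^sub>2) \<in> \<Gamma>" using \<Gamma>_def by blast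
      moreover have "solutions N s (\<psi>, m w\<^sub>1 w\<^sub>2) = solutions N s \<gamma> \<inter> solutions N s \<delta>"
        unfolding solutions_def 1(1) 2(1) using m by auto
      ultimately show ?case using \<delta>(2) by blast
    qed
    then obtain \<psi> v w where ok: "ok \<psi> v w"
      and sol: "\<And>\<gamma>. \<gamma> \<in> \<Delta> \<Longrightarrow> solutions N s (\<psi>, w) \<subseteq> solutions N s \<gamma>"
      unfolding \<Gamma>_def by blast
    have "sat N v (Ex ?z \<psi>)" using ok b unfolding ok_def by auto
    moreover have "wf_form L (Ex ?z \<psi>)" using ok s by (simp add: ok_def)
    ultimately have "sat N w (Ex ?z \<psi>)"
      using partial_elementary_sat[OF R, of "Ex ?z \<psi>" v w] ok unfolding ok_def fv.simps by blast
    then obtain c where "c \<in> dom_of N s" "sat N (w(?z := c)) \<psi>" by auto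
    then have "c \<in> solutions N s (\<psi>, w)" by (simp add: solutions_def)
    then show ?thesis using sol \<open>c \<in> dom_of N s\<close> by blast
  qed
  ultimately obtain b' where b': "b' \<in> dom_of N s" "\<And>\<gamma>. \<gamma> \<in> \<Gamma> \<Longrightarrow> b' \<in> solutions N s \<gamma>"
    using sat s unfolding saturated_def by metis
  have "partial_elementary L N (insert (b, b') R)"
  proof (rule partial_elementary_insert[OF N R s b b'(1)])
    fix \<phi> v w
    assume *: "wf_form L \<phi>" "assigns N v UNIV (fv \<phi>)" "v ?z = b" "w ?z = b'"
      "\<And>x. x \<in> fv \<phi> \<Longrightarrow> x \<noteq> ?z \<Longrightarrow> (v x, w x) \<in> R" "sat N v \<phi>"
    have "v(?z := b) = v" "w(?z := b') = w" using *(3,4) fun_upd_triv by metis+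
    then have "ok \<phi> v w" using * by (simp add: ok_def assigns_def)
    then have "b' \<in> solutions N s (\<phi>, w)" using b'(2) \<Gamma>_def by blast
    then show "sat N w \<phi>" using \<open>w(?z := b') = w\<close> by (simp add: solutions_def)
  qed
  then show thesis using that b'(1) by blast
qed

text \<open>A transfinite back-and-forth. The universe is well-ordered in the type of its own
  cardinal, so before each stage the map is still smaller than the universe and saturation
  applies.\<close>

theorem saturated_homogeneous:
  assumes L: "wf_sig L" and N: "is_struct L N" and sat: "saturated L N"
    and inf: "infinite (universe L N)"
    and R: "partial_elementary L N R" and small: "R \<prec> universe L N"
  obtains \<sigma> where "\<sigma> \<in> automorphisms L N" "\<And>a b. (a, b) \<in> R \<Longrightarrow> \<sigma> a = b"
proof -
  let ?U = "universe L N"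
  define r where "r = card_of ?U"
  have wo: "well_order_on ?U r" and co: "Card_order r" and fld: "Field r = ?U"
    unfolding r_def by (rule card_of_well_order_on card_of_Card_order Field_card_of)+
  have wf: "wf (r - Id)" and tr: "trans r" and tot: "total_on ?U r"
    using wo by (auto simp: well_order_on_def linear_order_on_def partial_order_on_def preorder_on_def)
  \<comment> \<open>\<open>f y\<close> holds an image and a preimage of \<open>y\<close>, so
    \<open>st f X\<close> is the map once all elements of \<open>X\<close> have been
    treated.\<close>
  define st where "st f X = R \<union> (\<Union>y\<in>X. {(y, fst (f y)), (snd (f y), y)})" for f :: "'d \<Rightarrow> 'd \<times> 'd" and X
  define G where "G f x = (SOME p. partial_elementary L N
      (insert (snd p, x) (insert (x, fst p) (st f (underS r x)))))" for f x
  \<comment> \<open>\<open>G f x\<close> depends on \<open>f\<close> only below \<open>x\<close>, so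
    recursion along the strict part of \<open>r\<close> satisfies the equation without
    \<open>cut\<close>.\<close>
  define f where "f = wfrec (r - Id) G"
  have f: "f x = G f x" for x
  proof -
    have "st (cut f (r - Id) x) (underS r x) = st f (underS r x)"
      unfolding st_def
      by (rule arg_cong[where f = "\<lambda>X. R \<union> X"], rule SUP_cong) (simp_all add: underS_def cut_apply)
    then have "G (cut f (r - Id) x) x = G f x" by (simp add: G_def)
    then show ?thesis using wfrec[OF wf, of G x] by (simp add: f_def)
  qed
  have st_mono: "st f X \<subseteq> st f Y" if "X \<subseteq> Y" for X Y using that by (auto simp: st_def)
  have RS: "R \<subseteq> st f X" for X by (auto simp: st_def)
  have seg: "insert y (underS r y) \<subseteq> insert x (underS r x)" if "(y, x) \<in> r" for x y
  proof
    fix z assume "z \<in> insert y (underS r y)"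
    then show "z \<in> insert x (underS r x)"
      using that transD[OF tr, of z y x] by (auto simp: underS_def)
  qed
  \<comment> \<open>The stages grow along the total order, so a finite part of the union lies in
    \<open>R\<close> or in one stage.\<close>
  have limit: "partial_elementary L N (st f X)"
    if X: "X \<subseteq> ?U" "\<And>y. y \<in> X \<Longrightarrow> partial_elementary L N (st f (insert y (underS r y)))" for X
  proof (rule partial_elementary_finite)
    fix Q assume "finite Q" "Q \<subseteq> st f X"
    then have "Q \<subseteq> R \<or> (\<exists>y\<in>X. Q \<subseteq> st f (insert y (underS r y)))"
    proof (induction)
      case (insert p Q)
      from insert.prems have "p \<in> R \<or> (\<exists>y\<in>X. p \<in> st f {y})" by (auto simp: st_def)
      then consider "p \<in> R" | y where "y \<in> X" "p \<in> st f (insert y (underS r y))"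
        using st_mono[of "{_}" "insert _ (underS r _)"] by blast
      then show ?case
      proof cases
        case 1
        then show ?thesis using insert RS by auto
      next
        case p: 2
        have "Q \<subseteq> R \<or> (\<exists>y\<in>X. Q \<subseteq> st f (insert y (underS r y)))"
          using insert by auto
        then show ?thesis
        proof
          assume "Q \<subseteq> R"
          then show ?thesis using p RS by blast
        next
          assume "\<exists>y\<in>X. Q \<subseteq> st f (insert y (underS r y))"
          then obtain y' where y': "y' \<in> X" "Q \<subseteq> st f (insert y' (underS r y'))" by blast
          have "(y, y') \<in> r \<or> (y', y) \<in> r \<or> y = y'"
            using tot p(1) y'(1) X(1) unfolding total_on_def by blast
          then show ?thesis
            using p y' st_mono[OF seg, of y y'] st_mono[OF seg, of y' y] by blast
        qed
      qed
    qed simp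
    then show "partial_elementary L N Q"
      using X(2) R partial_elementary_subset by blast
  qed
  have good: "partial_elementary L N (st f (insert x (underS r x)))" if "x \<in> ?U" for x
    using wf that
  proof (induction x rule: wf_induct_rule)
    case (less x)
    have "underS r x \<subseteq> ?U" using fld by (auto simp: underS_def Field_def)
    moreover have "partial_elementary L N (st f (insert y (underS r y)))" if "y \<in> underS r x" for y
      using that less.IH[of y] calculation by (auto simp: underS_def)
    ultimately have lim: "partial_elementary L N (st f (underS r x))"
      by (rule limit)
    obtain s where s: "s \<in> sorts L" "x \<in> dom_of N s" using less.prems by (auto simp: universe_def)
    have seg: "underS r x \<prec> ?U"
      unfolding lesspoll_iff_ordLess using card_of_underS[OF co, of x] less.prems fld by (simp add: r_def)
    have "st f (underS r x) = R \<union> ((\<lambda>y. (y, fst (f y))) ` underS r x \<union> (\<lambda>y. (snd (f y), y)) ` underS r x)"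
      by (auto simp: st_def)
    then have sm: "st f (underS r x) \<prec> ?U"
      using small seg by (simp add: lesspoll_Un_infinite[OF inf] image_lesspoll)
    obtain b where b: "b \<in> dom_of N s" "partial_elementary L N (insert (x, b) (st f (underS r x)))"
      using partial_elementary_extend[OF N sat lim sm s] by blast
    let ?Q = "insert (x, b) (st f (underS r x))"
    \<comment> \<open>The back half: extending the converse by an image of \<open>x\<close> gives a
      preimage of \<open>x\<close> for the map itself.\<close>
    have "?Q\<inverse> = prod.swap ` ?Q" by force
    then have "?Q\<inverse> \<prec> ?U"
      by (simp only: image_lesspoll[OF lesspoll_insert_infinite[OF inf sm]])
    then obtain a where "partial_elementary L N (insert (x, a) (?Q\<inverse>))"
      using partial_elementary_extend[OF N sat partial_elementary_converse[OF b(2) N] _ s] by blast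
    from partial_elementary_converse[OF this N] have "partial_elementary L N ((insert (x, a) (?Q\<inverse>))\<inverse>)" .
    moreover have "(insert (x, a) (?Q\<inverse>))\<inverse> = insert (a, x) ?Q" by auto
    ultimately have "partial_elementary L N (insert (a, x) ?Q)" by (simp only:)
    then have "\<exists>p. partial_elementary L N
      (insert (snd p, x) (insert (x, fst p) (st f (underS r x))))" by (intro exI[of _ "(b, a)"]) simp
    then have "partial_elementary L N
      (insert (snd (f x), x) (insert (x, fst (f x)) (st f (underS r x))))"
      unfolding f[of x] G_def by (rule someI_ex)
    moreover have "insert (snd (f x), x) (insert (x, fst (f x)) (st f (underS r x))) =
        st f (insert x (underS r x))" by (auto simp: st_def)
    ultimately show ?case by simp
  qed
  have all: "partial_elementary L N (st f ?U)" by (rule limit) (auto simp: good)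
  have "st f ?U \<subseteq> ?U \<times> ?U"
    using all by (force simp: partial_elementary_def universe_def)
  then have "Domain (st f ?U) = ?U" "Range (st f ?U) = ?U" by (auto simp: st_def)
  from partial_elementary_automorphism[OF L N all this] obtain \<sigma>
    where \<sigma>: "\<sigma> \<in> automorphisms L N" "\<forall>p\<in>st f ?U. \<sigma> (fst p) = snd p" by (auto simp: split_beta)
  show thesis
  proof (rule that[OF \<sigma>(1)])
    show "\<sigma> a = b" if "(a, b) \<in> R" for a b
      using bspec[OF \<sigma>(2) subsetD[OF RS that]] by simp
  qed
qed


section \<open>Countable elementary submodels\<close>

instance fo_term :: (countable, countable) countable
  by countable_datatype

instance fo_form :: (countable, countable, countable) countable
  by countable_datatype

lemma val_restrict_struct: "val (restrict_struct N K) v t = val N v t"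
  by (induction t) (auto simp: restrict_struct_def cong: map_cong)

text \<open>The Skolem hull of the empty set, closed off in countably many rounds, followed by the
  Tarski-Vaught test. Countable symbol types give countably many formulas.\<close>

theorem countable_elementary_submodel:
  fixes L :: "('s :: countable, 'f :: countable, 'r :: countable) signature"
    and N :: "('s, 'f, 'r, 'a) fo_struct"
  assumes L: "wf_sig L" and N: "is_struct L N"
  obtains K where "countable K" "elementary_submodel L K N"
proof -
  define sk where "sk \<phi> x w = (SOME b. b \<in> dom_of N (fst x) \<and> sat N (w(x := b)) \<phi>)"
    for \<phi> :: "('s, 'f, 'r) fo_form" and x w
  \<comment> \<open>Assignments are cut down to the finitely many parameters of
    \<open>\<phi>\<close>, since only countably many of those take values in a countable
    set.\<close>
  define asg where "asg \<phi> x X = {w \<in> (fv \<phi> - {x}) \<rightarrow>\<^sub>E X. \<exists>b\<in>dom_of N (fst x). sat N (w(x := b)) \<phi>}"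
    for \<phi> :: "('s, 'f, 'r) fo_form" and x and X :: "'a set"
  define step where "step X = X \<union> (\<Union>\<phi>. \<Union>x\<in>{x. fst x \<in> sorts L}. sk \<phi> x ` asg \<phi> x X)" for X
  define K where "K = (\<Union>n. (step ^^ n) {})"
  have sk: "sk \<phi> x w \<in> dom_of N (fst x)" "sat N (w(x := sk \<phi> x w)) \<phi>" if "w \<in> asg \<phi> x X" for \<phi> x w X
  proof -
    have "\<exists>b. b \<in> dom_of N (fst x) \<and> sat N (w(x := b)) \<phi>" using that by (auto simp: asg_def)
    from someI_ex[OF this] show "sk \<phi> x w \<in> dom_of N (fst x)" "sat N (w(x := sk \<phi> x w)) \<phi>"
      unfolding sk_def by blast+
  qed
  have "countable (step X)" if "countable X" for X
  proof -
    have "countable (asg \<phi> x X)" for \<phi> x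
      by (rule countable_subset[OF _ countable_PiE[of "fv \<phi> - {x}" "\<lambda>_. X"]])
        (auto simp: asg_def finite_fv that)
    then show ?thesis
      using that unfolding step_def by (intro countable_Un countable_UN countable_image) auto
  qed
  then have "countable ((step ^^ n) {})" for n by (induction n) auto
  then have "countable K" by (simp add: K_def)
  have "(step ^^ n) {} \<subseteq> universe L N" for n
  proof (induction n)
    case (Suc n)
    then show ?case using sk(1) by (auto simp: step_def universe_def)
  qed simp
  then have KU: "K \<subseteq> universe L N" by (auto simp: K_def)
  have inc: "(step ^^ m) {} \<subseteq> (step ^^ n) {}" if "m \<le> n" for m n
    using that by (rule lift_Suc_mono_le[rotated]) (auto simp: step_def)
  \<comment> \<open>The Tarski-Vaught condition. The finitely many parameters already occur in one
    round, and a witness is added in the next.\<close>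
  have TV: "\<exists>b\<in>dom_of N (fst x) \<inter> K. sat N (v(x := b)) \<phi>"
    if x: "fst x \<in> sorts L" and v: "assigns N v K (fv \<phi> - {x})"
      and b: "b \<in> dom_of N (fst x)" "sat N (v(x := b)) \<phi>" for \<phi> v x b
  proof -
    have fin: "\<exists>n. v ` X \<subseteq> (step ^^ n) {}" if "finite X" "v ` X \<subseteq> K" for X
      using that
    proof (induction)
      case (insert y X)
      then obtain m n where "v ` X \<subseteq> (step ^^ m) {}" "v y \<in> (step ^^ n) {}"
        by (auto simp: K_def)
      then have "v ` insert y X \<subseteq> (step ^^ max m n) {}"
        using inc[of m "max m n"] inc[of n "max m n"] by auto
      then show ?case by blast
    qed simp
    have "finite (fv \<phi> - {x})" by (simp add: finite_fv)
    moreover have "v ` (fv \<phi> - {x}) \<subseteq> K"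
      using v unfolding assigns_def by (meson IntD1 image_subsetI)
    ultimately obtain n where n: "v ` (fv \<phi> - {x}) \<subseteq> (step ^^ n) {}"
      using fin by blast
    define w where "w = restrict v (fv \<phi> - {x})"
    have eq: "sat N (w(x := c)) \<phi> \<longleftrightarrow> sat N (v(x := c)) \<phi>" for c
      by (rule sat_cong) (simp add: w_def)
    have w: "w \<in> asg \<phi> x ((step ^^ n) {})"
      unfolding asg_def
    proof (intro CollectI conjI bexI)
      show "w \<in> (fv \<phi> - {x}) \<rightarrow>\<^sub>E (step ^^ n) {}"
        unfolding w_def restrict_PiE_iff using n by blast
      show "sat N (w(x := b)) \<phi>" using b(2) eq by blast
    qed (rule b(1))
    then have "sk \<phi> x w \<in> step ((step ^^ n) {})" unfolding step_def using x by blast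
    then have "sk \<phi> x w \<in> (step ^^ Suc n) {}" by simp
    then have "sk \<phi> x w \<in> K" unfolding K_def by blast
    then show ?thesis using sk[OF w] eq by blast
  qed
  \<comment> \<open>Closure under the function symbols is the Tarski-Vaught condition for the
    formula \<open>x = t\<close>, which has only one solution.\<close>
  have TV_dom: "b \<in> K" if asm: "wf_form L (Eq (Var x) t)" "assigns N v K (fv_term t)" "x \<notin> fv_term t"
    "b \<in> dom_of N (fst x)" "b = val N v t" for x t v b
  proof -
    have val: "val N (v(x := c)) t = val N v t" for c
      using asm(3) by (intro val_cong) auto
    have "fst x \<in> sorts L" using wf_form_fv[OF asm(1), of x] by simp
    moreover have "assigns N v K (fv (Eq (Var x) t) - {x})" using asm(2) by (auto simp: assigns_def)
    moreover have "sat N (v(x := b)) (Eq (Var x) t)" using asm(5) val by simp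
    ultimately obtain c where "c \<in> K" "sat N (v(x := c)) (Eq (Var x) t)" using TV asm(4) by blast
    then show ?thesis using asm(5) val by simp
  qed
  let ?K = "restrict_struct N K"
  have "is_struct L ?K"
    unfolding is_struct_def
  proof (intro conjI ballI allI impI)
    show "disjoint_family_on (dom_of ?K) (sorts L)"
      using N unfolding is_struct_def disjoint_family_on_def restrict_struct_def by fastforce
    show "dom_of ?K s \<noteq> {}" if s: "s \<in> sorts L" for s
    proof -
      have "dom_of N s \<noteq> {}" using N s by (simp add: is_struct_def)
      then obtain b where "b \<in> dom_of N s" by blast
      then show ?thesis
        using TV[of "(s, 0)" _ "Eq (Var (s, 0)) (Var (s, 0))" b] s
        by (auto simp: restrict_struct_def assigns_def)
    qed
    fix f xs assume f: "f \<in> fun_syms L" and xs: "args_in ?K xs (fun_dom L f)"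
    let ?ss = "fun_dom L f" and ?y = "fun_of N f xs"
    let ?ts = "map (\<lambda>k. Var (?ss ! k, Suc k)) [0..<length ?ss]"
    let ?v = "\<lambda>(t, n). case n of 0 \<Rightarrow> ?y | Suc k \<Rightarrow> xs ! k"
    have ss: "set ?ss \<subseteq> sorts L" "fun_cod L f \<in> sorts L" using L f by (auto simp: wf_sig_def)
    have len: "length xs = length ?ss" using xs by (rule list_all2_lengthD)
    have xsN: "args_in N xs ?ss" using xs by (rule list_all2_mono) (simp add: restrict_struct_def)
    then have y: "?y \<in> dom_of N (fun_cod L f)" using N f by (auto simp: is_struct_def)
    have "list_all2 (has_sort L) ?ts ?ss"
      using ss(1) by (auto simp: list_all2_conv_all_nth intro!: has_sort.intros)
    then have 1: "wf_form L (Eq (Var (fun_cod L f, 0)) (Fun f ?ts))"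
      using has_sort.intros(2)[OF f, of ?ts] ss(2) by (auto intro: has_sort.intros)
    have 2: "assigns N ?v K (fv_term (Fun f ?ts))"
      using xs by (auto simp: assigns_def list_all2_conv_all_nth restrict_struct_def)
    have 3: "(fun_cod L f, 0) \<notin> fv_term (Fun f ?ts)" by auto
    have "map (val N ?v) ?ts = xs" using len by (intro nth_equalityI) auto
    then have 4: "?y = val N ?v (Fun f ?ts)" by (simp only: val.simps)
    have "?y \<in> K" by (rule TV_dom[OF 1 2 3 _ 4]) (simp add: y)
    then show "fun_of ?K f xs \<in> dom_of ?K (fun_cod L f)" using y by (simp add: restrict_struct_def)
  qed
  moreover have "sat ?K v \<phi> \<longleftrightarrow> sat N v \<phi>" if "wf_form L \<phi>" "assigns N v K (fv \<phi>)" for \<phi> v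
    using that
  proof (induction \<phi> arbitrary: v)
    case (Rel r ts)
    have "map (val ?K v) ts = map (val N v) ts" by (simp add: val_restrict_struct)
    then show ?case by (simp only: sat.simps) (simp add: restrict_struct_def)
  next
    case (And \<phi> \<psi>)
    have "assigns N v K (fv \<phi>)" "assigns N v K (fv \<psi>)" using And.prems(2) by (auto simp: assigns_def)
    then show ?case using And by simp
  next
    case (Ex x \<phi>)
    have x: "fst x \<in> sorts L" and \<phi>: "wf_form L \<phi>" using Ex.prems(1) by auto
    have "sat ?K (v(x := b)) \<phi> \<longleftrightarrow> sat N (v(x := b)) \<phi>" if "b \<in> dom_of N (fst x) \<inter> K" for b
      using Ex.prems(2) that by (intro Ex.IH \<phi>) (auto simp: assigns_def)
    then have "sat ?K v (Ex x \<phi>) \<longleftrightarrow> (\<exists>b\<in>dom_of N (fst x) \<inter> K. sat N (v(x := b)) \<phi>)"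
      by (simp add: restrict_struct_def)
    also have "\<dots> \<longleftrightarrow> sat N v (Ex x \<phi>)"
      using TV[OF x, of v \<phi>] Ex.prems(2) by auto
    finally show ?case .
  qed (simp_all add: val_restrict_struct)
  ultimately have "elementary_submodel L K N" using KU by (simp add: elementary_submodel_def)
  then show thesis using that \<open>countable K\<close> by blast
qed


section \<open>Angles on the circle\<close>

text \<open>The clockwise angle from \<open>a\<close> to \<open>b\<close>: for unit vectors
  \<open>b = a * cis (- ang a b)\<close>, with a value that is at least zero and less than
  \<open>2 * pi\<close>.\<close>

definition ang :: "complex \<Rightarrow> complex \<Rightarrow> real" where
  "ang a b = Arg2pi (a / b)"

lemma ang_range: "0 \<le> ang a b" "ang a b < 2 * pi"
  by (simp_all add: ang_def Arg2pi_ge_0 Arg2pi_lt_2pi)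

lemma cis_Arg2pi: "norm z = 1 \<Longrightarrow> cis (Arg2pi z) = z"
  by (metis cis_conv_exp complex_norm_eq_1_exp)

lemma Arg2pi_cis: "0 \<le> t \<Longrightarrow> t < 2 * pi \<Longrightarrow> Arg2pi (cis t) = t"
  by (simp add: cis_conv_exp Arg2pi_exp)

lemma eq_cis_ang:
  assumes "norm a = 1" "norm b = 1"
  shows "b = a * cis (- ang a b)"
proof -
  have "cis (ang a b) = a / b" unfolding ang_def using assms by (intro cis_Arg2pi) (simp add: norm_divide)
  moreover have "b \<noteq> 0" "a \<noteq> 0" using assms by auto
  ultimately show ?thesis by (simp add: field_simps flip: cis_inverse)
qed

lemma ang_cis:
  assumes "norm a = 1" "0 \<le> u" "u < 2 * pi"
  shows "ang a (a * cis (- u)) = u"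
proof -
  have "a / (a * cis (- u)) = cis u" using assms(1) by (auto simp: field_simps cis_mult)
  then show ?thesis using assms by (simp add: ang_def Arg2pi_cis)
qed

lemma ang_eqI:
  "norm a = 1 \<Longrightarrow> b = a * cis (- u) \<Longrightarrow> 0 \<le> u \<Longrightarrow> u < 2 * pi \<Longrightarrow> ang a b = u"
  using ang_cis by simp

lemma ang_inject:
  assumes "norm a = 1" "norm b = 1" "norm c = 1"
  shows "ang a b = ang a c \<longleftrightarrow> b = c"
  using eq_cis_ang[OF assms(1,2)] eq_cis_ang[OF assms(1,3)] by metis

lemma ang_self [simp]: "norm a = 1 \<Longrightarrow> ang a a = 0"
  using ang_cis[of a 0] by simp

lemma ang_eq_0:
  assumes "norm a = 1" "norm b = 1"
  shows "ang a b = 0 \<longleftrightarrow> a = b"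
  using ang_inject[of a b a] assms by auto

text \<open>Changing the base point subtracts an angle, and adds a full turn if \<open>c\<close>
  comes before \<open>b\<close> as seen from \<open>a\<close>. With this, order statements on the
  circle become linear arithmetic.\<close>

lemma ang_from:
  assumes "norm a = 1" "norm b = 1" "norm c = 1"
  shows "ang b c = (if ang a b \<le> ang a c then ang a c - ang a b else ang a c - ang a b + 2 * pi)"
proof (rule ang_eqI[OF assms(2)])
  have b: "b = a * cis (- ang a b)" and c: "c = a * cis (- ang a c)"
    using eq_cis_ang assms by auto
  have "a * cis (- ang a c) = a * cis (- ang a b) * cis (- (ang a c - ang a b + 2 * pi * of_int k))" for k :: int
  proof -
    have "cis (- ang a b) * cis (- (ang a c - ang a b + 2 * pi * of_int k)) =
        cis (- ang a c) * cis (2 * pi * of_int (- k))"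
      by (simp add: cis_mult algebra_simps)
    also have "cis (2 * pi * of_int (- k)) = 1" by (rule cis_multiple_2pi) simp
    finally show ?thesis by (simp add: mult.assoc)
  qed
  note * = this[of 0] this[of 1]
  show "c = b * cis (- (if ang a b \<le> ang a c then ang a c - ang a b else ang a c - ang a b + 2 * pi))"
  proof (cases "ang a b \<le> ang a c")
    case True
    then show ?thesis using *(1) by (simp flip: b c)
  next
    case False
    then show ?thesis using *(2) by (simp flip: b c)
  qed
  show "0 \<le> (if ang a b \<le> ang a c then ang a c - ang a b else ang a c - ang a b + 2 * pi)"
    "(if ang a b \<le> ang a c then ang a c - ang a b else ang a c - ang a b + 2 * pi) < 2 * pi"
    using ang_range[of a b] ang_range[of a c] by (simp_all split: if_split)
qed

lemma clockwise_iff_ang: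
  assumes "norm a = 1" "norm b = 1" "norm c = 1"
  shows "clockwise a b c \<longleftrightarrow> 0 < ang a b \<and> ang a b < ang a c"
proof
  assume "clockwise a b c"
  then obtain s t where st: "0 \<le> s" "s < t" "t < 2 * pi" "b = a * cis (- s)" "c = a * cis (- t)" "a \<noteq> b"
    by (auto simp: clockwise_def)
  then have "ang a b = s" "ang a c = t" by (auto intro!: ang_eqI assms(1))
  moreover have "ang a b \<noteq> 0" using st(6) ang_eq_0 assms by simp
  ultimately show "0 < ang a b \<and> ang a b < ang a c" using st by auto
next
  assume *: "0 < ang a b \<and> ang a b < ang a c"
  have "ang a a = 0" using assms by simp
  then have "distinct [a, b, c]" using * by auto
  then show "clockwise a b c"
    unfolding clockwise_def using * eq_cis_ang[OF assms(1,2)] eq_cis_ang[OF assms(1,3)]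
      ang_range[of a b] ang_range[of a c] by (intro conjI exI[of _ "ang a b"] exI[of _ "ang a c"]) auto
qed


section \<open>Automorphisms of the standard structure\<close>

text \<open>A lift to the universal covers: on the sort \<open>i\<close>, of which the circle of sort \<open>1\<close> is the quotient
  by \<open>x \<mapsto> x\<^sup>i\<close>, the map \<open>H\<close> acts as \<open>t \<mapsto> H (i t) / i\<close>.\<close>

locale circle_lift =
  fixes H :: "real \<Rightarrow> real"
  assumes mono: "strict_mono H" and periodic: "H (x + 2 * pi) = H x + 2 * pi" and surj: "surj H"
begin

lemma periodic_nat: "H (x + 2 * pi * real k) = H x + 2 * pi * real k"
proof (induction k)
  case (Suc k)
  have "x + 2 * pi * real (Suc k) = (x + 2 * pi * real k) + 2 * pi"
    by (simp add: algebra_simps)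
  then show ?case by (simp only: periodic Suc)
qed simp

lemma periodic_int: "H (x + 2 * pi * of_int k) = H x + 2 * pi * of_int k"
proof (cases k)
  case (nonneg n)
  then show ?thesis using periodic_nat[of x n] by simp
next
  case (neg n)
  have "x = (x + 2 * pi * of_int k) + 2 * pi * real (Suc n)" by (simp add: neg algebra_simps)
  then have "H x = H (x + 2 * pi * of_int k) + 2 * pi * real (Suc n)" by (metis periodic_nat)
  then show ?thesis by (simp add: neg algebra_simps)
qed

lemma circle_lift_inv: "circle_lift (inv_into UNIV H)"
proof
  have inj: "inj H" using mono by (rule strict_mono_imp_inj_on)
  note bij = surj_f_inv_f[OF surj] inv_f_f[OF inj]
  show "strict_mono (inv_into UNIV H)"
    by (rule strict_monoI) (metis bij(1) mono strict_mono_less)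
  show "inv_into UNIV H (x + 2 * pi) = inv_into UNIV H x + 2 * pi" for x
    by (metis bij periodic)
  show "surj (inv_into UNIV H)" using inj by (rule inj_imp_surj_inv)
qed

definition lift_map :: "nat \<times> complex \<Rightarrow> nat \<times> complex" where
  "lift_map = (\<lambda>x\<in>universe circ_sig circ_struct.
     (fst x, cis (H (real (fst x) * Arg2pi (snd x)) / real (fst x))))"

end

lemma universe_circ: "universe circ_sig circ_struct = {1..} \<times> sphere 0 1"
  by (auto simp: universe_def circ_sig_def circ_struct_def)

lemma dom_circ: "x \<in> dom_of circ_struct i \<longleftrightarrow> fst x = i \<and> norm (snd x) = 1"
  by (cases x) (auto simp: circ_struct_def)

lemma sorts_circ: "i \<in> sorts circ_sig \<longleftrightarrow> 1 \<le> i"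
  by (simp add: circ_sig_def)

lemma circ_fun_args:
  assumes "f \<in> fun_syms circ_sig" "args_in N xs (fun_dom circ_sig f)"
  obtains i x where "1 \<le> i" "f = Rot i \<or> f = Proj i" "xs = [x]" "x \<in> dom_of N i"
  using assms by (auto simp: circ_sig_def list_all2_Cons2)

lemma circ_rel_args:
  assumes "r \<in> rel_syms circ_sig" "args_in N xs (rel_dom circ_sig r)"
  obtains i x y z where "1 \<le> i" "r = Circ i" "xs = [x, y, z]"
    "x \<in> dom_of N i" "y \<in> dom_of N i" "z \<in> dom_of N i"
  using assms by (auto simp: circ_sig_def list_all2_Cons2)

lemma norm_1_cisE:
  assumes "norm z = 1"
  obtains t where "z = cis t"
  using cis_Arg2pi[OF assms] by metis

context circle_lift
begin

text \<open>The definition uses the standard argument; any other argument differs from it by a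
  multiple of \<open>2 * pi\<close>, which changes \<open>H (i t) / i\<close> by the same
  multiple.\<close>

lemma lift_map_cis:
  assumes "1 \<le> i"
  shows "lift_map (i, cis t) = (i, cis (H (real i * t) / real i))"
proof -
  define u where "u = Arg2pi (cis t)"
  have "cis u = cis t" unfolding u_def by (rule cis_Arg2pi) simp
  then obtain k :: int where k: "u = t + 2 * pi * of_int k"
    using complex_eq_iff sin_cos_eq_iff by (metis cis.sel)
  have "real i * u = real i * t + 2 * pi * of_int (int i * k)" by (simp add: k algebra_simps)
  then have "H (real i * u) / real i = H (real i * t) / real i + 2 * pi * of_int k"
    using assms by (simp add: periodic_int add_divide_distrib del: of_int_mult) (simp add: field_simps)
  then have "cis (H (real i * u) / real i) = cis (H (real i * t) / real i)"
    by (simp flip: cis_mult)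
  then show ?thesis using assms by (simp add: lift_map_def universe_circ u_def)
qed

lemma lift_map_inverse:
  assumes "x \<in> universe circ_sig circ_struct"
  shows "circle_lift.lift_map (inv_into UNIV H) (lift_map x) = x"
proof -
  obtain i z where x: "x = (i, z)" "1 \<le> i" "norm z = 1"
    using assms by (auto simp: universe_circ)
  then obtain t where "z = cis t" using norm_1_cisE by metis
  moreover have "inj H" using mono by (rule strict_mono_imp_inj_on)
  ultimately show ?thesis
    using x by (simp add: lift_map_cis circle_lift.lift_map_cis[OF circle_lift_inv])
qed

lemma lift_map_in_dom:
  "x \<in> dom_of circ_struct i \<Longrightarrow> 1 \<le> i \<Longrightarrow> lift_map x \<in> dom_of circ_struct i"
  by (cases x) (simp add: dom_circ lift_map_def universe_circ)

text \<open>The angles of \<open>a\<close>, \<open>b\<close>, \<open>c\<close> can be taken in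
  decreasing order within one period, and the induced map is increasing and commutes with a full
  turn, so it keeps their images in one period too.\<close>

lemma lift_map_clockwise:
  assumes "1 \<le> i" "norm a = 1" "norm b = 1" "norm c = 1" "clockwise a b c"
  shows "clockwise (snd (lift_map (i, a))) (snd (lift_map (i, b))) (snd (lift_map (i, c)))"
proof -
  obtain t where t: "a = cis t" using assms(2) norm_1_cisE by metis
  define u where "u = ang a b"
  define w where "w = ang a c"
  have uw: "0 < u" "u < w" "w < 2 * pi"
    using assms clockwise_iff_ang ang_range unfolding u_def w_def by auto
  have b: "b = cis (t - u)" and c: "c = cis (t - w)"
    unfolding u_def w_def
    using eq_cis_ang[OF assms(2,3)] eq_cis_ang[OF assms(2,4)] by (simp_all add: t cis_mult)
  define h where "h x = H (real i * x) / real i" for x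
  have h: "h x < h y" if "x < y" for x y
    using that assms(1) mono by (auto simp: h_def strict_mono_def divide_strict_right_mono)
  have "real i * t = real i * (t - 2 * pi) + 2 * pi * of_int (int i)" by (simp add: algebra_simps)
  then have "H (real i * t) = H (real i * (t - 2 * pi)) + 2 * pi * real i"
    using periodic_int[of "real i * (t - 2 * pi)" "int i"] by simp
  then have per: "h t = h (t - 2 * pi) + 2 * pi"
    using assms(1) by (simp add: h_def field_simps)
  have lt: "h (t - u) < h t" "h (t - w) < h (t - u)" "h (t - 2 * pi) < h (t - w)"
    using uw by (auto intro: h)
  have ang: "ang (cis (h t)) (cis (h (t - u))) = h t - h (t - u)"
    "ang (cis (h t)) (cis (h (t - w))) = h t - h (t - w)"
    using lt per by (auto intro!: ang_eqI simp: cis_mult)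
  have "snd (lift_map (i, cis x)) = cis (h x)" for x
    by (simp add: lift_map_cis[OF assms(1)] h_def)
  moreover have "clockwise (cis (h t)) (cis (h (t - u))) (cis (h (t - w)))"
    by (subst clockwise_iff_ang) (simp_all add: ang lt)
  ultimately show ?thesis by (simp only: t b c)
qed

text \<open>On angles \<open>Rot i\<close> subtracts \<open>2 * pi / i\<close>, which the scaling by
  \<open>i\<close> turns into the period of \<open>H\<close>, and \<open>Proj i\<close> is
  multiplication by \<open>i\<close>, through which the map on the sort \<open>i\<close> is defined.
  The inverse of \<open>H\<close> is again such a lift, which gives bijectivity and the converse for
  \<open>clockwise\<close>.\<close>

lemma lift_map_automorphism: "lift_map \<in> automorphisms circ_sig circ_struct"
proof -
  let ?U = "universe circ_sig circ_struct"
  interpret G: circle_lift "inv_into UNIV H" by (rule circle_lift_inv)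
  have invinv: "inv_into UNIV (inv_into UNIV H) = H"
    by (intro inv_inv_eq bijI surj strict_mono_imp_inj_on mono)
  have GH: "G.lift_map (lift_map x) = x" "lift_map (G.lift_map x) = x" if "x \<in> ?U" for x
    using lift_map_inverse[OF that] G.lift_map_inverse[OF that] by (simp_all only: invinv)
  have img: "lift_map ` dom_of circ_struct i = dom_of circ_struct i" if "i \<in> sorts circ_sig" for i
  proof -
    have i: "1 \<le> i" and sub: "dom_of circ_struct i \<subseteq> ?U"
      using that by (auto simp: sorts_circ universe_circ dom_circ)
    show ?thesis
    proof
      show "dom_of circ_struct i \<subseteq> lift_map ` dom_of circ_struct i"
      proof
        fix x assume x: "x \<in> dom_of circ_struct i"
        have "lift_map (G.lift_map x) = x" using x sub by (intro GH(2)) blast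
        then show "x \<in> lift_map ` dom_of circ_struct i"
          using G.lift_map_in_dom[OF x i] by (rule image_eqI[OF sym])
      qed
      show "lift_map ` dom_of circ_struct i \<subseteq> dom_of circ_struct i"
        using lift_map_in_dom[OF _ i] by blast
    qed
  qed
  have "inj_on lift_map ?U" using GH(1) by (rule inj_on_inverseI)
  moreover have "lift_map ` ?U = ?U" using img by (simp add: universe_def image_UN)
  moreover have "lift_map \<in> extensional ?U" by (simp add: lift_map_def)
  ultimately have "lift_map \<in> Bij ?U" by (simp add: Bij_def bij_betw_def)
  moreover have "lift_map (fun_of circ_struct f xs) = fun_of circ_struct f (map lift_map xs)"
    if "f \<in> fun_syms circ_sig" "args_in circ_struct xs (fun_dom circ_sig f)" for f xs
  proof -
    from circ_fun_args[OF that] obtain i x where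
      i: "1 \<le> i" "f = Rot i \<or> f = Proj i" and x: "xs = [x]" "x \<in> dom_of circ_struct i" .
    then obtain z where z: "xs = [(i, z)]" "norm z = 1" by (cases x) (simp add: dom_circ)
    obtain t where t: "z = cis t" using z(2) norm_1_cisE by metis
    show ?thesis
      using i(2)
    proof
      assume f: "f = Rot i"
      have "H (real i * t) = H (real i * (t - 2 * pi / real i) + 2 * pi)"
        using i(1) by (simp add: field_simps)
      then have "H (real i * (t - 2 * pi / real i)) = H (real i * t) - 2 * pi"
        using periodic[of "real i * (t - 2 * pi / real i)"] by simp
      then show ?thesis
        using i(1) by (simp add: f z(1) t circ_struct_def cis_mult lift_map_cis diff_divide_distrib
            flip: diff_conv_add_uminus)
    next
      assume f: "f = Proj i"
      show ?thesis
        using i(1) by (simp add: f z(1) t circ_struct_def Complex.DeMoivre lift_map_cis)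
    qed
  qed
  moreover have "rel_of circ_struct r (map lift_map xs) \<longleftrightarrow> rel_of circ_struct r xs"
    if "r \<in> rel_syms circ_sig" "args_in circ_struct xs (rel_dom circ_sig r)" for r xs
  proof -
    from circ_rel_args[OF that] obtain i x y z where i: "1 \<le> i" "r = Circ i" and
      x: "xs = [x, y, z]" "x \<in> dom_of circ_struct i" "y \<in> dom_of circ_struct i" "z \<in> dom_of circ_struct i" .
    then obtain a b c where
      xs: "xs = [(i, a), (i, b), (i, c)]" "norm a = 1" "norm b = 1" "norm c = 1"
      by (cases x; cases y; cases z) (simp add: dom_circ)
    let ?h = "\<lambda>z. snd (lift_map (i, z))"
    have h: "G.lift_map (i, ?h z) = (i, z)" "norm (?h z) = 1" if "norm z = 1" for z
    proof -
      have "(i, z) \<in> ?U" "lift_map (i, z) = (i, ?h z)" using i(1) that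
        by (auto simp: universe_circ lift_map_def)
      then show "G.lift_map (i, ?h z) = (i, z)" using GH(1) by metis
      show "norm (?h z) = 1" using i(1) that by (simp add: universe_circ lift_map_def)
    qed
    have "clockwise (?h a) (?h b) (?h c) \<longleftrightarrow> clockwise a b c"
      using lift_map_clockwise[OF i(1) xs(2-4)] h xs(2-4)
        G.lift_map_clockwise[OF i(1), of "?h a" "?h b" "?h c"] by auto
    then show ?thesis by (simp add: i xs circ_struct_def)
  qed
  ultimately show ?thesis using img by (simp add: automorphisms_def)
qed

end

lemma cis_eq_iff: "cis x = cis y \<longleftrightarrow> (\<exists>k::int. x = y + 2 * pi * of_int k)"
proof
  assume "cis x = cis y"
  then have "sin x = sin y \<and> cos x = cos y" by (metis cis.sel)
  then show "\<exists>k::int. x = y + 2 * pi * of_int k" unfolding sin_cos_eq_iff by blast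
qed (auto simp flip: cis_mult)

text \<open>The witness is piecewise linear with slopes \<open>q \<le> 1\<close> and \<open>1 / q\<close> on the interval from
  \<open>c - s - e\<close> to \<open>c + e\<close>, the identity on the rest of a period, and extended periodically.\<close>

lemma circle_lift_move:
  assumes s: "0 \<le> s" and e: "0 < e" "s + 2 * e \<le> 2 * pi"
  obtains H where "circle_lift H" "H c = c - s"
    "\<And>x. c + e - 2 * pi \<le> x \<Longrightarrow> x \<le> c - s - e \<Longrightarrow> H x = x"
proof -
  define l where "l = c - s - e"
  define r where "r = c + e"
  define b where "b = r - 2 * pi"
  have lr: "b \<le> l" "l \<le> r" "l < r" using s e by (auto simp: l_def r_def b_def)
  \<comment> \<open>Chosen so that the line of slope \<open>q\<close> through
    \<open>(c, c - s)\<close> meets the diagonal at \<open>l\<close>, and the line of slope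
    \<open>1 / q\<close> meets it at \<open>r\<close>.\<close>
  define q where "q = e / (s + e)"
  have q: "0 < q" "q \<le> 1" using s e by (auto simp: q_def)
  \<comment> \<open>Writing the bump with \<open>min\<close> and \<open>max\<close> of increasing
    lines makes strict monotonicity and continuity immediate.\<close>
  define B where "B x = min x (max (c - s + q * (x - c)) (c - s + (x - c) / q))" for x
  have B_mono: "strict_mono B"
  proof (rule strict_monoI)
    fix x y :: real assume "x < y"
    then have "q * (x - c) < q * (y - c)" "(x - c) / q < (y - c) / q"
      using q by (auto intro: mult_strict_left_mono divide_strict_right_mono)
    then show "B x < B y" using \<open>x < y\<close> unfolding B_def by linarith
  qed
  have B_id: "B x = x" if "x \<le> l \<or> r \<le> x" for x
    using that
  proof
    assume "x \<le> l"
    then have "(s + e) * (1 - q) \<le> (c - x) * (1 - q)" using q by (intro mult_right_mono) (auto simp: l_def)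
    also have "(s + e) * (1 - q) = s" using s e by (simp add: q_def field_simps)
    finally have "x \<le> c - s + q * (x - c)" by (simp add: algebra_simps)
    then show ?thesis by (simp add: B_def)
  next
    assume "r \<le> x"
    then have "e * (1 / q - 1) \<le> (x - c) * (1 / q - 1)" using q by (intro mult_right_mono) (auto simp: r_def)
    also have "e * (1 / q - 1) = s" using s e by (simp add: q_def field_simps)
    finally have "x \<le> c - s + (x - c) / q" by (simp add: algebra_simps)
    then show ?thesis by (simp add: B_def)
  qed
  have B_surj: "\<exists>x. B x = y" for y
  proof (cases "y \<le> l \<or> r \<le> y")
    case False
    have "continuous_on {l..r} B" unfolding B_def using q by (intro continuous_intros) auto
    then show ?thesis using False lr B_id IVT'[of B l y r] by auto
  qed (use B_id in blast)
  have B_range: "b \<le> B x \<longleftrightarrow> b \<le> x" "B x < r \<longleftrightarrow> x < r" for x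
    using strict_mono_less_eq[OF B_mono, of b x] strict_mono_less[OF B_mono, of x r]
      B_id[of b] B_id[of r] lr by auto
  \<comment> \<open>The number of the translate of the fundamental interval from \<open>b\<close> to
    \<open>r\<close> that contains \<open>x\<close>.\<close>
  define k where "k x = \<lfloor>(x - b) / (2 * pi)\<rfloor>" for x
  define H where "H x = B (x - 2 * pi * of_int (k x)) + 2 * pi * of_int (k x)" for x
  have r: "r = b + 2 * pi" by (simp add: b_def)
  have split: "\<exists>z n. x = z + 2 * pi * of_int n \<and> b \<le> z \<and> z < r" for x
  proof (intro exI conjI)
    show "x = (x - 2 * pi * of_int (k x)) + 2 * pi * of_int (k x)" by simp
    have "of_int (k x) \<le> (x - b) / (2 * pi)" "(x - b) / (2 * pi) < of_int (k x) + 1"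
      unfolding k_def by linarith+
    then show "b \<le> x - 2 * pi * of_int (k x)" "x - 2 * pi * of_int (k x) < r"
      by (simp_all add: field_simps r)
  qed
  have H: "H (z + 2 * pi * of_int n) = B z + 2 * pi * of_int n" if "b \<le> z" "z < r" for z and n :: int
  proof -
    have "(z + 2 * pi * of_int n - b) / (2 * pi) = (z - b) / (2 * pi) + of_int n"
      by (simp add: field_simps)
    moreover have "\<lfloor>(z - b) / (2 * pi)\<rfloor> = 0"
      using that by (simp add: floor_eq_iff r field_simps)
    ultimately have "k (z + 2 * pi * of_int n) = n" by (simp add: k_def)
    then show ?thesis by (simp add: H_def)
  qed
  have "circle_lift H"
  proof
    show "strict_mono H"
    proof (rule strict_monoI)
      fix x y :: real assume "x < y"
      obtain z m where z: "x = z + 2 * pi * of_int m" "b \<le> z" "z < r" using split by blast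
      obtain w n where w: "y = w + 2 * pi * of_int n" "b \<le> w" "w < r" using split by blast
      have step: "2 * pi * of_int i + 2 * pi \<le> 2 * pi * of_int j" if "i < j" for i j :: int
      proof -
        have "2 * pi * (of_int i + 1) \<le> 2 * pi * of_int j"
          using that by (intro mult_left_mono) auto
        then show ?thesis by (simp add: algebra_simps)
      qed
      consider "m = n" | "m < n" | "n < m" by linarith
      then show "H x < H y"
      proof cases
        case 1
        then show ?thesis
          using \<open>x < y\<close> z w strict_mono_less[OF B_mono] by (simp add: H)
      next
        case 2
        have "B z < r" "b \<le> B w" using B_range z w by auto
        then show ?thesis using step[OF 2] z w r by (simp add: H)
      next
        case 3
        then show ?thesis using step[OF 3] \<open>x < y\<close> z w r by linarith
      qed
    qed
    show "H (x + 2 * pi) = H x + 2 * pi" for x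
    proof -
      obtain z m where z: "x = z + 2 * pi * of_int m" "b \<le> z" "z < r" using split by blast
      have "x + 2 * pi = z + 2 * pi * of_int (m + 1)" by (simp add: z(1) algebra_simps)
      then have "H (x + 2 * pi) = B z + 2 * pi * of_int (m + 1)" by (simp only: H z(2,3))
      moreover have "H x = B z + 2 * pi * of_int m" by (simp only: H z)
      ultimately show ?thesis by (simp add: algebra_simps)
    qed
    have "\<exists>x. H x = y" for y
    proof -
      obtain z m where z: "y = z + 2 * pi * of_int m" "b \<le> z" "z < r" using split by blast
      obtain x where "B x = z" using B_surj by blast
      then have "H (x + 2 * pi * of_int m) = y" using B_range[of x] z by (simp add: H)
      then show ?thesis by blast
    qed
    then show "surj H" by (metis surjI)
  qed
  moreover have "H c = c - s"
    using H[of c 0] s e by (simp add: r_def b_def B_def)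
  moreover have "H x = x" if "c + e - 2 * pi \<le> x" "x \<le> c - s - e" for x
    using H[of x 0] B_id[of x] that lr by (simp add: l_def r_def b_def)
  ultimately show thesis by (rule that)
qed

text \<open>A finite set that misses the arc from \<open>c\<close> to \<open>d\<close> stays at some
  distance \<open>e\<close> from both of its ends. A lift that is the identity beyond this margin
  moves \<open>c\<close> to \<open>d\<close> and fixes everything, in every sort, that projects into
  \<open>P\<close>.\<close>

lemma circle_move:
  assumes c: "norm c = 1" "norm d = 1" and P: "finite P" "\<And>p. p \<in> P \<Longrightarrow> norm p = 1"
    "c \<notin> P" "d \<notin> P" "\<And>p. p \<in> P \<Longrightarrow> \<not> clockwise c p d"
  obtains \<sigma> where "\<sigma> \<in> automorphisms circ_sig circ_struct" "\<sigma> (1, c) = (1, d)"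
    "\<And>i y. 1 \<le> i \<Longrightarrow> norm y = 1 \<Longrightarrow> y ^ i \<in> P \<Longrightarrow> \<sigma> (i, y) = (i, y)"
proof -
  define s where "s = ang c d"
  have gap: "s < ang c p" if "p \<in> P" for p
  proof -
    have "\<not> (0 < ang c p \<and> ang c p < s)"
      using P that c clockwise_iff_ang unfolding s_def by blast
    moreover have "ang c p \<noteq> 0" using ang_eq_0[of c p] P that c by metis
    moreover have "ang c p \<noteq> s" using ang_inject[of c p d] P that c unfolding s_def by metis
    ultimately show ?thesis using ang_range[of c p] by linarith
  qed
  have s: "0 \<le> s" "s < 2 * pi" using ang_range unfolding s_def by auto
  have "\<exists>e>0. s + 2 * e \<le> 2 * pi \<and> (\<forall>p\<in>P. s + e \<le> ang c p \<and> ang c p \<le> 2 * pi - e)"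
    using P(1) gap
  proof (induction P)
    case empty
    show ?case using s by (intro exI[of _ "pi - s / 2"]) auto
  next
    case (insert p P)
    then obtain e where e: "e > 0" "s + 2 * e \<le> 2 * pi"
      "\<And>p. p \<in> P \<Longrightarrow> s + e \<le> ang c p \<and> ang c p \<le> 2 * pi - e" by auto
    define e' where "e' = min e (min (ang c p - s) (2 * pi - ang c p))"
    have "s < ang c p" using insert.prems by simp
    then have "e' > 0" using e(1) ang_range(2)[of c p] by (simp add: e'_def)
    moreover have "e' \<le> e" "s + e' \<le> ang c p" "ang c p \<le> 2 * pi - e'" by (auto simp: e'_def)
    ultimately show ?case using e(2,3) by (intro exI[of _ e']) fastforce
  qed
  then obtain e where e: "e > 0" "s + 2 * e \<le> 2 * pi"
      "\<And>p. p \<in> P \<Longrightarrow> s + e \<le> ang c p \<and> ang c p \<le> 2 * pi - e" by blast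
  obtain t where t: "c = cis t" using c norm_1_cisE by metis
  obtain H where H: "circle_lift H" "H t = t - s"
    "\<And>x. t + e - 2 * pi \<le> x \<Longrightarrow> x \<le> t - s - e \<Longrightarrow> H x = x"
    using circle_lift_move[OF s(1) e(1,2)] by blast
  interpret circle_lift H by (rule H(1))
  show thesis
  proof (rule that[OF lift_map_automorphism])
    have "d = c * cis (- s)" unfolding s_def by (rule eq_cis_ang[OF c])
    then show "lift_map (1, c) = (1, d)"
      using lift_map_cis[of 1 t] by (simp add: t H(2) cis_mult)
  next
    fix i y assume i: "1 \<le> i" "norm y = 1" "y ^ i \<in> P"
    obtain u where u: "y = cis u" using i norm_1_cisE by metis
    define p where "p = y ^ i"
    have "p = c * cis (- ang c p)" using eq_cis_ang c(1) P(2) i(3) unfolding p_def by blast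
    then have "cis (real i * u) = cis (t - ang c p)" by (simp add: p_def u Complex.DeMoivre t cis_mult)
    then obtain k :: int where k: "real i * u = t - ang c p + 2 * pi * of_int k"
      unfolding cis_eq_iff by blast
    have "H (t - ang c p) = t - ang c p" using e(3)[of p] i(3) by (intro H(3)) (auto simp: p_def)
    then have "H (real i * u) = real i * u" unfolding k by (simp add: periodic_int)
    then show "lift_map (i, y) = (i, y)" using i(1) by (simp add: u lift_map_cis)
  qed
qed


section \<open>Cells of the circle\<close>

text \<open>The witness halves the smaller of the two angles. The last clause makes \<open>y\<close>
  precede everything that \<open>x\<close> precedes, so that constraints \<open>k\<close> can be met
  one after another.\<close>

lemma clockwise_left_dense:
  assumes "norm a = 1" "norm x = 1" "norm k = 1" "a \<noteq> x" "a \<noteq> k"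
  obtains y where "norm y = 1" "clockwise a y k"
    "\<And>z. norm z = 1 \<Longrightarrow> clockwise a x z \<Longrightarrow> clockwise a y z"
proof -
  define u where "u = min (ang a x) (ang a k) / 2"
  have pos: "0 < ang a x" "0 < ang a k"
    using ang_range(1) ang_eq_0 assms by (metis less_eq_real_def)+
  then have u: "0 < u" "u < ang a x" "u < ang a k" by (auto simp: u_def)
  have ang: "ang a (a * cis (- u)) = u"
    using u ang_range(2)[of a x] by (intro ang_cis assms(1)) auto
  show thesis
  proof (rule that[of "a * cis (- u)"])
    show n: "norm (a * cis (- u)) = 1" using assms by (simp add: norm_mult)
    show "clockwise a (a * cis (- u)) k"
      using u by (simp add: clockwise_iff_ang assms n ang)
    show "clockwise a (a * cis (- u)) z" if "norm z = 1" "clockwise a x z" for z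
      using u that by (simp add: clockwise_iff_ang assms n ang)
  qed
qed

text \<open>\<open>ang_from\<close> turns all three claims into inequalities between angles measured
  at \<open>k\<close>.\<close>

lemma clockwise_order:
  assumes "norm k = 1" "norm a = 1" "norm c = 1" "norm d = 1" "clockwise k d c"
  shows "\<not> clockwise d k c" "\<not> clockwise c d k" "clockwise k c a \<Longrightarrow> \<not> clockwise d a c"
proof -
  note iff = clockwise_iff_ang
  have "0 < ang k d" "ang k d < ang k c" using assms by (simp_all add: iff)
  then show "\<not> clockwise d k c" "\<not> clockwise c d k" "clockwise k c a \<Longrightarrow> \<not> clockwise d a c"
    using assms(1-4) ang_range[of k a] ang_range[of k c] ang_range[of k d]
    by (auto simp: iff ang_from[OF assms(1,4)] ang_from[OF assms(1,3)])
qed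

lemma ang_mult: "w \<noteq> 0 \<Longrightarrow> ang (a * w) (b * w) = ang a b"
  by (simp add: ang_def)

lemma clockwise_mult:
  assumes "norm a = 1" "norm b = 1" "norm c = 1" "norm w = 1"
  shows "clockwise (a * w) (b * w) (c * w) \<longleftrightarrow> clockwise a b c"
proof -
  have "w \<noteq> 0" using assms(4) by auto
  then show ?thesis using assms by (simp add: clockwise_iff_ang norm_mult ang_mult)
qed

text \<open>For \<open>e = 2 * pi\<close> the end point would coincide with \<open>x\<close> and the
  left side would shrink to \<open>y = x\<close>. This is why cells are only used in the sorts with
  \<open>2 \<le> i\<close>.\<close>

lemma arc_iff_ang:
  assumes "norm x = 1" "norm y = 1" "0 < e" "e < 2 * pi"
  shows "y = x \<or> clockwise x y (x * cis (- e)) \<longleftrightarrow> ang x y < e"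
proof -
  have "ang x (x * cis (- e)) = e" using assms by (intro ang_cis) auto
  then have "clockwise x y (x * cis (- e)) \<longleftrightarrow> 0 < ang x y \<and> ang x y < e"
    using assms by (simp add: clockwise_iff_ang norm_mult)
  moreover have "y = x \<longleftrightarrow> ang x y = 0" using ang_eq_0[OF assms(1,2)] by auto
  ultimately show ?thesis using ang_range(1)[of x y] assms(3) by linarith
qed

lemma ang_cell:
  assumes x: "norm x = 1" and e: "0 < e" "e \<le> 2 * pi"
    and y: "y = x * cis (- (real j * e + u))" "0 \<le> u" "u < e"
  shows "ang (x * cis (- (real j * e))) y = u"
  using e y(2,3) by (intro ang_eqI) (auto simp: norm_mult x y(1) mult.assoc cis_mult)

lemma ex_ang_cell:
  assumes n: "0 < n" and x: "norm x = 1" "norm y = 1"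
  shows "\<exists>j<n. ang (x * cis (- (real j * (2 * pi / real n)))) y < 2 * pi / real n"
proof -
  define e where "e = 2 * pi / real n"
  define j where "j = nat \<lfloor>ang x y / e\<rfloor>"
  have e: "0 < e" "e \<le> 2 * pi" using n by (auto simp: e_def field_simps)
  have "0 \<le> ang x y / e" using e ang_range by simp
  then have "real j \<le> ang x y / e" "ang x y / e < real j + 1" unfolding j_def by linarith+
  then have j: "real j * e \<le> ang x y" "ang x y < real j * e + e" using e by (auto simp: field_simps)
  have "real j * e < real n * e"
    using j(1) ang_range(2)[of x y] n by (simp add: e_def)
  then have "j < n" using e by simp
  moreover have "ang (x * cis (- (real j * e))) y = ang x y - real j * e"
    using eq_cis_ang[OF x] j by (intro ang_cell[OF x(1) e]) auto
  ultimately show ?thesis using j unfolding e_def by (intro exI[of _ j]) auto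
qed

text \<open>Of two points in an arc that begins at \<open>k\<close> and is shorter than
  \<open>e\<close>, the one that comes first sees the other within \<open>e\<close>.\<close>

lemma ang_within:
  assumes "norm k = 1" "norm y = 1" "norm z = 1" "ang k y < e" "ang k z < e"
  shows "ang y z < e \<or> ang z y < e"
  using ang_from[OF assms(1,2,3)] ang_from[OF assms(1,3,2)] ang_range[of k y] ang_range[of k z] assms(4,5)
  by (auto split: if_splits)

text \<open>The step from \<open>y\<close> to \<open>z\<close> may run backwards by almost
  \<open>e\<close>. The extra rotation by \<open>e\<close> puts the total offset from the start of
  cell \<open>j\<close> between zero and \<open>3 * e\<close>, whence three cells and no negative
  index.\<close>

lemma ang_step:
  assumes x: "norm x = 1" "norm y = 1" "norm z = 1" and e: "0 < e" "e \<le> 2 * pi"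
    and y: "ang (x * cis (- (real j * e))) y < e" and z: "ang y z < e \<or> ang z y < e"
  shows "\<exists>m\<in>{j, Suc j, Suc (Suc j)}. ang (x * cis (- (real m * e))) (z * cis (- e)) < e"
proof -
  define u where "u = ang (x * cis (- (real j * e))) y"
  have u: "0 \<le> u" "u < e" using ang_range y by (auto simp: u_def)
  have "y = x * cis (- (real j * e)) * cis (- u)"
    unfolding u_def using x by (intro eq_cis_ang) (simp_all add: norm_mult)
  moreover obtain w where w: "z = y * cis (- w)" "- e < w" "w < e"
    using z
  proof
    assume "ang y z < e"
    then show thesis
      using that[of "ang y z"] eq_cis_ang[OF x(2,3)] ang_range(1)[of y z] e by simp
  next
    assume *: "ang z y < e"
    have "y * cis (ang z y) = z * cis (- ang z y) * cis (ang z y)"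
      using eq_cis_ang[OF x(3,2)] by (rule arg_cong)
    then have "z = y * cis (- (- ang z y))" by (simp add: mult.assoc cis_mult)
    then show thesis
      using that[of "- ang z y"] * ang_range(1)[of z y] e by simp
  qed
  ultimately have zx: "z * cis (- e) = x * cis (- (real j * e + (u + w + e)))"
    by (simp add: mult.assoc cis_mult algebra_simps)
  define v where "v = u + w + e"
  have v: "0 \<le> v" "v < e + e + e" using u w by (auto simp: v_def)
  have "\<exists>i\<le>2. real i * e \<le> v \<and> v < real i * e + e"
  proof -
    consider "v < e" | "e \<le> v" "v < e + e" | "e + e \<le> v" by linarith
    then show ?thesis
    proof cases
      case 1
      then show ?thesis using v by (intro exI[of _ 0]) auto
    next
      case 2
      then show ?thesis using v by (intro exI[of _ 1]) auto
    next
      case 3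
      then show ?thesis using v by (intro exI[of _ 2]) auto
    qed
  qed
  then obtain i where i: "i \<le> 2" "real i * e \<le> v" "v < real i * e + e" by blast
  have "ang (x * cis (- (real (j + i) * e))) (z * cis (- e)) = v - real i * e"
    unfolding zx using i by (intro ang_cell[OF x(1) e]) (simp_all add: v_def algebra_simps)
  moreover have "j + i \<in> {j, Suc j, Suc (Suc j)}" using i(1) by auto
  ultimately show ?thesis using i(3) by (intro bexI[of _ "j + i"]) simp_all
qed

text \<open>The angle amounts to \<open>l - j\<close> steps: at least one step, and less than a full
  turn, so nothing wraps around.\<close>

lemma not_ang_cell:
  assumes x: "norm x = 1" and n: "j < l" "l < j + n"
  shows "\<not> ang (x * cis (- (real j * (2 * pi / real n)))) (x * cis (- (real l * (2 * pi / real n)))) < 2 * pi / real n"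
proof -
  define e where "e = 2 * pi / real n"
  have e: "0 < e" "real n * e = 2 * pi" using n by (auto simp: e_def)
  have "real (l - j) * e < real n * e" "1 * e \<le> real (l - j) * e"
    using e(1) n by (auto intro!: mult_right_mono)
  moreover have "ang (x * cis (- (real j * e))) (x * cis (- (real l * e))) = real (l - j) * e"
    using calculation e n x by (intro ang_eqI) (auto simp: norm_mult mult.assoc cis_mult of_nat_diff algebra_simps)
  ultimately show ?thesis unfolding e_def by simp
qed

lemma power_eq_imp_rotation:
  assumes n: "0 < n" and x: "norm x = 1" "norm y = 1" and eq: "x ^ n = y ^ n"
  shows "\<exists>j<n. y = x * cis (- (real j * (2 * pi / real n)))"
proof -
  define u where "u = ang x y"
  have y: "y = x * cis (- u)" unfolding u_def by (rule eq_cis_ang[OF x])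
  then have "y ^ n = x ^ n * cis (real n * (- u))" by (simp add: power_mult_distrib Complex.DeMoivre)
  then have "cis (real n * (- u)) = cis 0" using eq x by auto
  then obtain k :: int where k: "real n * (- u) = 2 * pi * of_int k" unfolding cis_eq_iff by auto
  have u: "0 \<le> u" "u < 2 * pi" using ang_range by (auto simp: u_def)
  have "2 * pi * of_int k \<le> 0" using u n k by (metis mult_nonneg_nonpos neg_le_0_iff_le of_nat_0_le_iff)
  then have "k \<le> 0" using pi_gt_zero by (auto simp: mult_le_0_iff)
  \<comment> \<open>Angles are measured clockwise while \<open>cis\<close> turns the other way,
    hence the sign.\<close>
  define j where "j = nat (- k)"
  have j: "real j = - of_int k" using \<open>k \<le> 0\<close> by (simp add: j_def)
  have uj: "u = real j * (2 * pi / real n)" using k n by (simp add: j field_simps)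
  have "real j * (2 * pi) = real n * u" using n by (simp add: uj)
  also have "\<dots> < real n * (2 * pi)" using u(2) n by (intro mult_strict_left_mono) auto
  finally have "real j * (2 * pi) < real n * (2 * pi)" .
  then have "j < n" by simp
  then show ?thesis using y uj by blast
qed


section \<open>First-order properties of the circles\<close>

instance circ_fun :: countable
  by countable_datatype

instance circ_rel :: countable
  by countable_datatype

abbreviation "V i n \<equiv> Var (i, n)"
abbreviation "rot_t i t \<equiv> Fun (Rot i) [t]"
abbreviation "proj_t i t \<equiv> Fun (Proj i) [t]"
abbreviation "circ_f i t u w \<equiv> Rel (Circ i) [t, u, w]"

lemma has_sort_Var [simp]: "has_sort L (Var x) s \<longleftrightarrow> fst x = s \<and> s \<in> sorts L"
  by (cases x) (auto intro: has_sort.intros elim: has_sort.cases)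

lemma circ_sig_simps [simp]:
  "Rot i \<in> fun_syms circ_sig \<longleftrightarrow> 1 \<le> i" "Proj i \<in> fun_syms circ_sig \<longleftrightarrow> 1 \<le> i"
  "Circ i \<in> rel_syms circ_sig \<longleftrightarrow> 1 \<le> i" "i \<in> sorts circ_sig \<longleftrightarrow> 1 \<le> i"
  "fun_dom circ_sig (Rot i) = [i]" "fun_dom circ_sig (Proj i) = [i]"
  "fun_cod circ_sig (Rot i) = i" "fun_cod circ_sig (Proj i) = 1"
  "rel_dom circ_sig (Circ i) = [i, i, i]"
  by (auto simp: circ_sig_def)

lemma has_sort_Fun [simp]:
  "has_sort L (Fun f ts) s \<longleftrightarrow> f \<in> fun_syms L \<and> s = fun_cod L f \<and> list_all2 (has_sort L) ts (fun_dom L f)"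
  by (auto intro: has_sort.intros elim: has_sort.cases)

lemma has_sort_rot_funpow [simp]:
  "1 \<le> i \<Longrightarrow> has_sort circ_sig ((rot_t i ^^ j) t) i \<longleftrightarrow> has_sort circ_sig t i"
  by (induction j) auto

lemma fv_rot_funpow [simp]: "fv_term ((rot_t i ^^ j) t) = fv_term t"
  by (induction j) auto

lemma val_rot_funpow [simp]: "val N v ((rot_t i ^^ j) t) = ((\<lambda>x. fun_of N (Rot i) [x]) ^^ j) (val N v t)"
  by (induction j) auto

lemma circ_struct_simps [simp]:
  "fun_of circ_struct (Rot i) [(k, z)] = (i, z * cis (- (2 * pi / real i)))"
  "fun_of circ_struct (Proj i) [(k, z)] = (1, z ^ i)"
  "rel_of circ_struct (Circ i) [(k, a), (k, b), (k, c)] \<longleftrightarrow> clockwise a b c"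
  by (simp_all add: circ_struct_def)

lemma circ_struct_rot_funpow [simp]:
  "((\<lambda>x. fun_of circ_struct (Rot i) [x]) ^^ j) (i, z) = (i, z * cis (- (real j * (2 * pi / real i))))"
  by (induction j) (simp_all add: mult.assoc cis_mult algebra_simps add_divide_distrib)

lemma circ_domE:
  assumes "x \<in> dom_of circ_struct i"
  obtains z where "x = (i, z)" "norm z = 1"
  using assms by (cases x) (auto simp: dom_circ)

lemma is_struct_fun:
  "is_struct L N \<Longrightarrow> f \<in> fun_syms L \<Longrightarrow> args_in N xs (fun_dom L f) \<Longrightarrow>
    fun_of N f xs \<in> dom_of N (fun_cod L f)"
  by (simp add: is_struct_def)

locale circ_model =
  fixes N :: "(nat, circ_fun, circ_rel, 'a) fo_struct"
  assumes model: "is_model circ_sig N (Th circ_sig circ_struct)"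
begin

definition rot :: "nat \<Rightarrow> 'a \<Rightarrow> 'a" where "rot i x = fun_of N (Rot i) [x]"
definition proj :: "nat \<Rightarrow> 'a \<Rightarrow> 'a" where "proj i x = fun_of N (Proj i) [x]"
definition circ :: "nat \<Rightarrow> 'a \<Rightarrow> 'a \<Rightarrow> 'a \<Rightarrow> bool" where "circ i x y z = rel_of N (Circ i) [x, y, z]"

lemma struct: "is_struct circ_sig N"
  using model by (simp add: is_model_def)

lemma rot_in_dom: "x \<in> dom_of N i \<Longrightarrow> 1 \<le> i \<Longrightarrow> rot i x \<in> dom_of N i"
  using is_struct_fun[OF struct, of "Rot i" "[x]"] by (simp add: rot_def)

lemma proj_in_dom: "x \<in> dom_of N i \<Longrightarrow> 1 \<le> i \<Longrightarrow> proj i x \<in> dom_of N 1"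
  using is_struct_fun[OF struct, of "Proj i" "[x]"] by (simp add: proj_def)

lemma funpow_rot_in_dom: "x \<in> dom_of N i \<Longrightarrow> 1 \<le> i \<Longrightarrow> (rot i ^^ j) x \<in> dom_of N i"
  by (induction j) (auto intro: rot_in_dom)

lemma rot_eta: "(\<lambda>x. fun_of N (Rot i) [x]) = rot i"
  by (simp add: rot_def fun_eq_iff)

lemma transfer1:
  assumes "wf_form circ_sig \<phi>" "fv \<phi> \<subseteq> {(i, 0)}" "1 \<le> i"
    and "\<And>a. norm a = 1 \<Longrightarrow> sat circ_struct (asg [(i, a)]) \<phi>"
    and "x \<in> dom_of N i"
  shows "sat N (asg [x]) \<phi>"
  by (rule transfer_asg[OF model assms(1), of "[i]"])
    (use assms in \<open>auto simp: sorts_circ list_all2_Cons2 elim!: circ_domE\<close>)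

lemma transfer2:
  assumes "wf_form circ_sig \<phi>" "fv \<phi> \<subseteq> {(i, 0), (i, 1)}" "1 \<le> i"
    and "\<And>a b. norm a = 1 \<Longrightarrow> norm b = 1 \<Longrightarrow> sat circ_struct (asg [(i, a), (i, b)]) \<phi>"
    and "x \<in> dom_of N i" "y \<in> dom_of N i"
  shows "sat N (asg [x, y]) \<phi>"
  by (rule transfer_asg[OF model assms(1), of "[i, i]"])
    (use assms in \<open>auto simp: sorts_circ list_all2_Cons2 elim!: circ_domE\<close>)

lemma transfer3:
  assumes "wf_form circ_sig \<phi>" "fv \<phi> \<subseteq> {(i, 0), (i, 1), (i, 2)}" "1 \<le> i"
    and "\<And>a b c. norm a = 1 \<Longrightarrow> norm b = 1 \<Longrightarrow> norm c = 1 \<Longrightarrow>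
      sat circ_struct (asg [(i, a), (i, b), (i, c)]) \<phi>"
    and "x \<in> dom_of N i" "y \<in> dom_of N i" "z \<in> dom_of N i"
  shows "sat N (asg [x, y, z]) \<phi>"
  by (rule transfer_asg[OF model assms(1), of "[i, i, i]"])
    (use assms in \<open>auto simp: sorts_circ list_all2_Cons2 elim!: circ_domE\<close>)

section \<open>The circular order of the sort 1 in \<open>N\<close>\<close>

lemma circ_left_dense:
  assumes "a \<in> dom_of N 1" "x \<in> dom_of N 1" "k \<in> dom_of N 1" "a \<noteq> x" "a \<noteq> k"
  obtains y where "y \<in> dom_of N 1" "circ 1 a y k"
    "\<And>z. z \<in> dom_of N 1 \<Longrightarrow> circ 1 a x z \<Longrightarrow> circ 1 a y z"
proof -
  let ?\<phi> = "Imp (And (Neg (Eq (V 1 0) (V 1 1))) (Neg (Eq (V 1 0) (V 1 2))))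
    (Ex (1, 3) (And (circ_f 1 (V 1 0) (V 1 3) (V 1 2))
      (All (1, 4) (Imp (circ_f 1 (V 1 0) (V 1 1) (V 1 4)) (circ_f 1 (V 1 0) (V 1 3) (V 1 4))))))"
  have "sat N (asg [a, x, k]) ?\<phi>"
  proof (rule transfer3[where i = 1])
    fix a b c :: complex assume n: "norm a = 1" "norm b = 1" "norm c = 1"
    show "sat circ_struct (asg [(1, a), (1, b), (1, c)]) ?\<phi>"
    proof (cases "a = b \<or> a = c")
      case False
      then obtain y where "norm y = 1" "clockwise a y c"
          "\<And>z. norm z = 1 \<Longrightarrow> clockwise a b z \<Longrightarrow> clockwise a y z"
        using clockwise_left_dense[OF n] by blast
      then show ?thesis
        by (auto simp: asg_def dom_circ intro!: bexI[of _ "(1, y)"])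
    qed (auto simp: asg_def)
  qed (use assms in \<open>auto simp: sorts_circ\<close>)
  then show thesis
    using assms that by (auto simp: asg_def circ_def)
qed

lemma ex_neq:
  assumes "a \<in> dom_of N 1"
  obtains x where "x \<in> dom_of N 1" "x \<noteq> a"
proof -
  have "sat N (asg [a]) (Ex (1, 1) (Neg (Eq (V 1 1) (V 1 0))))"
  proof (rule transfer1[where i = 1])
    fix a :: complex assume "norm a = 1"
    then have "- a \<noteq> a" "norm (- a) = 1" by (auto simp: neg_eq_iff_add_eq_0)
    then show "sat circ_struct (asg [(1, a)]) (Ex (1, 1) (Neg (Eq (V 1 1) (V 1 0))))"
      by (auto simp: asg_def dom_circ intro!: bexI[of _ "(1, - a)"])
  qed (use assms in \<open>auto simp: sorts_circ\<close>)
  then show thesis using that by (auto simp: asg_def)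
qed

lemma circ_order:
  assumes "k \<in> dom_of N 1" "d \<in> dom_of N 1" "c \<in> dom_of N 1" "circ 1 k d c"
  shows "\<not> circ 1 d k c" "\<not> circ 1 c d k" "k \<noteq> d" "d \<noteq> c" "k \<noteq> c"
proof -
  let ?\<phi> = "Imp (circ_f 1 (V 1 0) (V 1 1) (V 1 2)) (And (Neg (circ_f 1 (V 1 1) (V 1 0) (V 1 2)))
    (And (Neg (circ_f 1 (V 1 2) (V 1 1) (V 1 0))) (And (Neg (Eq (V 1 0) (V 1 1)))
    (And (Neg (Eq (V 1 1) (V 1 2))) (Neg (Eq (V 1 0) (V 1 2)))))))"
  have "sat N (asg [k, d, c]) ?\<phi>"
  proof (rule transfer3[where i = 1])
    fix a b c :: complex assume n: "norm a = 1" "norm b = 1" "norm c = 1"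
    show "sat circ_struct (asg [(1, a), (1, b), (1, c)]) ?\<phi>"
      using clockwise_order[OF n(1) n(1) n(3) n(2)] by (auto simp: asg_def clockwise_def)
  qed (use assms in \<open>auto simp: sorts_circ\<close>)
  then show "\<not> circ 1 d k c" "\<not> circ 1 c d k" "k \<noteq> d" "d \<noteq> c" "k \<noteq> c"
    using assms(4) by (auto simp: asg_def circ_def)
qed

lemma circ_order2:
  assumes "k \<in> dom_of N 1" "d \<in> dom_of N 1" "c \<in> dom_of N 1" "a \<in> dom_of N 1"
    "circ 1 k d c" "circ 1 k c a"
  shows "\<not> circ 1 d a c"
proof -
  let ?\<phi> = "Imp (And (circ_f 1 (V 1 0) (V 1 1) (V 1 2)) (circ_f 1 (V 1 0) (V 1 2) (V 1 3)))
    (Neg (circ_f 1 (V 1 1) (V 1 3) (V 1 2)))"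
  have "sat N (asg [k, d, c, a]) ?\<phi>"
  proof (rule transfer_asg[OF model, of _ "[1, 1, 1, 1]"])
    fix ys assume "args_in circ_struct ys [1, 1, 1, 1 :: nat]"
    then obtain a b c d where "ys = [(1, a), (1, b), (1, c), (1, d)]"
      "norm a = 1" "norm b = 1" "norm c = 1" "norm d = 1"
      by (auto simp: list_all2_Cons2 elim!: circ_domE)
    then show "sat circ_struct (asg ys) ?\<phi>"
      using clockwise_order(3)[of a d c b] by (auto simp: asg_def)
  qed (use assms in \<open>auto simp: sorts_circ\<close>)
  then show ?thesis using assms(5,6) by (simp add: asg_def circ_def)
qed

text \<open>The half-open arc of one rotation step that begins at the \<open>j\<close>-th rotate of
  \<open>x\<close>; including the start and excluding the end lets successive arcs tile the
  circle.\<close>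

definition cell :: "nat \<Rightarrow> nat \<Rightarrow> 'a \<Rightarrow> 'a \<Rightarrow> bool" where
  "cell i j x y \<longleftrightarrow> y = (rot i ^^ j) x \<or> circ i ((rot i ^^ j) x) y (rot i ((rot i ^^ j) x))"

text \<open>Distance less than one rotation step, in either direction.\<close>

definition near :: "nat \<Rightarrow> 'a \<Rightarrow> 'a \<Rightarrow> bool" where
  "near i x y \<longleftrightarrow> cell i 0 x y \<or> cell i 0 y x"

end

text \<open>Placed outside the locale because the same formula is read in two structures: as
  \<open>cell\<close> in \<open>N\<close> and as a condition on \<open>ang\<close> in the standard
  one.\<close>

definition cell_f ::
  "nat \<Rightarrow> nat \<Rightarrow> (nat, circ_fun) fo_term \<Rightarrow> (nat, circ_fun) fo_term \<Rightarrow> (nat, circ_fun, circ_rel) fo_form"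
where "cell_f i j t u = Or (Eq u ((rot_t i ^^ j) t))
    (circ_f i ((rot_t i ^^ j) t) u (rot_t i ((rot_t i ^^ j) t)))"

lemma wf_cell_f [simp]:
  "1 \<le> i \<Longrightarrow> wf_form circ_sig (cell_f i j t u) \<longleftrightarrow> has_sort circ_sig t i \<and> has_sort circ_sig u i"
  by (auto simp: cell_f_def)

lemma fv_cell_f [simp]: "fv (cell_f i j t u) = fv_term t \<union> fv_term u"
  by (auto simp: cell_f_def)

lemma (in circ_model) sat_cell_f [simp]:
  "sat N v (cell_f i j t u) \<longleftrightarrow> cell i j (val N v t) (val N v u)"
  by (simp add: cell_f_def cell_def rot_eta) (simp add: rot_def circ_def)

lemma sat_cell_f_circ_struct:
  assumes "2 \<le> i" "val circ_struct v t = (i, a)" "val circ_struct v u = (i, b)" "norm a = 1" "norm b = 1"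
  shows "sat circ_struct v (cell_f i j t u) \<longleftrightarrow>
    ang (a * cis (- (real j * (2 * pi / real i)))) b < 2 * pi / real i"
proof -
  have e: "0 < 2 * pi / real i" "2 * pi / real i < 2 * pi" using assms(1) by (auto simp: field_simps)
  show ?thesis
    unfolding cell_f_def
    using arc_iff_ang[of "a * cis (- (real j * (2 * pi / real i)))" b, OF _ assms(5) e] assms(2-4)
    by (simp add: norm_mult)
qed

section \<open>Cells, rotations and fibres of the sort \<open>i\<close> in \<open>N\<close>\<close>

context circ_model
begin

text \<open>The \<open>i\<close> arcs cover the circle; for a fixed sort this is a finite
  disjunction and hence transfers.\<close>

lemma cell_total:
  assumes "2 \<le> i" "x \<in> dom_of N i" "y \<in> dom_of N i"
  obtains j where "j < i" "cell i j x y"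
proof -
  let ?\<phi> = "Disj (cell_f i 0 (V i 0) (V i 1)) (map (\<lambda>j. cell_f i j (V i 0) (V i 1)) [0..<i])"
  have "sat N (asg [x, y]) ?\<phi>"
  proof (rule transfer2[where i = i])
    fix a b :: complex assume n: "norm a = 1" "norm b = 1"
    obtain j where "j < i" "ang (a * cis (- (real j * (2 * pi / real i)))) b < 2 * pi / real i"
      using ex_ang_cell[OF _ n, of i] assms(1) by auto
    then have "sat circ_struct (asg [(i, a), (i, b)]) (cell_f i j (V i 0) (V i 1))"
      using assms(1) n by (subst sat_cell_f_circ_struct[of _ _ _ a _ b]) (auto simp: asg_def)
    then show "sat circ_struct (asg [(i, a), (i, b)]) ?\<phi>" using \<open>j < i\<close> by auto
  qed (use assms in auto)
  then show thesis
    using assms(1) that[of 0] that by (auto simp: asg_def)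
qed

lemma near_of_cell:
  assumes "2 \<le> i" "k \<in> dom_of N i" "y \<in> dom_of N i" "z \<in> dom_of N i" "cell i j k y" "cell i j k z"
  shows "near i y z"
proof -
  let ?\<phi> = "Imp (And (cell_f i j (V i 0) (V i 1)) (cell_f i j (V i 0) (V i 2)))
    (Or (cell_f i 0 (V i 1) (V i 2)) (cell_f i 0 (V i 2) (V i 1)))"
  have "sat N (asg [k, y, z]) ?\<phi>"
  proof (rule transfer3[where i = i])
    fix a b c :: complex assume n: "norm a = 1" "norm b = 1" "norm c = 1"
    let ?M = "sat circ_struct (asg [(i, a), (i, b), (i, c)])"
    note M = sat_cell_f_circ_struct[OF assms(1), of "asg [(i, a), (i, b), (i, c)]"]
    have "?M (cell_f i j (V i 0) (V i 1)) \<longleftrightarrow> ang (a * cis (- (real j * (2 * pi / real i)))) b < 2 * pi / real i"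
      using n by (intro M) (simp_all add: asg_def)
    moreover have "?M (cell_f i j (V i 0) (V i 2)) \<longleftrightarrow>
        ang (a * cis (- (real j * (2 * pi / real i)))) c < 2 * pi / real i"
      using n by (intro M) (simp_all add: asg_def)
    moreover have "?M (cell_f i 0 (V i 1) (V i 2)) \<longleftrightarrow> ang b c < 2 * pi / real i"
      using n M[of _ b _ c 0] by (simp add: asg_def)
    moreover have "?M (cell_f i 0 (V i 2) (V i 1)) \<longleftrightarrow> ang c b < 2 * pi / real i"
      using n M[of _ c _ b 0] by (simp add: asg_def)
    ultimately show "?M ?\<phi>"
      using ang_within[of "a * cis (- (real j * (2 * pi / real i)))" b c] n
      by (simp add: norm_mult)
  qed (use assms in auto)
  then show ?thesis using assms(5,6) by (simp add: asg_def near_def)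
qed

text \<open>The transferred form of \<open>ang_step\<close>: moving to a near point and then
  rotating once advances the cell by zero, one or two.\<close>

lemma cell_near:
  assumes "2 \<le> i" "x \<in> dom_of N i" "y \<in> dom_of N i" "z \<in> dom_of N i" "cell i j x y" "near i y z"
  obtains m where "m \<in> {j, Suc j, Suc (Suc j)}" "cell i m x (rot i z)"
proof -
  let ?\<phi> = "Imp (And (cell_f i j (V i 0) (V i 1)) (Or (cell_f i 0 (V i 1) (V i 2)) (cell_f i 0 (V i 2) (V i 1))))
    (Disj (cell_f i j (V i 0) (rot_t i (V i 2)))
      (map (\<lambda>m. cell_f i m (V i 0) (rot_t i (V i 2))) [Suc j, Suc (Suc j)]))"
  have "sat N (asg [x, y, z]) ?\<phi>"
  proof (rule transfer3[where i = i])
    fix a b c :: complex assume n: "norm a = 1" "norm b = 1" "norm c = 1"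
    let ?M = "sat circ_struct (asg [(i, a), (i, b), (i, c)])"
    note M = sat_cell_f_circ_struct[OF assms(1), of "asg [(i, a), (i, b), (i, c)]"]
    have "?M (cell_f i j (V i 0) (V i 1)) \<longleftrightarrow> ang (a * cis (- (real j * (2 * pi / real i)))) b < 2 * pi / real i"
      using n by (intro M) (simp_all add: asg_def)
    moreover have "?M (cell_f i 0 (V i 1) (V i 2)) \<longleftrightarrow> ang b c < 2 * pi / real i"
      using n M[of _ b _ c 0] by (simp add: asg_def)
    moreover have "?M (cell_f i 0 (V i 2) (V i 1)) \<longleftrightarrow> ang c b < 2 * pi / real i"
      using n M[of _ c _ b 0] by (simp add: asg_def)
    moreover have "?M (cell_f i m (V i 0) (rot_t i (V i 2))) \<longleftrightarrow>
        ang (a * cis (- (real m * (2 * pi / real i)))) (c * cis (- (2 * pi / real i))) < 2 * pi / real i" for m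
      using n by (intro M) (simp_all add: asg_def norm_mult)
    moreover have "0 < 2 * pi / real i" "2 * pi / real i \<le> 2 * pi"
      using assms(1) by (auto simp: field_simps)
    ultimately show "?M ?\<phi>" using ang_step[OF n, of "2 * pi / real i" j] by auto
  qed (use assms in auto)
  then show ?thesis using assms(5,6) that by (auto simp: asg_def near_def rot_def)
qed

lemma not_cell_rot:
  assumes "2 \<le> i" "x \<in> dom_of N i" "j < l" "l < j + i"
  shows "\<not> cell i j x ((rot i ^^ l) x)"
proof -
  let ?\<phi> = "Neg (cell_f i j (V i 0) ((rot_t i ^^ l) (V i 0)))"
  have "sat N (asg [x]) ?\<phi>"
  proof (rule transfer1[where i = i])
    fix a :: complex assume n: "norm a = 1"
    show "sat circ_struct (asg [(i, a)]) ?\<phi>"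
      using not_ang_cell[OF n assms(3,4)] assms(1) n
      by (simp, subst sat_cell_f_circ_struct[of i _ _ a _ "a * cis (- (real l * (2 * pi / real i)))"])
        (auto simp: asg_def norm_mult)
  qed (use assms in auto)
  then show ?thesis by (simp add: asg_def rot_eta)
qed

lemma proj_surj:
  assumes "1 \<le> i" "a \<in> dom_of N 1"
  obtains x where "x \<in> dom_of N i" "proj i x = a"
proof -
  have "sat N (asg [a]) (Ex (i, 1) (Eq (proj_t i (V i 1)) (V 1 0)))"
  proof (rule transfer1[where i = 1])
    fix a :: complex assume "norm a = 1"
    then obtain t where t: "a = cis t" using norm_1_cisE by metis
    then show "sat circ_struct (asg [(1, a)]) (Ex (i, 1) (Eq (proj_t i (V i 1)) (V 1 0)))"
      using assms(1) by (auto simp: asg_def dom_circ Complex.DeMoivre intro!: bexI[of _ "(i, cis (t / real i))"])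
  qed (use assms in auto)
  then show thesis using that by (auto simp: asg_def proj_def)
qed

text \<open>Two \<open>i\<close>-th roots of the same number differ by an \<open>i\<close>-th root
  of unity, that is, by a power of the rotation.\<close>

lemma proj_eq_imp_rot:
  assumes "1 \<le> i" "x \<in> dom_of N i" "y \<in> dom_of N i" "proj i x = proj i y"
  obtains j where "j < i" "y = (rot i ^^ j) x"
proof -
  let ?eq = "\<lambda>j. Eq (V i 1) ((rot_t i ^^ j) (V i 0))"
  let ?\<phi> = "Imp (Eq (proj_t i (V i 0)) (proj_t i (V i 1))) (Disj (?eq 0) (map ?eq [0..<i]))"
  have "sat N (asg [x, y]) ?\<phi>"
  proof (rule transfer2[where i = i])
    fix a b :: complex assume n: "norm a = 1" "norm b = 1"
    show "sat circ_struct (asg [(i, a), (i, b)]) ?\<phi>"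
    proof (cases "a ^ i = b ^ i")
      case True
      then obtain j where j: "j < i" "b = a * cis (- (real j * (2 * pi / real i)))"
        using power_eq_imp_rotation[OF _ n, of i] assms(1) by auto
      then have "sat circ_struct (asg [(i, a), (i, b)]) (?eq j)" by (simp add: asg_def)
      then have "\<exists>\<psi>\<in>set (map ?eq [0..<i]). sat circ_struct (asg [(i, a), (i, b)]) \<psi>"
        using j(1) by (intro bexI[of _ "?eq j"]) auto
      then show ?thesis by (simp only: Imp_simps Disj_simps) blast
    qed (simp add: asg_def)
  qed (use assms in auto)
  then show thesis using assms that[of 0] that by (auto simp: asg_def proj_def rot_eta)
qed

lemma rot_properties:
  assumes "1 \<le> i" "x \<in> dom_of N i" "y \<in> dom_of N i" "z \<in> dom_of N i"
  shows funpow_rot_sort: "(rot i ^^ i) x = x"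
    and proj_rot: "proj i (rot i x) = proj i x"
    and circ_rot: "circ i (rot i x) (rot i y) (rot i z) \<longleftrightarrow> circ i x y z"
proof -
  let ?r = "\<lambda>n. rot_t i (V i n)"
  let ?c = "circ_f i (V i 0) (V i 1) (V i 2)" and ?cr = "circ_f i (?r 0) (?r 1) (?r 2)"
  let ?\<phi> = "And (Eq ((rot_t i ^^ i) (V i 0)) (V i 0)) (And (Eq (proj_t i (?r 0)) (proj_t i (V i 0)))
    (And (Imp ?c ?cr) (Imp ?cr ?c)))"
  have "sat N (asg [x, y, z]) ?\<phi>"
  proof (rule transfer3[where i = i])
    fix a b c :: complex assume n: "norm a = 1" "norm b = 1" "norm c = 1"
    have "cis (- (real i * (2 * pi / real i))) = 1"
      using assms(1) cis_multiple_2pi[of "-1"] by simp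
    moreover have "(a * cis (- (2 * pi / real i))) ^ i = a ^ i * cis (- (real i * (2 * pi / real i)))"
      by (simp add: power_mult_distrib Complex.DeMoivre)
    ultimately show "sat circ_struct (asg [(i, a), (i, b), (i, c)]) ?\<phi>"
      using clockwise_mult[OF n, of "cis (- (2 * pi / real i))"] by (simp add: asg_def)
  qed (use assms in auto)
  then show "(rot i ^^ i) x = x" "proj i (rot i x) = proj i x"
    "circ i (rot i x) (rot i y) (rot i z) \<longleftrightarrow> circ i x y z"
    by (auto simp: asg_def rot_eta) (auto simp: rot_def proj_def circ_def)
qed

end


section \<open>Elements of the sort 1\<close>

context circ_model
begin

lemma proj_1:
  assumes "x \<in> dom_of N 1"
  shows "proj 1 x = x"
proof -
  have "sat N (asg [x]) (Eq (proj_t 1 (V 1 0)) (V 1 0))"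
    by (rule transfer1[where i = 1]) (use assms in \<open>auto simp: asg_def\<close>)
  then show ?thesis by (simp add: asg_def proj_def)
qed

text \<open>\<open>circle_move\<close> speaks of the standard structure only. For each formula it
  yields a first-order statement: some parameter projects onto \<open>c\<close>, onto
  \<open>d\<close> or into the open arc between them, or \<open>\<phi>\<close> passes from
  \<open>c\<close> to \<open>d\<close>. This transfers, and in \<open>N\<close> the assumption
  \<open>arc\<close> excludes the first alternative.\<close>

lemma partial_elementary_move:
  assumes A: "A \<subseteq> universe circ_sig N" and c: "c \<in> dom_of N 1" and d: "d \<in> dom_of N 1"
    and arc: "\<And>i x. 1 \<le> i \<Longrightarrow> x \<in> A \<Longrightarrow> x \<in> dom_of N i \<Longrightarrow>
      proj i x \<noteq> c \<and> proj i x \<noteq> d \<and> \<not> circ 1 c (proj i x) d"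
  shows "partial_elementary circ_sig N (insert (c, d) (Id_on A))"
proof (rule partial_elementary_Id_on_insert[OF struct A _ c d])
  let ?M = "circ_struct"
  fix \<phi> :: "(nat, circ_fun, circ_rel) fo_form" and v :: "nat \<times> nat \<Rightarrow> 'a"
  assume wf: "wf_form circ_sig \<phi>" and v: "assigns N v A (fv \<phi> - {(1, 0)})"
    and sat: "sat N (v((1, 0) := c)) \<phi>"
  let ?q = "(1, 0) :: nat \<times> nat"
  have "finite (insert 0 (snd ` fv \<phi>))" by (simp add: finite_fv)
  \<comment> \<open>The variable \<open>(1, n)\<close> will stand for \<open>d\<close>; it must not
    occur free in \<open>\<phi>\<close> and must differ from \<open>(1, 0)\<close>.\<close>
  then obtain n where "n \<notin> insert 0 (snd ` fv \<phi>)" using ex_new_if_finite infinite_UNIV_nat by metis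
  moreover have "(1, n) \<in> fv \<phi> \<Longrightarrow> n \<in> snd ` fv \<phi>"
    by (rule image_eqI[where x = "(1, n)"]) simp_all
  ultimately have n: "(1, n) \<notin> fv \<phi>" "n \<noteq> 0" by auto
  let ?q' = "(1, n) :: nat \<times> nat"
  obtain xs where xs: "set xs = fv \<phi> - {?q}"
    using finite_fv[of \<phi>] finite_list[of "fv \<phi> - {?q}"] by auto
  define pt where "pt x = proj_t (fst x) (Var x)" for x :: "nat \<times> nat"
  define bad where "bad x = Disj (Eq (pt x) (Var ?q)) [Eq (pt x) (Var ?q'), circ_f 1 (Var ?q) (pt x) (Var ?q')]" for x
  \<comment> \<open>The existential subformula asserts \<open>\<phi>\<close> with \<open>d\<close>
    in place of \<open>c\<close>, again without substitution.\<close>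
  define \<theta> where "\<theta> = Disj (Imp \<phi> (Ex ?q (And (Eq (Var ?q) (Var ?q')) \<phi>))) (map bad xs)"
  define u where "u = v(?q := c, ?q' := d)"
  have fst_xs: "1 \<le> fst x" if "x \<in> set xs" for x
    using wf_form_fv[OF wf, of x] that xs by auto
  have "sat N u \<theta>"
  proof (rule transfer[OF model, where X = "insert ?q (insert ?q' (fv \<phi>))"])
    show "wf_form circ_sig \<theta>"
      using wf fst_xs by (simp add: \<theta>_def bad_def pt_def)
    show "fv \<theta> \<subseteq> insert ?q (insert ?q' (fv \<phi>))"
      using xs by (auto simp: \<theta>_def bad_def pt_def)
    show "fst ` insert ?q (insert ?q' (fv \<phi>)) \<subseteq> sorts circ_sig"
      using wf_form_fv[OF wf] by auto
    show "assigns N u UNIV (insert ?q (insert ?q' (fv \<phi>)))"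
      using v c d n by (auto simp: assigns_def u_def)
  next
    fix w :: "nat \<times> nat \<Rightarrow> nat \<times> complex"
    assume w: "assigns ?M w UNIV (insert ?q (insert ?q' (fv \<phi>)))"
    show "sat ?M w \<theta>"
    proof (cases "\<exists>x\<in>set xs. sat ?M w (bad x)")
      case True
      then show ?thesis by (auto simp: \<theta>_def)
    next
      case False
      have wx: "w x = (fst x, snd (w x))" "norm (snd (w x)) = 1"
        if "x \<in> insert ?q (insert ?q' (fv \<phi>))" for x
      proof -
        have "w x \<in> dom_of ?M (fst x)" using w that unfolding assigns_def by blast
        then show "w x = (fst x, snd (w x))" "norm (snd (w x)) = 1"
          by (simp_all add: dom_circ prod_eq_iff)
      qed
      define c' where "c' = snd (w ?q)"
      define d' where "d' = snd (w ?q')"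
      have c': "w ?q = (1, c')" "norm c' = 1" and d': "w ?q' = (1, d')" "norm d' = 1"
        unfolding c'_def d'_def using wx[of ?q] wx[of ?q'] by simp_all
      define P where "P = (\<lambda>x. snd (w x) ^ fst x) ` set xs"
      have val: "val ?M w (pt x) = (1, snd (w x) ^ fst x)" for x
        by (cases "w x") (simp add: pt_def)
      have P: "norm p = 1" "c' \<noteq> p" "d' \<noteq> p" "\<not> clockwise c' p d'" if p: "p \<in> P" for p
      proof -
        obtain x where x: "x \<in> set xs" "p = snd (w x) ^ fst x" using p unfolding P_def by blast
        have "x \<in> insert ?q (insert ?q' (fv \<phi>))" using x(1) xs by blast
        then show "norm p = 1" using wx(2)[of x] by (simp add: x(2) norm_power)
        have "\<not> sat ?M w (bad x)" using False x(1) by blast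
        then show "c' \<noteq> p" "d' \<noteq> p" "\<not> clockwise c' p d'"
          by (auto simp: bad_def val x(2) c'(1)[unfolded One_nat_def] d'(1)[unfolded One_nat_def])
      qed
      have "finite P" "c' \<notin> P" "d' \<notin> P" using P(2,3) by (auto simp: P_def)
      then obtain \<sigma> where \<sigma>: "\<sigma> \<in> automorphisms circ_sig ?M" "\<sigma> (1, c') = (1, d')"
        "\<And>i y. 1 \<le> i \<Longrightarrow> norm y = 1 \<Longrightarrow> y ^ i \<in> P \<Longrightarrow> \<sigma> (i, y) = (i, y)"
        using circle_move[OF c'(2) d'(2) _ P(1) _ _ P(4)] by blast
      have "sat ?M (w(?q := w ?q')) \<phi>" if "sat ?M w \<phi>"
      proof -
        have "assigns ?M w UNIV (fv \<phi>)" using w by (simp add: assigns_def)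
        then have "sat ?M (\<sigma> \<circ> w) \<phi>"
          using sat_automorphism[OF wf_sig_circ_sig is_struct_circ_struct \<sigma>(1) wf] that by blast
        moreover have "(\<sigma> \<circ> w) x = (w(?q := w ?q')) x" if x: "x \<in> fv \<phi>" for x
        proof (cases "x = ?q")
          case True
          then show ?thesis using \<sigma>(2) by (simp only: comp_apply fun_upd_same c'(1) d'(1))
        next
          case False
          then have xs': "x \<in> set xs" using x xs by blast
          have "\<sigma> (fst x, snd (w x)) = (fst x, snd (w x))"
            using xs' fst_xs wx(2)[of x] x by (intro \<sigma>(3)) (auto simp: P_def)
          moreover have "w x = (fst x, snd (w x))" using wx(1)[of x] x by blast
          ultimately have "\<sigma> (w x) = w x" by (simp only:)
          then show ?thesis using False by simp
        qed
        ultimately show ?thesis using sat_cong[of \<phi> "\<sigma> \<circ> w" "w(?q := w ?q')" ?M] by blast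
      qed
      moreover have "w ?q' \<in> dom_of ?M 1" using w by (simp add: assigns_def)
      ultimately show ?thesis using n(2) by (auto simp: \<theta>_def)
    qed
  qed (simp add: finite_fv)
  moreover have "\<not> sat N u (bad x)" if x: "x \<in> set xs" for x
  proof -
    have "x \<in> fv \<phi> - {?q}" using x xs by blast
    then have "v x \<in> A" "v x \<in> dom_of N (fst x)" using v by (auto simp: assigns_def)
    moreover have "x \<noteq> ?q" "x \<noteq> ?q'" using \<open>x \<in> fv \<phi> - {?q}\<close> n(1) by blast+
    then have "u x = v x" by (simp add: u_def)
    ultimately show ?thesis
      using arc[OF fst_xs[OF x], of "v x"] n(2) by (simp add: bad_def pt_def u_def proj_def circ_def)
  qed
  moreover have "sat N u \<phi>"
  proof -
    have "u x = (v(?q := c)) x" if "x \<in> fv \<phi>" for x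
    proof -
      have "x \<noteq> ?q'" using that n(1) by blast
      then show ?thesis by (simp add: u_def)
    qed
    then show ?thesis using sat sat_cong[of \<phi> u "v(?q := c)" N] by blast
  qed
  ultimately obtain e where "e = d" "sat N (u(?q := e)) \<phi>"
    using n(2) by (auto simp: \<theta>_def u_def)
  moreover have "sat N (u(?q := d)) \<phi> \<longleftrightarrow> sat N (v(?q := d)) \<phi>"
  proof (rule sat_cong)
    fix x assume "x \<in> fv \<phi>"
    then have "x \<noteq> ?q'" using n(1) by blast
    then show "(u(?q := d)) x = (v(?q := d)) x" by (cases "x = ?q") (simp_all add: u_def)
  qed
  ultimately show "sat N (v(?q := d)) \<phi>" by simp
qed simp

text \<open>Left density is applied once per element of \<open>F\<close>: each time the witness
  moves closer to \<open>k\<close> and keeps the constraints already met.\<close>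

lemma ex_circ_finite:
  assumes k: "k \<in> dom_of N 1" and F: "finite F" "F \<subseteq> dom_of N 1 - {k}"
  shows "\<exists>y\<in>dom_of N 1. y \<noteq> k \<and> (\<forall>x\<in>F. circ 1 k y x)"
  using F
proof (induction F)
  case empty
  show ?case using ex_neq[OF k] by blast
next
  case (insert x F)
  then obtain y where y: "y \<in> dom_of N 1" "y \<noteq> k" "\<forall>x\<in>F. circ 1 k y x" by auto
  have x: "x \<in> dom_of N 1" "k \<noteq> x" using insert.prems by auto
  obtain z where z: "z \<in> dom_of N 1" "circ 1 k z x" "\<And>w. w \<in> dom_of N 1 \<Longrightarrow> circ 1 k y w \<Longrightarrow> circ 1 k z w"
    using circ_left_dense[OF k y(1) x(1)] y(2) x(2) by metis
  have "z \<noteq> k" using circ_order(3)[OF k z(1) x(1) z(2)] by blast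
  moreover have "\<forall>w\<in>F. circ 1 k z w" using z(3) y(3) insert.prems by blast
  ultimately show ?case using z(1,2) by blast
qed

text \<open>Saturation turns \<open>ex_circ_finite\<close> into a point infinitesimally close to
  \<open>k\<close> on its clockwise side, before all other points of \<open>A\<close>.\<close>

lemma ex_circ_countable:
  assumes sat: "saturated circ_sig N" and unc: "uncountable (universe circ_sig N)"
    and A: "countable A" "A \<subseteq> universe circ_sig N" and k: "k \<in> A" "k \<in> dom_of N 1"
  obtains y where "y \<in> dom_of N 1" "y \<noteq> k" "\<And>x. x \<in> A \<Longrightarrow> x \<in> dom_of N 1 \<Longrightarrow> x \<noteq> k \<Longrightarrow> circ 1 k y x"
proof -
  let ?B = "A \<inter> dom_of N 1 - {k}"
  define w where "w x = (\<lambda>p :: nat \<times> nat. if snd p = 1 then k else x)" for x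
  define \<phi> :: "(nat, circ_fun, circ_rel) fo_form" where "\<phi> = circ_f 1 (V 1 1) (V 1 0) (V 1 2)"
  define \<psi> :: "(nat, circ_fun, circ_rel) fo_form" where "\<psi> = Neg (Eq (V 1 0) (V 1 1))"
  \<comment> \<open>The formula \<open>\<psi>\<close> is added separately, because for empty
    \<open>?B\<close> nothing else would keep the solution away from \<open>k\<close>.\<close>
  define \<Gamma> where "\<Gamma> = insert (\<psi>, w k) ((\<lambda>x. (\<phi>, w x)) ` ?B)"
  have sol_\<phi>: "solutions N 1 (\<phi>, w x) = {y \<in> dom_of N 1. circ 1 k y x}" for x
    by (auto simp: solutions_def \<phi>_def w_def circ_def)
  have sol_\<psi>: "solutions N 1 (\<psi>, w x) = {y \<in> dom_of N 1. y \<noteq> k}" for x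
    by (auto simp: solutions_def \<psi>_def w_def)
  have "\<Gamma> \<subseteq> forms_over circ_sig N A 1"
    using k by (auto simp: \<Gamma>_def forms_over_def \<phi>_def \<psi>_def w_def assigns_def)
  note \<Gamma> = this
  have fin: "\<exists>y\<in>dom_of N 1. \<forall>\<gamma>\<in>\<Delta>. y \<in> solutions N 1 \<gamma>" if \<Delta>: "\<Delta> \<subseteq> \<Gamma>" "finite \<Delta>" for \<Delta>
  proof -
    let ?F = "{x \<in> ?B. (\<phi>, w x) \<in> \<Delta>}"
    \<comment> \<open>The parameter \<open>x\<close> can be read off its formula, so a finite
      \<open>\<Delta>\<close> mentions finitely many points.\<close>
    have "x = snd (\<phi>, w x) (1, 2)" for x by (simp add: w_def)
    then have "?F \<subseteq> (\<lambda>\<gamma>. snd \<gamma> (1, 2)) ` \<Delta>" by (metis (no_types, lifting) image_eqI mem_Collect_eq subsetI)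
    then have "finite ?F" using \<Delta>(2) finite_surj by blast
    then obtain y where y: "y \<in> dom_of N 1" "y \<noteq> k" "\<forall>x\<in>?F. circ 1 k y x"
      using ex_circ_finite[OF k(2), of ?F] by blast
    have "y \<in> solutions N 1 \<gamma>" if \<gamma>: "\<gamma> \<in> \<Delta>" for \<gamma>
    proof -
      have "\<gamma> \<in> \<Gamma>" using \<gamma> \<Delta>(1) by blast
      then consider "\<gamma> = (\<psi>, w k)" | x where "x \<in> ?B" "\<gamma> = (\<phi>, w x)"
        unfolding \<Gamma>_def by blast
      then show ?thesis
      proof cases
        case 1
        then show ?thesis using y by (simp only: sol_\<psi>) simp
      next
        case 2
        then show ?thesis using y \<gamma> by (simp only: sol_\<phi>) simp
      qed
    qed
    then show ?thesis using y(1) by blast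
  qed
  have small: "A \<prec> universe circ_sig N" using A(1) unc by (rule countable_lesspoll_uncountable)
  obtain y where y: "y \<in> dom_of N 1" "\<forall>\<gamma>\<in>\<Gamma>. y \<in> solutions N 1 \<gamma>"
    using saturatedD[OF sat _ A(2) small \<Gamma> fin] by auto
  show thesis
  proof (rule that[OF y(1)])
    have "y \<in> solutions N 1 (\<psi>, w k)" using y(2) by (simp add: \<Gamma>_def)
    then show "y \<noteq> k" by (simp only: sol_\<psi>) simp
    show "circ 1 k y x" if "x \<in> A" "x \<in> dom_of N 1" "x \<noteq> k" for x
    proof -
      have "y \<in> solutions N 1 (\<phi>, w x)" using y(2) that by (simp add: \<Gamma>_def)
      then show ?thesis by (simp only: sol_\<phi>) simp
    qed
  qed
qed

end


section \<open>Normal subgroups of the automorphism group\<close>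

lemma carrier_Aut: "carrier (Aut L N) = automorphisms L N"
  by (simp add: Aut_def)

lemma mult_Aut:
  assumes "\<sigma> \<in> automorphisms L N" "\<tau> \<in> automorphisms L N" "x \<in> universe L N"
  shows "(\<sigma> \<otimes>\<^bsub>Aut L N\<^esub> \<tau>) x = \<sigma> (\<tau> x)"
  using assms by (simp add: Aut_def BijGroup_def automorphisms_Bij compose_eq)

lemma one_Aut: "x \<in> universe L N \<Longrightarrow> \<one>\<^bsub>Aut L N\<^esub> x = x"
  by (simp add: Aut_def BijGroup_def)

lemma (in group) conj_in_normal_generated:
  assumes "x \<in> X" "g \<in> carrier G"
  shows "g \<otimes> x \<otimes> inv g \<in> normal_generated G X"
  unfolding normal_generated_def
proof (rule InterI)
  fix H assume H: "H \<in> {H. H \<lhd> G \<and> X \<subseteq> H}"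
  then have "x \<in> H" using assms(1) by blast
  then show "g \<otimes> x \<otimes> inv g \<in> H" using H assms(2) by (intro normal.inv_op_closed2) simp_all
qed

lemma (in group) one_in_normal_generated: "\<one> \<in> normal_generated G X"
  unfolding normal_generated_def
proof (rule InterI)
  fix H assume "H \<in> {H. H \<lhd> G \<and> X \<subseteq> H}"
  then have "subgroup H G" by (simp add: normal_imp_subgroup)
  then show "\<one> \<in> H" by (rule subgroup.one_closed)
qed

text \<open>If \<open>\<tau>\<close> sends \<open>c\<close> to \<open>d\<close>, its conjugate by
  \<open>\<sigma>\<close> sends the image of \<open>c\<close> to the image of \<open>d\<close>, and
  normality keeps the conjugate in the group.\<close>

lemma same_Lascar_type_conj:
  assumes L: "wf_sig L" and N: "is_struct L N" and \<sigma>: "\<sigma> \<in> automorphisms L N"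
    and \<tau>: "\<tau> \<in> fixing_small_submodel L N"
    and c: "c ` I \<subseteq> universe L N" "\<And>i. i \<in> I \<Longrightarrow> \<tau> (c i) = d i"
  shows "same_Lascar_type L N I (\<sigma> \<circ> c) (\<sigma> \<circ> d)"
proof -
  interpret group "Aut L N" by (rule group_Aut[OF L N])
  let ?\<rho> = "\<sigma> \<otimes>\<^bsub>Aut L N\<^esub> \<tau> \<otimes>\<^bsub>Aut L N\<^esub> inv\<^bsub>Aut L N\<^esub> \<sigma>"
  have carr: "\<sigma> \<in> carrier (Aut L N)" "\<tau> \<in> carrier (Aut L N)"
    using \<sigma> \<tau> by (simp_all add: carrier_Aut fixing_small_submodel_def)
  then have \<rho>: "?\<rho> \<in> carrier (Aut L N)" "?\<rho> \<otimes>\<^bsub>Aut L N\<^esub> \<sigma> = \<sigma> \<otimes>\<^bsub>Aut L N\<^esub> \<tau>"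
    by (simp_all add: m_assoc)
  have "?\<rho> (\<sigma> (c i)) = \<sigma> (d i)" if i: "i \<in> I" for i
  proof -
    have U: "c i \<in> universe L N" using c(1) i by blast
    have "?\<rho> (\<sigma> (c i)) = (?\<rho> \<otimes>\<^bsub>Aut L N\<^esub> \<sigma>) (c i)"
      using mult_Aut[of ?\<rho> L N \<sigma>, OF _ \<sigma> U] \<rho>(1) by (simp only: carrier_Aut)
    also have "\<dots> = \<sigma> (\<tau> (c i))"
      using mult_Aut[of \<sigma> L N \<tau>, OF \<sigma> _ U] carr(2) by (simp only: \<rho>(2) carrier_Aut)
    finally show ?thesis by (simp only: c(2)[OF i])
  qed
  moreover have "?\<rho> \<in> normal_generated (Aut L N) (fixing_small_submodel L N)"
    using \<tau> carr(1) by (rule conj_in_normal_generated)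
  ultimately show ?thesis unfolding same_Lascar_type_def by (intro bexI[of _ ?\<rho>]) auto
qed

lemma same_Lascar_type_refl:
  assumes "wf_sig L" "is_struct L N" "c ` I \<subseteq> universe L N"
  shows "same_Lascar_type L N I c c"
proof -
  interpret group "Aut L N" by (rule group_Aut[OF assms(1,2)])
  show ?thesis
    unfolding same_Lascar_type_def
  proof (intro bexI ballI)
    fix i assume "i \<in> I"
    then have "c i \<in> universe L N" using assms(3) by blast
    then show "\<one>\<^bsub>Aut L N\<^esub> (c i) = c i" by (rule one_Aut)
  qed (rule one_in_normal_generated)
qed

lemma realizes_automorphism:
  assumes L: "wf_sig L" and N: "is_struct L N" and \<sigma>: "\<sigma> \<in> automorphisms L N"
    and c: "c ` I \<subseteq> universe L N"
  shows "realizes L N I (\<sigma> \<circ> c) (tp L N I c)"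
proof -
  have U: "\<sigma> x \<in> universe L N" if "x \<in> universe L N" for x
    using that automorphisms_in_dom[OF \<sigma>] by (auto simp: universe_def)
  then have "(\<sigma> \<circ> c) ` I \<subseteq> universe L N" using c by auto
  moreover have "p \<in> tp L N I (\<sigma> \<circ> c)" if p: "p \<in> tp L N I c" for p
  proof -
    obtain \<phi> v where p: "p = (\<phi>, v)" "wf_form L \<phi>" "v ` fv \<phi> \<subseteq> I"
      "assigns N (c \<circ> v) (universe L N) (fv \<phi>)" "sat N (c \<circ> v) \<phi>"
      using p by (auto simp: tp_def)
    have "(\<sigma> \<circ> (c \<circ> v)) x \<in> universe L N \<inter> dom_of N (fst x)" if "x \<in> fv \<phi>" for x
      using p(4) that automorphisms_in_dom[OF \<sigma> wf_form_fv[OF p(2) that]] U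
      by (simp add: assigns_def)
    then have "assigns N (\<sigma> \<circ> (c \<circ> v)) (universe L N) (fv \<phi>)"
      unfolding assigns_def by blast
    moreover have "sat N (\<sigma> \<circ> (c \<circ> v)) \<phi>"
      using sat_automorphism[OF L N \<sigma> p(2), of "c \<circ> v"] p(4,5) by (simp add: assigns_def)
    ultimately show ?thesis using p(1-3) by (simp add: tp_def comp_assoc)
  qed
  ultimately show ?thesis by (auto simp: realizes_def)
qed


section \<open>The type of an element of the sort 1\<close>

context circ_model
begin

lemma dom_in_universe: "x \<in> dom_of N i \<Longrightarrow> 1 \<le> i \<Longrightarrow> x \<in> universe circ_sig N"
  by (auto simp: universe_def)

lemma dom_unique: "x \<in> dom_of N i \<Longrightarrow> x \<in> dom_of N j \<Longrightarrow> 1 \<le> i \<Longrightarrow> 1 \<le> j \<Longrightarrow> i = j"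
  using is_struct_dom_unique[OF struct, of i j x] by simp

lemma ex_automorphism:
  assumes "saturated circ_sig N" "uncountable (universe circ_sig N)" "countable R"
    and "partial_elementary circ_sig N R"
  obtains \<sigma> where "\<sigma> \<in> automorphisms circ_sig N" "\<And>x y. (x, y) \<in> R \<Longrightarrow> \<sigma> x = y"
proof (rule saturated_homogeneous[OF wf_sig_circ_sig struct assms(1) _ assms(4)])
  show "infinite (universe circ_sig N)" using assms(2) by (rule uncountable_infinite)
  show "R \<prec> universe circ_sig N" by (rule countable_lesspoll_uncountable[OF assms(3,2)])
qed (rule that)

text \<open>Over the empty set any point of the sort 1 can be moved to any other. Once
  \<open>c'\<close> is in place, the points \<open>e\<close> and \<open>d\<close> are joined by two
  arcs, and at least one of them avoids \<open>c\<close>.\<close>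

lemma ex_automorphism_pair:
  assumes sat: "saturated circ_sig N" "uncountable (universe circ_sig N)"
    and dom: "c' \<in> dom_of N 1" "d' \<in> dom_of N 1" "c \<in> dom_of N 1" "d \<in> dom_of N 1"
    and neq: "c' \<noteq> d'" "c \<noteq> d"
  obtains \<sigma> where "\<sigma> \<in> automorphisms circ_sig N" "\<sigma> c' = c" "\<sigma> d' = d"
proof -
  have "partial_elementary circ_sig N (insert (c', c) (Id_on {}))"
    by (rule partial_elementary_move) (use dom in auto)
  then obtain \<sigma> where \<sigma>: "\<sigma> \<in> automorphisms circ_sig N" "\<sigma> c' = c"
    using ex_automorphism[OF sat, of "insert (c', c) (Id_on {})"] by auto
  define e where "e = \<sigma> d'"
  have e: "e \<in> dom_of N 1" unfolding e_def using automorphisms_in_dom[OF \<sigma>(1)] dom(2) by simp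
  have "inj_on \<sigma> (universe circ_sig N)"
    using automorphisms_Bij[OF \<sigma>(1)] by (simp add: Bij_def bij_betw_def)
  then have "\<sigma> d' = \<sigma> c' \<longleftrightarrow> d' = c'"
    by (rule inj_on_eq_iff) (rule dom_in_universe[OF dom(2) order_refl] dom_in_universe[OF dom(1) order_refl])+
  then have ec: "e \<noteq> c" using neq(1) \<sigma>(2) by (simp add: e_def)
  have c_only: "i = 1 \<and> proj i x = c" if "1 \<le> i" "x \<in> {c}" "x \<in> dom_of N i" for i x
  proof -
    have "i = 1" using dom_unique[of c i 1] that dom(3) by simp
    then show ?thesis using that proj_1[OF dom(3)] by simp
  qed
  have U: "{c} \<subseteq> universe circ_sig N" using dom(3) dom_in_universe by blast
  have move: "partial_elementary circ_sig N (insert (u, w) (Id_on {c}))"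
    if "u \<in> dom_of N 1" "w \<in> dom_of N 1" "c \<noteq> u" "c \<noteq> w" "\<not> circ 1 u c w" for u w
  proof (rule partial_elementary_move[OF U that(1,2)])
    fix i x assume "1 \<le> i" "x \<in> {c}" "x \<in> dom_of N i"
    then have "proj i x = c" using c_only by blast
    then show "proj i x \<noteq> u \<and> proj i x \<noteq> w \<and> \<not> circ 1 u (proj i x) w"
      using that(3-5) by simp
  qed
  have "partial_elementary circ_sig N (insert (e, d) (Id_on {c}))"
  proof (cases "circ 1 e c d")
    case False
    show ?thesis by (rule move[OF e dom(4) ec[symmetric] neq(2) False])
  next
    \<comment> \<open>The arc from \<open>e\<close> to \<open>d\<close> contains \<open>c\<close>,
      so the map is built along the other arc and inverted.\<close>
    case True
    then have "\<not> circ 1 d c e" using circ_order(2)[OF e dom(3,4)] by blast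
    then have "partial_elementary circ_sig N (insert (d, e) (Id_on {c}))"
      by (rule move[OF dom(4) e neq(2) ec[symmetric]])
    from partial_elementary_converse[OF this struct]
    have "partial_elementary circ_sig N ((insert (d, e) (Id_on {c}))\<inverse>)" .
    moreover have "(insert (d, e) (Id_on {c}))\<inverse> = insert (e, d) (Id_on {c})" by auto
    ultimately show ?thesis by simp
  qed
  moreover have "countable (insert (e, d) (Id_on {c}))" by (simp add: countable_Id_on)
  ultimately obtain \<tau> where \<tau>': "\<tau> \<in> automorphisms circ_sig N"
    "\<And>x y. (x, y) \<in> insert (e, d) (Id_on {c}) \<Longrightarrow> \<tau> x = y"
    using ex_automorphism[OF sat] by blast
  then have \<tau>: "\<tau> \<in> automorphisms circ_sig N" "\<tau> c = c" "\<tau> e = d" by auto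
  interpret group "Aut circ_sig N" by (rule group_Aut[OF wf_sig_circ_sig struct])
  let ?\<rho> = "\<tau> \<otimes>\<^bsub>Aut circ_sig N\<^esub> \<sigma>"
  have "?\<rho> \<in> automorphisms circ_sig N"
    using \<sigma>(1) \<tau>(1) m_closed by (simp flip: carrier_Aut)
  moreover have "?\<rho> c' = c" "?\<rho> d' = d"
    using mult_Aut[OF \<tau>(1) \<sigma>(1) dom_in_universe[OF dom(1)]]
      mult_Aut[OF \<tau>(1) \<sigma>(1) dom_in_universe[OF dom(2)]] \<sigma>(2) \<tau>(2,3)
    by (simp_all add: e_def)
  ultimately show thesis by (rule that)
qed

text \<open>Two points infinitesimally close to \<open>k\<close> realize the same cut over
  \<open>K\<close>: no point of \<open>K\<close> lies on the arc between them, and projections of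
  \<open>K\<close> stay in \<open>K\<close>. So an automorphism fixing \<open>K\<close> sends one to
  the other.\<close>

lemma ex_fixing_small_submodel_move:
  assumes sat: "saturated circ_sig N" "uncountable (universe circ_sig N)"
  obtains \<tau> c' where "\<tau> \<in> fixing_small_submodel circ_sig N" "c' \<in> dom_of N 1" "\<tau> c' \<in> dom_of N 1"
    "\<tau> c' \<noteq> c'"
proof -
  obtain K where K: "countable K" "elementary_submodel circ_sig K N"
    by (rule countable_elementary_submodel[OF wf_sig_circ_sig struct])
  have KU: "K \<subseteq> universe circ_sig N" and Ks: "is_struct circ_sig (restrict_struct N K)"
    using K(2) by (simp_all add: elementary_submodel_def)
  have "dom_of (restrict_struct N K) 1 \<noteq> {}" using Ks by (simp add: is_struct_def)
  then obtain k where k: "k \<in> K" "k \<in> dom_of N 1" by (auto simp: restrict_struct_def)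
  have proj_K: "proj i x \<in> K" if "1 \<le> i" "x \<in> K" "x \<in> dom_of N i" for i x
    using is_struct_fun[OF Ks, of "Proj i" "[x]"] that by (simp add: restrict_struct_def proj_def)
  obtain c where c: "c \<in> dom_of N 1" "c \<noteq> k" "\<And>x. x \<in> K \<Longrightarrow> x \<in> dom_of N 1 \<Longrightarrow> x \<noteq> k \<Longrightarrow> circ 1 k c x"
    using ex_circ_countable[OF sat K(1) KU k] by blast
  have "countable (insert c K)" "insert c K \<subseteq> universe circ_sig N" "k \<in> insert c K"
    using K(1) KU k(1) c(1) dom_in_universe by auto
  \<comment> \<open>The point \<open>d\<close> is taken even closer to \<open>k\<close> than
    \<open>c\<close>, so that the two are distinct and their order is known.\<close>
  then obtain d where d: "d \<in> dom_of N 1" "d \<noteq> k"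
    "\<And>x. x \<in> insert c K \<Longrightarrow> x \<in> dom_of N 1 \<Longrightarrow> x \<noteq> k \<Longrightarrow> circ 1 k d x"
    using ex_circ_countable[OF sat _ _ _ k(2)] by blast
  have kdc: "circ 1 k d c" using d(3) c by blast
  note o = circ_order[OF k(2) d(1) c(1) kdc]
  have "partial_elementary circ_sig N (insert (d, c) (Id_on K))"
  proof (rule partial_elementary_move[OF KU d(1) c(1)])
    fix i x assume x: "1 \<le> i" "x \<in> K" "x \<in> dom_of N i"
    define p where "p = proj i x"
    have p: "p \<in> K" "p \<in> dom_of N 1" unfolding p_def using proj_K proj_in_dom x by auto
    show "proj i x \<noteq> d \<and> proj i x \<noteq> c \<and> \<not> circ 1 d (proj i x) c"
      unfolding p_def[symmetric]
    proof (cases "p = k")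
      case True
      then show "p \<noteq> d \<and> p \<noteq> c \<and> \<not> circ 1 d p c" using o(1) c(2) d(2) by blast
    next
      case False
      have kcp: "circ 1 k c p" "circ 1 k d p" using c(3) d(3) p False by blast+
      have "c \<noteq> p" "d \<noteq> p" using circ_order(4)[OF k(2) _ p(2)] c(1) d(1) kcp by blast+
      moreover have "\<not> circ 1 d p c" by (rule circ_order2[OF k(2) d(1) c(1) p(2) kdc kcp(1)])
      ultimately show "p \<noteq> d \<and> p \<noteq> c \<and> \<not> circ 1 d p c" by blast
    qed
  qed
  moreover have "countable (insert (d, c) (Id_on K))" using K(1) by (simp add: countable_Id_on)
  ultimately obtain \<tau> where \<tau>: "\<tau> \<in> automorphisms circ_sig N"
    "\<And>x y. (x, y) \<in> insert (d, c) (Id_on K) \<Longrightarrow> \<tau> x = y"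
    using ex_automorphism[OF sat] by blast
  have "\<tau> d = c" by (rule \<tau>(2)) simp
  have "\<tau> \<in> fixing_small_submodel circ_sig N"
    unfolding fixing_small_submodel_def
  proof (intro CollectI conjI exI ballI)
    show "\<tau> x = x" if "x \<in> K" for x using that by (intro \<tau>(2)) auto
  qed (use \<tau>(1) K(2) countable_lesspoll_uncountable[OF K(1) sat(2)] in simp_all)
  then show thesis
    using d(1) by (rule that) (simp_all add: \<open>\<tau> d = c\<close> c(1)[unfolded One_nat_def] o(4)[symmetric])
qed

lemma Lascar_strong_type_sort_1:
  assumes sat: "saturated circ_sig N" "uncountable (universe circ_sig N)" and a: "a \<in> dom_of N 1"
  shows "Lascar_strong_type circ_sig N {()} (tp circ_sig N {()} (\<lambda>_. a))"
  unfolding Lascar_strong_type_def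
proof (intro allI impI, elim conjE)
  fix c d :: "unit \<Rightarrow> 'a"
  assume *: "realizes circ_sig N {()} c (tp circ_sig N {()} (\<lambda>_. a))"
    "realizes circ_sig N {()} d (tp circ_sig N {()} (\<lambda>_. a))"
  have in_dom: "f () \<in> dom_of N 1" if "realizes circ_sig N {()} f (tp circ_sig N {()} (\<lambda>_. a))" for f
  proof -
    \<comment> \<open>The formula \<open>x = x\<close> records nothing but the sort of its variable,
      and only the sort of the realizations enters the argument.\<close>
    have "(Eq (V 1 0) (V 1 0), \<lambda>_. ()) \<in> tp circ_sig N {()} (\<lambda>_. a)"
      using a dom_in_universe by (simp add: tp_def assigns_def comp_def)
    then have "(Eq (V 1 0) (V 1 0), \<lambda>_. ()) \<in> tp circ_sig N {()} f"
      using that by (auto simp: realizes_def)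
    then show ?thesis by (simp add: tp_def assigns_def comp_def)
  qed
  have cd: "c () \<in> dom_of N 1" "d () \<in> dom_of N 1" using in_dom * by blast+
  show "same_Lascar_type circ_sig N {()} c d"
  proof (cases "c () = d ()")
    case True
    have "c ` {()} \<subseteq> universe circ_sig N" using cd(1) dom_in_universe by auto
    then have "same_Lascar_type circ_sig N {()} c c"
      by (rule same_Lascar_type_refl[OF wf_sig_circ_sig struct])
    moreover have "d = c" using True by (simp add: fun_eq_iff)
    ultimately show ?thesis by simp
  next
    case False
    obtain \<tau> c' where \<tau>: "\<tau> \<in> fixing_small_submodel circ_sig N" "c' \<in> dom_of N 1" "\<tau> c' \<in> dom_of N 1"
      "\<tau> c' \<noteq> c'" using ex_fixing_small_submodel_move[OF sat] .
    obtain \<sigma> where \<sigma>: "\<sigma> \<in> automorphisms circ_sig N" "\<sigma> c' = c ()" "\<sigma> (\<tau> c') = d ()"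
      using ex_automorphism_pair[OF sat \<tau>(2,3) cd \<tau>(4)[symmetric] False] .
    have "same_Lascar_type circ_sig N {()} (\<sigma> \<circ> (\<lambda>_. c')) (\<sigma> \<circ> (\<lambda>_. \<tau> c'))"
      by (rule same_Lascar_type_conj[OF wf_sig_circ_sig struct \<sigma>(1) \<tau>(1)])
        (use \<tau>(2) dom_in_universe in auto)
    moreover have "\<sigma> \<circ> (\<lambda>_. c') = c" "\<sigma> \<circ> (\<lambda>_. \<tau> c') = d" using \<sigma> by (auto simp: fun_eq_iff)
    ultimately show ?thesis by simp
  qed
qed

end


section \<open>The type of the algebraic closure\<close>

context circ_model
begin

lemma automorphism_rot:
  "\<sigma> \<in> automorphisms circ_sig N \<Longrightarrow> 1 \<le> i \<Longrightarrow> x \<in> dom_of N i \<Longrightarrow> \<sigma> (rot i x) = rot i (\<sigma> x)"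
  using automorphisms_fun[of \<sigma> circ_sig N "Rot i" "[x]"] by (simp add: rot_def)

lemma automorphism_circ:
  "\<sigma> \<in> automorphisms circ_sig N \<Longrightarrow> 1 \<le> i \<Longrightarrow>
    x \<in> dom_of N i \<Longrightarrow> y \<in> dom_of N i \<Longrightarrow> z \<in> dom_of N i \<Longrightarrow>
    circ i (\<sigma> x) (\<sigma> y) (\<sigma> z) \<longleftrightarrow> circ i x y z"
  using automorphisms_rel[of \<sigma> circ_sig N "Circ i" "[x, y, z]"] by (simp add: circ_def)

lemma automorphism_cell:
  assumes \<sigma>: "\<sigma> \<in> automorphisms circ_sig N" and i: "1 \<le> i" "x \<in> dom_of N i" "y \<in> dom_of N i"
    and "cell i j x y"
  shows "cell i j (\<sigma> x) (\<sigma> y)"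
proof -
  have rot: "\<sigma> ((rot i ^^ j) x) = (rot i ^^ j) (\<sigma> x)"
    using i by (induction j) (simp_all add: automorphism_rot[OF \<sigma>] funpow_rot_in_dom)
  have dom: "(rot i ^^ j) x \<in> dom_of N i" "rot i ((rot i ^^ j) x) \<in> dom_of N i"
    using i by (simp_all add: funpow_rot_in_dom rot_in_dom)
  show ?thesis
    using assms(5)
    by (auto simp: cell_def automorphism_circ[OF \<sigma> i(1) dom(1) i(3) dom(2)]
        simp flip: rot automorphism_rot[OF \<sigma> i(1) dom(1)])
qed

section \<open>Displacement counted by chains of near points\<close>

definition near_rel :: "nat \<Rightarrow> ('a \<times> 'a) set" where
  "near_rel i = {(x, y). x \<in> dom_of N i \<and> y \<in> dom_of N i \<and> near i x y}"

lemma near_relpow_sym: "(x, y) \<in> near_rel i ^^ n \<Longrightarrow> (y, x) \<in> near_rel i ^^ n"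
proof (induction n arbitrary: y)
  case (Suc n)
  then obtain z where "(x, z) \<in> near_rel i ^^ n" "(z, y) \<in> near_rel i" by auto
  then have "(z, x) \<in> near_rel i ^^ n" "(y, z) \<in> near_rel i"
    using Suc.IH by (auto simp: near_rel_def near_def)
  then show ?case by (rule relpow_Suc_I2[rotated])
qed simp

lemma near_relpow_automorphism:
  assumes \<sigma>: "\<sigma> \<in> automorphisms circ_sig N" "1 \<le> i" and xy: "(x, y) \<in> near_rel i ^^ n"
  shows "(\<sigma> x, \<sigma> y) \<in> near_rel i ^^ n"
  using xy
proof (induction n arbitrary: y)
  case (Suc n)
  then obtain z where z: "(x, z) \<in> near_rel i ^^ n" "(z, y) \<in> near_rel i" by auto
  have "\<sigma> w \<in> dom_of N i" if "w \<in> dom_of N i" for w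
    using automorphisms_in_dom[OF \<sigma>(1)] \<sigma>(2) that by simp
  then have "(\<sigma> z, \<sigma> y) \<in> near_rel i"
    using z(2) automorphism_cell[OF \<sigma>] by (simp add: near_rel_def near_def) blast
  then show ?case using Suc.IH[OF z(1)] by (rule relpow_Suc_I[rotated])
qed simp

lemma near_rot:
  assumes "1 \<le> i" "x \<in> dom_of N i" "y \<in> dom_of N i" "near i x y"
  shows "near i ((rot i ^^ n) x) ((rot i ^^ n) y)"
proof (induction n)
  case (Suc n)
  have step: "cell i 0 (rot i u) (rot i v)" if "cell i 0 u v" "u \<in> dom_of N i" "v \<in> dom_of N i" for u v
    using that circ_rot[OF assms(1) that(2,3) rot_in_dom[OF that(2) assms(1)]] by (auto simp: cell_def)
  have "(rot i ^^ n) x \<in> dom_of N i" "(rot i ^^ n) y \<in> dom_of N i"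
    using assms by (simp_all add: funpow_rot_in_dom)
  then show ?case using Suc step by (auto simp: near_def)
qed (simp add: assms)

text \<open>Induction with \<open>cell_near\<close>, one rotation per step. The \<open>n\<close>
  rotations of \<open>y\<close> compensate for steps that run backwards, and the bound
  \<open>2 * n\<close> does not depend on \<open>i\<close>.\<close>

lemma near_relpow_cell:
  assumes i: "2 \<le> i" and x: "x \<in> dom_of N i" and xy: "(x, y) \<in> near_rel i ^^ n"
  shows "y \<in> dom_of N i \<and> (\<exists>j\<le>2 * n. cell i j x ((rot i ^^ n) y))"
  using xy
proof (induction n arbitrary: y)
  case 0
  then show ?case using x by (simp add: cell_def)
next
  case (Suc n)
  have i1: "1 \<le> i" using i by simp
  obtain z where z: "(x, z) \<in> near_rel i ^^ n" "(z, y) \<in> near_rel i" using Suc.prems by auto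
  obtain j where j: "j \<le> 2 * n" "cell i j x ((rot i ^^ n) z)" using Suc.IH[OF z(1)] by blast
  have zy: "z \<in> dom_of N i" "y \<in> dom_of N i" "near i z y" using z(2) by (simp_all add: near_rel_def)
  have "(rot i ^^ n) w \<in> dom_of N i" if "w \<in> dom_of N i" for w
    using that i1 by (rule funpow_rot_in_dom)
  moreover have "near i ((rot i ^^ n) z) ((rot i ^^ n) y)"
    using near_rot zy i1 by blast
  ultimately obtain m where m: "m \<in> {j, Suc j, Suc (Suc j)}" "cell i m x (rot i ((rot i ^^ n) y))"
    using cell_near[OF i x _ _ j(2)] zy(1,2) by blast
  show ?case
  proof (intro conjI exI)
    show "m \<le> 2 * Suc n" using m(1) j(1) by auto
    show "cell i m x ((rot i ^^ Suc n) y)" using m(2) by simp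
  qed (rule zy(2))
qed

text \<open>A fixed point \<open>k\<close> of the sort \<open>i\<close> serves as an origin:
  \<open>x\<close> lies in one of the cells counted from \<open>k\<close>, and its image lies in the
  same cell because \<open>\<sigma>\<close> fixes \<open>k\<close>.\<close>

lemma fixing_small_submodel_near:
  assumes \<sigma>: "\<sigma> \<in> fixing_small_submodel circ_sig N" and i: "2 \<le> i" and x: "x \<in> dom_of N i"
  shows "(x, \<sigma> x) \<in> near_rel i"
proof -
  obtain K where K: "elementary_submodel circ_sig K N" "\<forall>x\<in>K. \<sigma> x = x"
    and aut: "\<sigma> \<in> automorphisms circ_sig N"
    using \<sigma> by (auto simp: fixing_small_submodel_def)
  have i1: "1 \<le> i" using i by simp
  have "is_struct circ_sig (restrict_struct N K)" using K(1) by (simp add: elementary_submodel_def)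
  then have "dom_of (restrict_struct N K) i \<noteq> {}" using i1 by (simp add: is_struct_def)
  then obtain k where k: "k \<in> dom_of N i" "k \<in> K" by (auto simp: restrict_struct_def)
  obtain j where j: "cell i j k x" using cell_total[OF i k(1) x] .
  have \<sigma>x: "\<sigma> x \<in> dom_of N i" using automorphisms_in_dom[OF aut _ x] i1 by simp
  have "cell i j (\<sigma> k) (\<sigma> x)" by (rule automorphism_cell[OF aut i1 k(1) x j])
  then have "cell i j k (\<sigma> x)" using K(2) k(2) by simp
  with j have "near i x (\<sigma> x)" by (rule near_of_cell[OF i k(1) x \<sigma>x])
  then show ?thesis using x \<sigma>x by (simp add: near_rel_def)
qed

text \<open>The number \<open>n\<close> is chosen before the sort \<open>i\<close>; this order of
  quantifiers is what excludes \<open>half_turn\<close>.\<close>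

definition bounded_auts :: "('a \<Rightarrow> 'a) set" where
  "bounded_auts = {\<sigma> \<in> automorphisms circ_sig N.
     \<exists>n. \<forall>i\<ge>2. \<forall>x\<in>dom_of N i. (x, \<sigma> x) \<in> near_rel i ^^ n}"

lemma bounded_autsI:
  assumes "\<sigma> \<in> automorphisms circ_sig N"
    "\<And>i x. 2 \<le> i \<Longrightarrow> x \<in> dom_of N i \<Longrightarrow> (x, \<sigma> x) \<in> near_rel i ^^ n"
  shows "\<sigma> \<in> bounded_auts"
  using assms unfolding bounded_auts_def by blast

lemma bounded_autsE:
  assumes "\<sigma> \<in> bounded_auts"
  obtains n where "\<sigma> \<in> automorphisms circ_sig N"
    "\<And>i x. 2 \<le> i \<Longrightarrow> x \<in> dom_of N i \<Longrightarrow> (x, \<sigma> x) \<in> near_rel i ^^ n"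
  using assms unfolding bounded_auts_def by blast

text \<open>Inverses keep the bound because nearness is symmetric, products add bounds, and
  conjugates keep the bound because automorphisms preserve \<open>near_rel\<close>.\<close>

lemma bounded_auts_normal: "bounded_auts \<lhd> Aut circ_sig N"
proof -
  let ?G = "Aut circ_sig N"
  interpret group ?G by (rule group_Aut[OF wf_sig_circ_sig struct])
  have carr: "\<sigma> \<in> carrier ?G \<longleftrightarrow> \<sigma> \<in> automorphisms circ_sig N" for \<sigma>
    by (simp add: carrier_Aut)
  have U: "x \<in> universe circ_sig N" if "2 \<le> i" "x \<in> dom_of N i" for i x
    using dom_in_universe[OF that(2)] that(1) by simp
  have in_dom: "\<sigma> x \<in> dom_of N i" if "\<sigma> \<in> carrier ?G" "2 \<le> i" "x \<in> dom_of N i" for \<sigma> i x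
    using automorphisms_in_dom[of \<sigma> circ_sig N i x] that by (simp add: carr)
  have mult: "(\<sigma> \<otimes>\<^bsub>?G\<^esub> \<tau>) x = \<sigma> (\<tau> x)"
    if "\<sigma> \<in> carrier ?G" "\<tau> \<in> carrier ?G" "2 \<le> i" "x \<in> dom_of N i" for \<sigma> \<tau> i x
    using mult_Aut[of \<sigma> circ_sig N \<tau> x] U that by (simp add: carr)
  have inv_r: "\<sigma> ((inv\<^bsub>?G\<^esub> \<sigma>) x) = x" if "\<sigma> \<in> carrier ?G" "2 \<le> i" "x \<in> dom_of N i" for \<sigma> i x
  proof -
    have "\<sigma> ((inv\<^bsub>?G\<^esub> \<sigma>) x) = (\<sigma> \<otimes>\<^bsub>?G\<^esub> inv\<^bsub>?G\<^esub> \<sigma>) x"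
      by (rule mult[symmetric, OF that(1) inv_closed[OF that(1)] that(2,3)])
    then show ?thesis by (simp only: r_inv[OF that(1)] one_Aut[OF U[OF that(2,3)]])
  qed
  have "subgroup bounded_auts ?G"
  proof (rule subgroupI)
    show "bounded_auts \<subseteq> carrier ?G" by (auto simp: bounded_auts_def carr)
    have "\<one>\<^bsub>?G\<^esub> \<in> bounded_auts"
    proof (rule bounded_autsI[where n = 0])
      show "\<one>\<^bsub>?G\<^esub> \<in> automorphisms circ_sig N" using one_closed by (simp only: carr)
      show "(x, \<one>\<^bsub>?G\<^esub> x) \<in> near_rel i ^^ 0" if "2 \<le> i" "x \<in> dom_of N i" for i x
        using one_Aut[OF U[OF that]] by simp
    qed
    then show "bounded_auts \<noteq> {}" by blast
  next
    fix \<sigma> assume "\<sigma> \<in> bounded_auts"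
    then obtain n where \<sigma>: "\<sigma> \<in> automorphisms circ_sig N"
      "\<And>i x. 2 \<le> i \<Longrightarrow> x \<in> dom_of N i \<Longrightarrow> (x, \<sigma> x) \<in> near_rel i ^^ n" by (rule bounded_autsE) blast
    have \<sigma>G: "\<sigma> \<in> carrier ?G" using \<sigma>(1) by (simp only: carr)
    show "inv\<^bsub>?G\<^esub> \<sigma> \<in> bounded_auts"
    proof (rule bounded_autsI)
      show "inv\<^bsub>?G\<^esub> \<sigma> \<in> automorphisms circ_sig N" using inv_closed[OF \<sigma>G] by (simp only: carr)
      fix i x assume i: "2 \<le> i" "x \<in> dom_of N i"
      have "((inv\<^bsub>?G\<^esub> \<sigma>) x, \<sigma> ((inv\<^bsub>?G\<^esub> \<sigma>) x)) \<in> near_rel i ^^ n"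
        by (rule \<sigma>(2)[OF i(1) in_dom[OF inv_closed[OF \<sigma>G] i]])
      then show "(x, (inv\<^bsub>?G\<^esub> \<sigma>) x) \<in> near_rel i ^^ n"
        unfolding inv_r[OF \<sigma>G i] by (rule near_relpow_sym)
    qed
  next
    fix \<sigma> \<tau> assume "\<sigma> \<in> bounded_auts" "\<tau> \<in> bounded_auts"
    then obtain m n where \<sigma>: "\<sigma> \<in> automorphisms circ_sig N"
      "\<And>i x. 2 \<le> i \<Longrightarrow> x \<in> dom_of N i \<Longrightarrow> (x, \<sigma> x) \<in> near_rel i ^^ m"
      and \<tau>: "\<tau> \<in> automorphisms circ_sig N"
      "\<And>i x. 2 \<le> i \<Longrightarrow> x \<in> dom_of N i \<Longrightarrow> (x, \<tau> x) \<in> near_rel i ^^ n"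
      by (elim bounded_autsE) blast
    have G: "\<sigma> \<in> carrier ?G" "\<tau> \<in> carrier ?G" using \<sigma>(1) \<tau>(1) by (simp_all only: carr)
    show "\<sigma> \<otimes>\<^bsub>?G\<^esub> \<tau> \<in> bounded_auts"
    proof (rule bounded_autsI)
      show "\<sigma> \<otimes>\<^bsub>?G\<^esub> \<tau> \<in> automorphisms circ_sig N" using m_closed[OF G] by (simp only: carr)
      fix i x assume i: "2 \<le> i" "x \<in> dom_of N i"
      show "(x, (\<sigma> \<otimes>\<^bsub>?G\<^esub> \<tau>) x) \<in> near_rel i ^^ (n + m)"
        unfolding mult[OF G i] using \<tau>(2)[OF i] \<sigma>(2)[OF i(1) in_dom[OF G(2) i]] by (rule relpow_trans)
    qed
  qed
  then show ?thesis
  proof (rule normal_invI)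
    fix \<rho> \<sigma> assume \<rho>: "\<rho> \<in> carrier ?G" and "\<sigma> \<in> bounded_auts"
    then obtain n where \<sigma>: "\<sigma> \<in> automorphisms circ_sig N"
      "\<And>i x. 2 \<le> i \<Longrightarrow> x \<in> dom_of N i \<Longrightarrow> (x, \<sigma> x) \<in> near_rel i ^^ n" by (elim bounded_autsE) blast
    have G: "\<sigma> \<in> carrier ?G" "\<rho> \<otimes>\<^bsub>?G\<^esub> \<sigma> \<in> carrier ?G" "inv\<^bsub>?G\<^esub> \<rho> \<in> carrier ?G"
      using \<sigma>(1) \<rho> by (simp_all only: carr[symmetric] m_closed inv_closed)
    show "\<rho> \<otimes>\<^bsub>?G\<^esub> \<sigma> \<otimes>\<^bsub>?G\<^esub> inv\<^bsub>?G\<^esub> \<rho> \<in> bounded_auts"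
    proof (rule bounded_autsI)
      show "\<rho> \<otimes>\<^bsub>?G\<^esub> \<sigma> \<otimes>\<^bsub>?G\<^esub> inv\<^bsub>?G\<^esub> \<rho> \<in> automorphisms circ_sig N"
        using m_closed[OF G(2,3)] by (simp only: carr)
      fix i x assume i: "2 \<le> i" "x \<in> dom_of N i"
      let ?y = "(inv\<^bsub>?G\<^esub> \<rho>) x"
      have y: "?y \<in> dom_of N i" by (rule in_dom[OF G(3) i])
      have i1: "1 \<le> i" using i(1) by simp
      have "(\<rho> ?y, \<rho> (\<sigma> ?y)) \<in> near_rel i ^^ n"
        by (rule near_relpow_automorphism[OF \<rho>[unfolded carr] i1 \<sigma>(2)[OF i(1) y]])
      then show "(x, (\<rho> \<otimes>\<^bsub>?G\<^esub> \<sigma> \<otimes>\<^bsub>?G\<^esub> inv\<^bsub>?G\<^esub> \<rho>) x) \<in> near_rel i ^^ n"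
        unfolding mult[OF G(2,3) i] mult[OF \<rho> G(1) i(1) y] inv_r[OF \<rho> i] .
    qed
  qed
qed

section \<open>Rotation of every sort by half of its steps\<close>

definition half_turn :: "'a \<Rightarrow> 'a" where
  "half_turn = (\<lambda>x\<in>universe circ_sig N.
     let i = THE i. 1 \<le> i \<and> x \<in> dom_of N i in (rot i ^^ (i div 2)) x)"

lemma half_turn_eq:
  assumes "1 \<le> i" "x \<in> dom_of N i"
  shows "half_turn x = (rot i ^^ (i div 2)) x"
proof -
  have "(THE i. 1 \<le> i \<and> x \<in> dom_of N i) = i"
    using assms dom_unique by (intro the_equality) auto
  then show ?thesis using dom_in_universe[OF assms(2,1)] by (simp add: half_turn_def)
qed

text \<open>The rotation of the sort \<open>i\<close> has period \<open>i\<close>, so its power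
  \<open>i - 1\<close> is an inverse.\<close>

lemma bij_betw_rot:
  assumes "1 \<le> i"
  shows "bij_betw (rot i) (dom_of N i) (dom_of N i)"
proof -
  define r where "r = rot i"
  obtain n where n: "i = Suc n" using assms by (cases i) auto
  have period: "(r ^^ Suc n) x = x" if "x \<in> dom_of N i" for x
    using funpow_rot_sort[OF assms that that that] unfolding r_def n .
  have "bij_betw r (dom_of N i) (dom_of N i)"
  proof (rule bij_betw_byWitness[where f' = "r ^^ n"])
    show "\<forall>x\<in>dom_of N i. (r ^^ n) (r x) = x" "\<forall>x\<in>dom_of N i. r ((r ^^ n) x) = x"
      using period by (simp_all add: funpow_swap1)
    show "r ` dom_of N i \<subseteq> dom_of N i" "(r ^^ n) ` dom_of N i \<subseteq> dom_of N i"
      using rot_in_dom funpow_rot_in_dom assms by (auto simp: r_def)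
  qed
  then show ?thesis by (simp add: r_def)
qed

text \<open>Powers of the rotation commute with it and preserve \<open>circ\<close> and the fibres
  of \<open>proj\<close>. Compatibility with the projections also requires the identity on the sort
  1, which holds because \<open>1 div 2 = 0\<close>.\<close>

lemma half_turn_automorphism: "half_turn \<in> automorphisms circ_sig N"
proof -
  let ?U = "universe circ_sig N"
  have bij: "bij_betw (rot i ^^ m) (dom_of N i) (dom_of N i)" if "1 \<le> i" for i m
    using bij_betw_rot[OF that] by (rule bij_betw_funpow)
  have img: "half_turn ` dom_of N i = dom_of N i" if "1 \<le> i" for i
  proof -
    have "half_turn ` dom_of N i = (rot i ^^ (i div 2)) ` dom_of N i"
      using half_turn_eq[OF that] by (intro image_cong) auto
    then show ?thesis using bij[OF that] by (simp add: bij_betw_def)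
  qed
  have "inj_on half_turn ?U"
  proof (rule inj_onI)
    fix x y assume "x \<in> ?U" "y \<in> ?U" and eq: "half_turn x = half_turn y"
    then obtain i j where i: "1 \<le> i" "x \<in> dom_of N i" and j: "1 \<le> j" "y \<in> dom_of N j"
      by (auto simp: universe_def)
    have "half_turn x \<in> dom_of N i" "half_turn x \<in> dom_of N j"
      using imageI[OF i(2), of half_turn] imageI[OF j(2), of half_turn]
      by (simp_all add: img[OF i(1)] img[OF j(1)] eq)
    then have "i = j" using i(1) j(1) by (rule dom_unique)
    then have "(rot i ^^ (i div 2)) x = (rot i ^^ (i div 2)) y"
      using eq half_turn_eq[OF i] half_turn_eq[OF j] by simp
    then show "x = y"
      using bij_betw_imp_inj_on[OF bij[OF i(1)]] i(2) j(2) \<open>i = j\<close> by (blast dest: inj_onD)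
  qed
  moreover have "half_turn ` ?U = ?U" using img by (simp add: universe_def image_UN)
  moreover have "half_turn \<in> extensional ?U" by (simp add: half_turn_def)
  ultimately have "half_turn \<in> Bij ?U" by (simp add: Bij_def bij_betw_def)
  moreover have "half_turn (fun_of N f xs) = fun_of N f (map half_turn xs)"
    if f: "f \<in> fun_syms circ_sig" "args_in N xs (fun_dom circ_sig f)" for f xs
  proof -
    from circ_fun_args[OF f] obtain i x where
      i: "1 \<le> i" "f = Rot i \<or> f = Proj i" and x: "xs = [x]" "x \<in> dom_of N i" .
    note rx = rot_in_dom[OF x(2) i(1)] and px = proj_in_dom[OF x(2) i(1)]
    have proj: "proj i ((rot i ^^ m) x) = proj i x" for m
    proof (induction m)
      case (Suc m)
      have "(rot i ^^ m) x \<in> dom_of N i" using x(2) i(1) by (rule funpow_rot_in_dom)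
      then show ?case using proj_rot[OF i(1), of "(rot i ^^ m) x"] Suc by simp
    qed simp
    have "half_turn (rot i x) = rot i (half_turn x)"
      by (simp add: half_turn_eq[OF i(1)] rx x(2) funpow_swap1)
    moreover have "half_turn (proj i x) = proj i (half_turn x)"
      using half_turn_eq[OF order_refl px] by (simp add: half_turn_eq[OF i(1) x(2)] proj)
    ultimately show ?thesis using i(2) by (auto simp: x(1) simp flip: rot_def proj_def)
  qed
  moreover have "rel_of N r (map half_turn xs) \<longleftrightarrow> rel_of N r xs"
    if r: "r \<in> rel_syms circ_sig" "args_in N xs (rel_dom circ_sig r)" for r xs
  proof -
    from circ_rel_args[OF r] obtain i x y z where i: "1 \<le> i" "r = Circ i" and
      x: "xs = [x, y, z]" "x \<in> dom_of N i" "y \<in> dom_of N i" "z \<in> dom_of N i" .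
    have "circ i ((rot i ^^ m) x) ((rot i ^^ m) y) ((rot i ^^ m) z) \<longleftrightarrow> circ i x y z" for m
    proof (induction m)
      case (Suc m)
      then show ?case
        using circ_rot[OF i(1) funpow_rot_in_dom[OF x(2) i(1)] funpow_rot_in_dom[OF x(3) i(1)]
            funpow_rot_in_dom[OF x(4) i(1)], of m m m] by simp
    qed simp
    then show ?thesis
      using x(2-4) by (simp add: i(2) x(1) half_turn_eq[OF i(1)] flip: circ_def)
  qed
  ultimately show ?thesis using img by (simp add: automorphisms_def)
qed

text \<open>The formula saying that \<open>y\<close> projects to \<open>a\<close> has at most
  \<open>i\<close> solutions, the rotates of one of them.\<close>

lemma proj_fibre_acl:
  assumes a: "a \<in> dom_of N 1" and x: "1 \<le> i" "x \<in> dom_of N i" "proj i x = a"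
  shows "x \<in> acl circ_sig N {a}"
proof -
  let ?\<gamma> = "(Eq (proj_t i (V i 0)) (V 1 1), \<lambda>_ :: nat \<times> nat. a)"
  have sol: "solutions N i ?\<gamma> = {y \<in> dom_of N i. proj i y = a}"
    by (auto simp: solutions_def proj_def)
  have "solutions N i ?\<gamma> \<subseteq> (\<lambda>j. (rot i ^^ j) x) ` {..<i}"
  proof
    fix y assume "y \<in> solutions N i ?\<gamma>"
    then have "y \<in> dom_of N i" "proj i x = proj i y" using x(3) by (simp_all only: sol) simp_all
    then show "y \<in> (\<lambda>j. (rot i ^^ j) x) ` {..<i}"
      using proj_eq_imp_rot[OF x(1,2)] by (metis imageI lessThan_iff)
  qed
  then have "finite (solutions N i ?\<gamma>)" using finite_surj by blast
  moreover have "?\<gamma> \<in> forms_over circ_sig N {a} i"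
    using a x(1) by (auto simp: forms_over_def assigns_def)
  moreover have "x \<in> solutions N i ?\<gamma>" using x by (simp only: sol) simp
  moreover have "i \<in> sorts circ_sig" using x(1) by simp
  ultimately show ?thesis unfolding acl_def by blast
qed

lemma not_Lascar_strong_type_acl:
  assumes a: "a \<in> dom_of N 1"
  shows "\<not> Lascar_strong_type circ_sig N (acl circ_sig N {a})
    (tp circ_sig N (acl circ_sig N {a}) (\<lambda>x. x))"
proof
  let ?I = "acl circ_sig N {a}"
  let ?p = "tp circ_sig N ?I (\<lambda>x. x)"
  assume "Lascar_strong_type circ_sig N ?I ?p"
  moreover have I: "(\<lambda>x. x) ` ?I \<subseteq> universe circ_sig N"
    by (auto simp: acl_def solutions_def universe_def)
  then have "realizes circ_sig N ?I (\<lambda>x. x) ?p" by (simp add: realizes_def)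
  moreover have "realizes circ_sig N ?I (half_turn \<circ> (\<lambda>x. x)) ?p"
    by (rule realizes_automorphism[OF wf_sig_circ_sig struct half_turn_automorphism I])
  ultimately have "same_Lascar_type circ_sig N ?I (\<lambda>x. x) (half_turn \<circ> (\<lambda>x. x))"
    unfolding Lascar_strong_type_def by blast
  then obtain \<sigma> where \<sigma>: "\<sigma> \<in> normal_generated (Aut circ_sig N) (fixing_small_submodel circ_sig N)"
    "\<And>x. x \<in> ?I \<Longrightarrow> \<sigma> x = half_turn x"
    by (auto simp: same_Lascar_type_def)
  have "fixing_small_submodel circ_sig N \<subseteq> bounded_auts"
  proof
    fix \<tau> assume \<tau>: "\<tau> \<in> fixing_small_submodel circ_sig N"
    show "\<tau> \<in> bounded_auts"
    proof (rule bounded_autsI[where n = 1])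
      show "\<tau> \<in> automorphisms circ_sig N" using \<tau> by (simp add: fixing_small_submodel_def)
      show "(x, \<tau> x) \<in> near_rel i ^^ 1" if "2 \<le> i" "x \<in> dom_of N i" for i x
        using fixing_small_submodel_near[OF \<tau> that] by simp
    qed
  qed
  then have "\<sigma> \<in> bounded_auts"
    using \<sigma>(1) bounded_auts_normal unfolding normal_generated_def by blast
  then obtain n where n: "\<And>i x. 2 \<le> i \<Longrightarrow> x \<in> dom_of N i \<Longrightarrow> (x, \<sigma> x) \<in> near_rel i ^^ n"
    by (rule bounded_autsE) blast
  \<comment> \<open>In this sort \<open>half_turn\<close> rotates by \<open>n + 1\<close> steps, and
    together with the \<open>n\<close> rotations of \<open>near_relpow_cell\<close> by
    \<open>2 * n + 1\<close>. This is beyond every cell \<open>j \<le> 2 * n\<close> and still less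
    than a full turn, so \<open>not_cell_rot\<close> applies.\<close>
  define i where "i = 2 * n + 3"
  have i: "1 \<le> i" "2 \<le> i" "i div 2 = n + 1" by (simp_all add: i_def)
  obtain x where x: "x \<in> dom_of N i" "proj i x = a" using proj_surj[OF i(1) a] .
  have "\<sigma> x = (rot i ^^ (n + 1)) x"
    using \<sigma>(2)[OF proj_fibre_acl[OF a i(1) x]] half_turn_eq[OF i(1) x(1)] by (simp only: i(3))
  then have "(x, (rot i ^^ (n + 1)) x) \<in> near_rel i ^^ n" using n[OF i(2) x(1)] by simp
  from near_relpow_cell[OF i(2) x(1) this] obtain j where
    j: "j \<le> 2 * n" "cell i j x ((rot i ^^ n) ((rot i ^^ (n + 1)) x))" by blast
  have "(rot i ^^ n) ((rot i ^^ (n + 1)) x) = (rot i ^^ (2 * n + 1)) x"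
    by (simp only: funpow_add[symmetric] comp_apply[symmetric, of "rot i ^^ n"]) (simp add: mult_2)
  then show False
    using j not_cell_rot[OF i(2) x(1), of j "2 * n + 1"] by (simp add: i_def)
qed

end

theorem theorem3p6:
  fixes N :: "(nat, circ_fun, circ_rel, 'a) fo_struct" and a :: 'a
  assumes "is_model circ_sig N (Th circ_sig circ_struct)"
    and "saturated circ_sig N"
    and "uncountable (universe circ_sig N)"
    and "a \<in> dom_of N 1"
  shows "Lascar_strong_type circ_sig N {()} (tp circ_sig N {()} (\<lambda>_. a)) \<and>
    \<not> Lascar_strong_type circ_sig N (acl circ_sig N {a})
        (tp circ_sig N (acl circ_sig N {a}) (\<lambda>x. x))"
proof -
  interpret circ_model N by (rule circ_model.intro[OF assms(1)])
  show ?thesis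
    using Lascar_strong_type_sort_1[OF assms(2-4)] not_Lascar_strong_type_acl[OF assms(4)] ..
qed

end
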